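(* Let $\mathcal{C}$ be a $\phi$-weakly positive tensor category over $\mathbb{C}$ and let $X$ be a connected Frobenius algebra in $\mathcal{C}$ such that $\phi_X$ is an algebra isomorphism. Then every coherent sublattice of the Frobenius subalgebra poset of $X$ is finite.
   Context: Tensor categories (in the sense of Etingof–Gelaki–Nikshych–Ostrik: locally finite linear abelian rigid monoidal, bilinear tensor product, $\mathrm{End}(\mathbf 1)=\mathbb{C}$) are taken strict. A left dual of $X$ is $(X^*,\mathrm{ev}_X:X^*\otimes X\to\mathbf 1,\mathrm{coev}_X:\mathbf 1\to X\otimes X^* )$ satisfying the zigzag identities; $f^*:Y^*\to X^*$ is the dual of $f:X\to Y$. A Frobenius algebra is $(X,m,\delta,e,\epsilon)$ with $(X,m,e)$ a unital algebra, $(X,\delta,\epsilon)$ a counital coalgebra and $(\mathrm{id}_X\otimes m)\circ(\delta\otimes \mathrm{id}_X)=\delta\circ m=(m\otimes \mathrm{id}_X)\circ(\mathrm{id}_X\otimes\delta)$. It is always regarded as selfdual, $X^*=X$ (hence $X^{**}=X$), with $\mathrm{ev}_X=\epsilon\circ m$, $\mathrm{coev}_X=\delta\circ e$. $X$ is connected if $\dim\mathrm{Hom}(\mathbf 1,X)=1$. A quasi-pivotal structure is a natural isomorphism $\phi:\mathrm{id}_{\mathcal C}\to(\,)^{**}$ (not required monoidal). For $\alpha:Y\to Y^{**}$, $\mathrm{tr}(\alpha):=\mathrm{ev}_{Y^*}\circ(\alpha\otimes\mathrm{id}_{Y^*})\circ\mathrm{coev}_Y\in\mathbb{C}$. $\mathcal{C}$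 is $\phi$-weakly positive if $\phi$ is a quasi-pivotal structure with $\mathrm{tr}(\phi_Y)>0$ for every nonzero object $Y$. "$\phi_X$ is an algebra isomorphism" means $\phi_X:X\to X^{**}=X$ satisfies $m\circ(\phi_X\otimes\phi_X)=\phi_X\circ m$. A Frobenius algebra $X'$ is a Frobenius subalgebra of $X$ if there is a unital algebra monomorphism $i:X'\to X$ with $i^{**}=i$, $i^*\circ i=\mathrm{id}_{X'}$; put $b_{X'}:=i\circ i^*$. Two Frobenius subalgebras are equivalent iff their idempotents $b$ coincide; classes are denoted $[X']$; the Frobenius subalgebra poset of $X$ is the set of classes with $[X_1]\le[X_2]$ iff $b_{X_1}\circ b_{X_2}=b_{X_1}=b_{X_2}\circ b_{X_1}$. Ambient selfduality: let $C=C^*$ be selfdual and $(B,i,p)$ a split subobject ($p\circ i=\mathrm{id}_B$), $b=i\circ p$. Split $b^*=i'\circ p'$, $p'\circ i'=\mathrm{id}_{B'}$; the ambient dual of $B$ is $(B',\mathrm{ev}_C\circ(i'\otimes i),(p\otimes p')\circ\mathrm{coev}_C)$ (then $i^*=p'$, $p^*=i'$). $B$ is ambiently selfdual if it coincides with its ambient dual, i.e. one may take $B'=B$, $i'=i$, $p'=p$ (so $i^*=p$, $i^{**}=p^*=i$). A pair $(A,B)$ of subobjects of $X$ is coherent if $A$, $B$, $A\cap B$ (pullback) and $A+B$ (the join in the lattice of subobjects of $X$) are all ambiently selfdual subobjects of $X$. A sublattice $L$ of the Frobenius subalgebra poset is coherent if it has a bottom element and for all $[A],[B]\in L$ the pair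 $(A,B)$ is coherent and $[A]\wedge[B]=[A\cap B]$. *)

theory Defs
  imports Complex_Main "HOL-Algebra.Module" "HOL-Algebra.Lattice"
begin

section \<open>Strict tensor categories over the complex numbers\<close>

text \<open>
  A category is given by carrier sets of objects and of arrows; \<open>g \<cdot> f\<close> is composition in
  the order of functions and is meaningful only if \<open>Cod f = Dom g\<close>. The fields \<open>Add\<close>,
  \<open>Zer\<close> and \<open>Scl\<close> hold the linear structure of all Hom spaces at once
  (\<open>Zer X Y\<close> is the zero arrow from \<open>X\<close> to \<open>Y\<close>).
\<close>

record ('o, 'm) tcat =
  Ob :: "'o set"
  Arr :: "'m set"
  Dom :: "'m \<Rightarrow> 'o"
  Cod :: "'m \<Rightarrow> 'o"
  Idt :: "'o \<Rightarrow> 'm" (\<open>idt\<index>\<close>)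
  Cmp :: "'m \<Rightarrow> 'm \<Rightarrow> 'm" (infixl \<open>\<cdot>\<index>\<close> 65)
  Add :: "'m \<Rightarrow> 'm \<Rightarrow> 'm" (infixl \<open>\<boxplus>\<index>\<close> 60)
  Zer :: "'o \<Rightarrow> 'o \<Rightarrow> 'm"
  Scl :: "complex \<Rightarrow> 'm \<Rightarrow> 'm"
  TensO :: "'o \<Rightarrow> 'o \<Rightarrow> 'o" (infixr \<open>\<star>\<index>\<close> 75)
  TensM :: "'m \<Rightarrow> 'm \<Rightarrow> 'm" (infixr \<open>\<boxtimes>\<index>\<close> 75)
  Uni :: "'o" (\<open>\<I>\<index>\<close>)

definition mor :: "('o, 'm) tcat \<Rightarrow> 'o \<Rightarrow> 'o \<Rightarrow> 'm set" (\<open>Mor\<index>\<close>)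
  where "mor C X Y = {f \<in> Arr C. Dom C f = X \<and> Cod C f = Y}"

definition monic :: "('o, 'm) tcat \<Rightarrow> 'm \<Rightarrow> bool"
  where "monic C f \<longleftrightarrow> f \<in> Arr C \<and>
    (\<forall>Z\<in>Ob C. \<forall>g\<in>mor C Z (Dom C f). \<forall>h\<in>mor C Z (Dom C f).
       f \<cdot>\<^bsub>C\<^esub> g = f \<cdot>\<^bsub>C\<^esub> h \<longrightarrow> g = h)"

definition epic :: "('o, 'm) tcat \<Rightarrow> 'm \<Rightarrow> bool"
  where "epic C f \<longleftrightarrow> f \<in> Arr C \<and>
    (\<forall>Z\<in>Ob C. \<forall>g\<in>mor C (Cod C f) Z. \<forall>h\<in>mor C (Cod C f) Z.
       g \<cdot>\<^bsub>C\<^esub> f = h \<cdot>\<^bsub>C\<^esub> f \<longrightarrow> g = h)"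

definition iso_arr :: "('o, 'm) tcat \<Rightarrow> 'm \<Rightarrow> bool"
  where "iso_arr C f \<longleftrightarrow> f \<in> Arr C \<and>
    (\<exists>g\<in>mor C (Cod C f) (Dom C f).
       g \<cdot>\<^bsub>C\<^esub> f = Idt C (Dom C f) \<and> f \<cdot>\<^bsub>C\<^esub> g = Idt C (Cod C f))"

definition zero_object :: "('o, 'm) tcat \<Rightarrow> 'o \<Rightarrow> bool"
  where "zero_object C Z \<longleftrightarrow> Z \<in> Ob C \<and>
    (\<forall>X\<in>Ob C. (\<exists>!f. f \<in> mor C Z X) \<and> (\<exists>!f. f \<in> mor C X Z))"

definition is_kernel :: "('o, 'm) tcat \<Rightarrow> 'm \<Rightarrow> 'm \<Rightarrow> bool"
  where "is_kernel C f k \<longleftrightarrow> f \<in> Arr C \<and> k \<in> Arr C \<and> Cod C k = Dom C f \<and>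
    f \<cdot>\<^bsub>C\<^esub> k = Zer C (Dom C k) (Cod C f) \<and>
    (\<forall>Z\<in>Ob C. \<forall>g\<in>mor C Z (Dom C f). f \<cdot>\<^bsub>C\<^esub> g = Zer C Z (Cod C f) \<longrightarrow>
       (\<exists>!u. u \<in> mor C Z (Dom C k) \<and> k \<cdot>\<^bsub>C\<^esub> u = g))"

definition is_cokernel :: "('o, 'm) tcat \<Rightarrow> 'm \<Rightarrow> 'm \<Rightarrow> bool"
  where "is_cokernel C f c \<longleftrightarrow> f \<in> Arr C \<and> c \<in> Arr C \<and> Dom C c = Cod C f \<and>
    c \<cdot>\<^bsub>C\<^esub> f = Zer C (Dom C f) (Cod C c) \<and>
    (\<forall>Z\<in>Ob C. \<forall>g\<in>mor C (Cod C f) Z. g \<cdot>\<^bsub>C\<^esub> f = Zer C (Dom C f) Z \<longrightarrow>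
       (\<exists>!u. u \<in> mor C (Cod C c) Z \<and> u \<cdot>\<^bsub>C\<^esub> c = g))"

definition complex_ring :: "complex ring"
  where "complex_ring = \<lparr>carrier = UNIV, mult = (*), one = 1, zero = 0, add = (+)\<rparr>"

text \<open>The fields \<open>mult\<close> and \<open>one\<close> play no role in the locale \<open>module\<close>.\<close>

definition mor_space :: "('o, 'm) tcat \<Rightarrow> 'o \<Rightarrow> 'o \<Rightarrow> (complex, 'm) module"
  where "mor_space C X Y = \<lparr>carrier = mor C X Y, mult = undefined, one = undefined,
    zero = Zer C X Y, add = Add C, smult = Scl C\<rparr>"

definition mor_dim :: "('o, 'm) tcat \<Rightarrow> 'o \<Rightarrow> 'o \<Rightarrow> nat \<Rightarrow> bool"
  where "mor_dim C X Y n \<longleftrightarrow> (\<exists>B \<subseteq> mor C X Y. finite B \<and> card B = n \<and>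
    (\<forall>f\<in>mor C X Y. \<exists>!c. c \<in> B \<rightarrow>\<^sub>E (UNIV :: complex set) \<and>
       f = finsum (mor_space C X Y) (\<lambda>v. Scl C (c v) v) B))"

definition simple_object :: "('o, 'm) tcat \<Rightarrow> 'o \<Rightarrow> bool"
  where "simple_object C S \<longleftrightarrow> S \<in> Ob C \<and> \<not> zero_object C S \<and>
    (\<forall>f. monic C f \<and> Cod C f = S \<longrightarrow> zero_object C (Dom C f) \<or> iso_arr C f)"

text \<open>A filtration \<open>0 = Y 0 \<subseteq> \<dots> \<subseteq> Y n = X\<close> with simple quotients.\<close>

definition finite_length :: "('o, 'm) tcat \<Rightarrow> 'o \<Rightarrow> bool"
  where "finite_length C X \<longleftrightarrow> (\<exists>n Y t. zero_object C (Y 0) \<and> Y n = X \<and>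
    (\<forall>k<n. t k \<in> mor C (Y k) (Y (Suc k)) \<and> monic C (t k) \<and>
       (\<exists>q. is_cokernel C (t k) q \<and> simple_object C (Cod C q))))"

locale plain_category =
  fixes C :: "('o, 'm) tcat" (structure)
  assumes Dom_Ob: "f \<in> Arr C \<Longrightarrow> Dom C f \<in> Ob C"
    and Cod_Ob: "f \<in> Arr C \<Longrightarrow> Cod C f \<in> Ob C"
    and Idt_mor: "X \<in> Ob C \<Longrightarrow> idt X \<in> Mor X X"
    and Cmp_mor: "f \<in> Mor X Y \<Longrightarrow> g \<in> Mor Y Z \<Longrightarrow> g \<cdot> f \<in> Mor X Z"
    and Cmp_assoc: "f \<in> Mor W X \<Longrightarrow> g \<in> Mor X Y \<Longrightarrow> h \<in> Mor Y Z \<Longrightarrow>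
      (h \<cdot> g) \<cdot> f = h \<cdot> (g \<cdot> f)"
    and Idt_left: "f \<in> Mor X Y \<Longrightarrow> idt Y \<cdot> f = f"
    and Idt_right: "f \<in> Mor X Y \<Longrightarrow> f \<cdot> idt X = f"

locale linear_category = plain_category +
  assumes mor_module: "X \<in> Ob C \<Longrightarrow> Y \<in> Ob C \<Longrightarrow> Module.module complex_ring (mor_space C X Y)"
    and Cmp_Add_left: "f \<in> Mor X Y \<Longrightarrow> g \<in> Mor Y Z \<Longrightarrow> h \<in> Mor Y Z \<Longrightarrow>
      (g \<boxplus> h) \<cdot> f = (g \<cdot> f) \<boxplus> (h \<cdot> f)"
    and Cmp_Add_right: "f \<in> Mor X Y \<Longrightarrow> g \<in> Mor X Y \<Longrightarrow> h \<in> Mor Y Z \<Longrightarrow>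
      h \<cdot> (f \<boxplus> g) = (h \<cdot> f) \<boxplus> (h \<cdot> g)"
    and Cmp_Scl_left: "f \<in> Mor X Y \<Longrightarrow> g \<in> Mor Y Z \<Longrightarrow> Scl C a g \<cdot> f = Scl C a (g \<cdot> f)"
    and Cmp_Scl_right: "f \<in> Mor X Y \<Longrightarrow> g \<in> Mor Y Z \<Longrightarrow> g \<cdot> Scl C a f = Scl C a (g \<cdot> f)"

locale linear_abelian_category = linear_category +
  assumes zero_object_exists: "\<exists>Z. zero_object C Z"
    and biproduct_exists: "X \<in> Ob C \<Longrightarrow> Y \<in> Ob C \<Longrightarrow>
      \<exists>S\<in>Ob C. \<exists>i\<in>Mor X S. \<exists>j\<in>Mor Y S. \<exists>p\<in>Mor S X. \<exists>q\<in>Mor S Y.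
        p \<cdot> i = idt X \<and> q \<cdot> j = idt Y \<and> q \<cdot> i = Zer C X Y \<and> p \<cdot> j = Zer C Y X \<and>
        (i \<cdot> p) \<boxplus> (j \<cdot> q) = idt S"
    and kernel_exists: "f \<in> Arr C \<Longrightarrow> \<exists>k. is_kernel C f k"
    and cokernel_exists: "f \<in> Arr C \<Longrightarrow> \<exists>c. is_cokernel C f c"
    and monic_normal: "monic C k \<Longrightarrow> \<exists>f. is_kernel C f k"
    and epic_normal: "epic C c \<Longrightarrow> \<exists>f. is_cokernel C f c"

locale locally_finite_category = linear_abelian_category +
  assumes mor_finite_dim: "X \<in> Ob C \<Longrightarrow> Y \<in> Ob C \<Longrightarrow> \<exists>n. mor_dim C X Y n"
    and finite_length_Ob: "X \<in> Ob C \<Longrightarrow> finite_length C X"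

locale strict_monoidal_category = plain_category +
  assumes Uni_Ob: "\<I> \<in> Ob C"
    and TensO_Ob: "X \<in> Ob C \<Longrightarrow> Y \<in> Ob C \<Longrightarrow> X \<star> Y \<in> Ob C"
    and TensO_assoc: "X \<in> Ob C \<Longrightarrow> Y \<in> Ob C \<Longrightarrow> Z \<in> Ob C \<Longrightarrow>
      (X \<star> Y) \<star> Z = X \<star> (Y \<star> Z)"
    and TensO_Uni_left: "X \<in> Ob C \<Longrightarrow> \<I> \<star> X = X"
    and TensO_Uni_right: "X \<in> Ob C \<Longrightarrow> X \<star> \<I> = X"
    and TensM_mor: "f \<in> Mor X Y \<Longrightarrow> g \<in> Mor Z W \<Longrightarrow> f \<boxtimes> g \<in> Mor (X \<star> Z) (Y \<star> W)"
    and TensM_Idt: "X \<in> Ob C \<Longrightarrow> Y \<in> Ob C \<Longrightarrow> idt X \<boxtimes> idt Y = idt (X \<star> Y)"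
    and interchange: "f \<in> Mor X Y \<Longrightarrow> g \<in> Mor Y Z \<Longrightarrow> h \<in> Mor U V \<Longrightarrow> k \<in> Mor V W \<Longrightarrow>
      (g \<cdot> f) \<boxtimes> (k \<cdot> h) = (g \<boxtimes> k) \<cdot> (f \<boxtimes> h)"
    and TensM_assoc: "f \<in> Arr C \<Longrightarrow> g \<in> Arr C \<Longrightarrow> h \<in> Arr C \<Longrightarrow>
      (f \<boxtimes> g) \<boxtimes> h = f \<boxtimes> (g \<boxtimes> h)"
    and TensM_Uni_left: "f \<in> Arr C \<Longrightarrow> idt \<I> \<boxtimes> f = f"
    and TensM_Uni_right: "f \<in> Arr C \<Longrightarrow> f \<boxtimes> idt \<I> = f"


section \<open>Duals\<close>

record ('o, 'm) dual =
  dob :: 'o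
  dev :: 'm
  dcoev :: 'm

locale left_dual =
  fixes C :: "('o, 'm) tcat" (structure) and X :: 'o and d :: "('o, 'm) dual"
  assumes dob_Ob: "dob d \<in> Ob C"
    and dev_mor: "dev d \<in> Mor (dob d \<star> X) \<I>"
    and dcoev_mor: "dcoev d \<in> Mor \<I> (X \<star> dob d)"
    and zigzag: "(idt X \<boxtimes> dev d) \<cdot> (dcoev d \<boxtimes> idt X) = idt X"
    and zigzag_dual: "(dev d \<boxtimes> idt (dob d)) \<cdot> (idt (dob d) \<boxtimes> dcoev d) = idt (dob d)"

text \<open>A right dual of \<open>X\<close> is an object together with data exhibiting \<open>X\<close> as its left dual.\<close>

locale tensor_category = locally_finite_category + strict_monoidal_category +
  assumes TensM_Add_left: "f \<in> Mor X Y \<Longrightarrow> g \<in> Mor X Y \<Longrightarrow> h \<in> Mor Z W \<Longrightarrow>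
      (f \<boxplus> g) \<boxtimes> h = (f \<boxtimes> h) \<boxplus> (g \<boxtimes> h)"
    and TensM_Add_right: "f \<in> Mor X Y \<Longrightarrow> g \<in> Mor Z W \<Longrightarrow> h \<in> Mor Z W \<Longrightarrow>
      f \<boxtimes> (g \<boxplus> h) = (f \<boxtimes> g) \<boxplus> (f \<boxtimes> h)"
    and TensM_Scl_left: "f \<in> Arr C \<Longrightarrow> g \<in> Arr C \<Longrightarrow> Scl C a f \<boxtimes> g = Scl C a (f \<boxtimes> g)"
    and TensM_Scl_right: "f \<in> Arr C \<Longrightarrow> g \<in> Arr C \<Longrightarrow> f \<boxtimes> Scl C a g = Scl C a (f \<boxtimes> g)"
    and left_dual_exists: "X \<in> Ob C \<Longrightarrow> \<exists>d. left_dual C X d"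
    and right_dual_exists: "X \<in> Ob C \<Longrightarrow> \<exists>Y\<in>Ob C. \<exists>d. left_dual C Y d \<and> dob d = X"
    and End_Uni: "bij_betw (\<lambda>a. Scl C a (idt \<I>)) UNIV (Mor \<I> \<I>)"

text \<open>
  The dual arrow of \<open>f : X \<rightarrow> Y\<close> relative to left duals \<open>dX\<close> of \<open>X\<close> and \<open>dY\<close> of \<open>Y\<close>, and the
  double dual, which in addition uses left duals \<open>dX2\<close> of \<open>dob dX\<close> and \<open>dY2\<close> of \<open>dob dY\<close>.
\<close>

definition dual_arr ::
    "('o, 'm) tcat \<Rightarrow> ('o, 'm) dual \<Rightarrow> ('o, 'm) dual \<Rightarrow> 'm \<Rightarrow> 'm"
  where "dual_arr C dX dY f =
    (dev dY \<boxtimes>\<^bsub>C\<^esub> Idt C (dob dX)) \<cdot>\<^bsub>C\<^esub>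
    (Idt C (dob dY) \<boxtimes>\<^bsub>C\<^esub> f \<boxtimes>\<^bsub>C\<^esub> Idt C (dob dX)) \<cdot>\<^bsub>C\<^esub>
    (Idt C (dob dY) \<boxtimes>\<^bsub>C\<^esub> dcoev dX)"

definition ddual_arr ::
    "('o, 'm) tcat \<Rightarrow> ('o, 'm) dual \<Rightarrow> ('o, 'm) dual \<Rightarrow> ('o, 'm) dual \<Rightarrow> ('o, 'm) dual \<Rightarrow> 'm \<Rightarrow> 'm"
  where "ddual_arr C dX dX2 dY dY2 f = dual_arr C dY2 dX2 (dual_arr C dX dY f)"

text \<open>\<open>D\<close> is the choice of left duals that makes \<open>(\<^bold>\<cdot>)\<^sup>*\<close>, and hence \<open>(\<^bold>\<cdot>)\<^sup>*\<^sup>*\<close>, a functor.\<close>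

locale quasi_pivotal_category = tensor_category +
  fixes D :: "'a \<Rightarrow> ('a, 'b) dual" and \<phi> :: "'a \<Rightarrow> 'b"
  assumes D_dual: "X \<in> Ob C \<Longrightarrow> left_dual C X (D X)"
    and phi_mor: "X \<in> Ob C \<Longrightarrow> \<phi> X \<in> Mor X (dob (D (dob (D X))))"
    and phi_iso: "X \<in> Ob C \<Longrightarrow> iso_arr C (\<phi> X)"
    and phi_natural: "f \<in> Mor X Y \<Longrightarrow>
      ddual_arr C (D X) (D (dob (D X))) (D Y) (D (dob (D Y))) f \<cdot> \<phi> X = \<phi> Y \<cdot> f"

text \<open>
  The trace of \<open>\<alpha> : Y \<rightarrow> Y\<^sup>*\<^sup>*\<close>, an endomorphism of the unit object; a scalar \<open>a\<close> is identified
  with \<open>Scl C a (Idt C (Uni C))\<close>.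
\<close>

definition trace :: "('o, 'm) tcat \<Rightarrow> ('o \<Rightarrow> ('o, 'm) dual) \<Rightarrow> 'o \<Rightarrow> 'm \<Rightarrow> 'm"
  where "trace C D Y \<alpha> =
    dev (D (dob (D Y))) \<cdot>\<^bsub>C\<^esub> (\<alpha> \<boxtimes>\<^bsub>C\<^esub> Idt C (dob (D Y))) \<cdot>\<^bsub>C\<^esub> dcoev (D Y)"

locale weakly_positive_category = quasi_pivotal_category +
  assumes trace_pos: "Y \<in> Ob C \<Longrightarrow> \<not> zero_object C Y \<Longrightarrow>
    \<exists>r::real. r > 0 \<and> trace C D Y (\<phi> Y) = Scl C (complex_of_real r) (idt \<I>)"


section \<open>Frobenius algebras\<close>

record ('o, 'm) frob =
  fob :: 'o
  fmul :: 'm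
  fcomul :: 'm
  funit :: 'm
  fcounit :: 'm

locale frobenius_algebra =
  fixes C :: "('o, 'm) tcat" (structure) and F :: "('o, 'm) frob"
  assumes fob_Ob: "fob F \<in> Ob C"
    and fmul_mor: "fmul F \<in> Mor (fob F \<star> fob F) (fob F)"
    and fcomul_mor: "fcomul F \<in> Mor (fob F) (fob F \<star> fob F)"
    and funit_mor: "funit F \<in> Mor \<I> (fob F)"
    and fcounit_mor: "fcounit F \<in> Mor (fob F) \<I>"
    and mul_assoc: "fmul F \<cdot> (fmul F \<boxtimes> idt (fob F)) = fmul F \<cdot> (idt (fob F) \<boxtimes> fmul F)"
    and unit_left: "fmul F \<cdot> (funit F \<boxtimes> idt (fob F)) = idt (fob F)"
    and unit_right: "fmul F \<cdot> (idt (fob F) \<boxtimes> funit F) = idt (fob F)"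
    and comul_coassoc:
      "(fcomul F \<boxtimes> idt (fob F)) \<cdot> fcomul F = (idt (fob F) \<boxtimes> fcomul F) \<cdot> fcomul F"
    and counit_left: "(fcounit F \<boxtimes> idt (fob F)) \<cdot> fcomul F = idt (fob F)"
    and counit_right: "(idt (fob F) \<boxtimes> fcounit F) \<cdot> fcomul F = idt (fob F)"
    and frobenius_left:
      "(idt (fob F) \<boxtimes> fmul F) \<cdot> (fcomul F \<boxtimes> idt (fob F)) = fcomul F \<cdot> fmul F"
    and frobenius_right:
      "(fmul F \<boxtimes> idt (fob F)) \<cdot> (idt (fob F) \<boxtimes> fcomul F) = fcomul F \<cdot> fmul F"

text \<open>The selfduality of a Frobenius algebra.\<close>

definition frob_dual :: "('o, 'm) tcat \<Rightarrow> ('o, 'm) frob \<Rightarrow> ('o, 'm) dual"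
  where "frob_dual C F = \<lparr>dob = fob F,
    dev = fcounit F \<cdot>\<^bsub>C\<^esub> fmul F, dcoev = fcomul F \<cdot>\<^bsub>C\<^esub> funit F\<rparr>"

definition connected_frob :: "('o, 'm) tcat \<Rightarrow> ('o, 'm) frob \<Rightarrow> bool"
  where "connected_frob C F \<longleftrightarrow> mor_dim C (Uni C) (fob F) 1"

text \<open>
  Since \<open>X\<close> is regarded as selfdual, \<open>\<phi>\<^sub>X\<close> is read as an arrow \<open>X \<rightarrow> X\<^sup>*\<^sup>* = X\<close>. The choice \<open>D\<close> of
  duals need not select the Frobenius selfduality of \<open>X\<close> (one object may carry several Frobenius
  structures), so \<open>\<phi>\<^sub>X\<close> is composed with the canonical isomorphism from the double dual
  of \<open>X\<close> formed with \<open>D\<close> to the one formed with \<open>frob_dual\<close>, which is \<open>X\<close> itself; this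
  isomorphism is the double dual of the identity, and is the identity if \<open>D\<close>
  does select \<open>frob_dual\<close>.
\<close>

definition phi_frob ::
    "('o, 'm) tcat \<Rightarrow> ('o \<Rightarrow> ('o, 'm) dual) \<Rightarrow> ('o \<Rightarrow> 'm) \<Rightarrow> ('o, 'm) frob \<Rightarrow> 'm"
  where "phi_frob C D \<phi> F =
    ddual_arr C (D (fob F)) (D (dob (D (fob F)))) (frob_dual C F) (frob_dual C F)
      (Idt C (fob F)) \<cdot>\<^bsub>C\<^esub> \<phi> (fob F)"

definition multiplicative :: "('o, 'm) tcat \<Rightarrow> ('o, 'm) frob \<Rightarrow> ('o, 'm) frob \<Rightarrow> 'm \<Rightarrow> bool"
  where "multiplicative C F G f \<longleftrightarrow>
    fmul G \<cdot>\<^bsub>C\<^esub> (f \<boxtimes>\<^bsub>C\<^esub> f) = f \<cdot>\<^bsub>C\<^esub> fmul F"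


section \<open>The Frobenius subalgebra poset\<close>

text \<open>A Frobenius subalgebra is recorded together with its inclusion \<open>i\<close>.\<close>

locale frobenius_subalgebra =
  fixes C :: "('o, 'm) tcat" (structure) and F :: "('o, 'm) frob"
    and F' :: "('o, 'm) frob" and i :: 'm
  assumes sub_frob: "frobenius_algebra C F'"
    and incl_mor: "i \<in> Mor (fob F') (fob F)"
    and incl_monic: "monic C i"
    and incl_mul: "multiplicative C F' F i"
    and incl_unit: "i \<cdot> funit F' = funit F"
    and incl_ddual:
      "ddual_arr C (frob_dual C F') (frob_dual C F') (frob_dual C F) (frob_dual C F) i = i"
    and incl_split: "dual_arr C (frob_dual C F') (frob_dual C F) i \<cdot> i = idt (fob F')"

definition frob_subs :: "('o, 'm) tcat \<Rightarrow> ('o, 'm) frob \<Rightarrow> (('o, 'm) frob \<times> 'm) set"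
  where "frob_subs C F = {(F', i). frobenius_subalgebra C F F' i}"

definition sub_idem :: "('o, 'm) tcat \<Rightarrow> ('o, 'm) frob \<Rightarrow> ('o, 'm) frob \<times> 'm \<Rightarrow> 'm"
  where "sub_idem C F A =
    snd A \<cdot>\<^bsub>C\<^esub> dual_arr C (frob_dual C (fst A)) (frob_dual C F) (snd A)"

definition sub_rel ::
    "('o, 'm) tcat \<Rightarrow> ('o, 'm) frob \<Rightarrow> ((('o, 'm) frob \<times> 'm) \<times> (('o, 'm) frob \<times> 'm)) set"
  where "sub_rel C F = {(A, B). A \<in> frob_subs C F \<and> B \<in> frob_subs C F \<and>
    sub_idem C F A = sub_idem C F B}"

definition sub_class ::
    "('o, 'm) tcat \<Rightarrow> ('o, 'm) frob \<Rightarrow> ('o, 'm) frob \<times> 'm \<Rightarrow> (('o, 'm) frob \<times> 'm) set"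
  where "sub_class C F A = sub_rel C F `` {A}"

definition frob_poset ::
    "('o, 'm) tcat \<Rightarrow> ('o, 'm) frob \<Rightarrow> (('o, 'm) frob \<times> 'm) set gorder"
  where "frob_poset C F = \<lparr>carrier = frob_subs C F // sub_rel C F, eq = (=),
    le = (\<lambda>P Q. \<exists>A\<in>P. \<exists>B\<in>Q.
      sub_idem C F A \<cdot>\<^bsub>C\<^esub> sub_idem C F B = sub_idem C F A \<and>
      sub_idem C F B \<cdot>\<^bsub>C\<^esub> sub_idem C F A = sub_idem C F A)\<rparr>"


section \<open>Coherent pairs and coherent sublattices\<close>

text \<open>Subobjects are represented by monic arrows; \<open>factors C s t\<close> is the inclusion \<open>s \<le> t\<close>.\<close>

definition factors :: "('o, 'm) tcat \<Rightarrow> 'm \<Rightarrow> 'm \<Rightarrow> bool"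
  where "factors C s t \<longleftrightarrow> (\<exists>u\<in>mor C (Dom C s) (Dom C t). s = t \<cdot>\<^bsub>C\<^esub> u)"

definition sub_meet :: "('o, 'm) tcat \<Rightarrow> 'm \<Rightarrow> 'm \<Rightarrow> 'm \<Rightarrow> bool"
  where "sub_meet C i j k \<longleftrightarrow> k \<in> Arr C \<and> Cod C k = Cod C i \<and> Cod C k = Cod C j \<and>
    (\<exists>u\<in>mor C (Dom C k) (Dom C i). \<exists>v\<in>mor C (Dom C k) (Dom C j).
       i \<cdot>\<^bsub>C\<^esub> u = k \<and> j \<cdot>\<^bsub>C\<^esub> v = k \<and>
       (\<forall>Z\<in>Ob C. \<forall>f\<in>mor C Z (Dom C i). \<forall>g\<in>mor C Z (Dom C j).
          i \<cdot>\<^bsub>C\<^esub> f = j \<cdot>\<^bsub>C\<^esub> g \<longrightarrow>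
          (\<exists>!h. h \<in> mor C Z (Dom C k) \<and> u \<cdot>\<^bsub>C\<^esub> h = f \<and> v \<cdot>\<^bsub>C\<^esub> h = g)))"

definition sub_join :: "('o, 'm) tcat \<Rightarrow> 'm \<Rightarrow> 'm \<Rightarrow> 'm \<Rightarrow> bool"
  where "sub_join C i j s \<longleftrightarrow> monic C s \<and> Cod C s = Cod C i \<and> Cod C s = Cod C j \<and>
    factors C i s \<and> factors C j s \<and>
    (\<forall>t. monic C t \<and> Cod C t = Cod C s \<and> factors C i t \<and> factors C j t \<longrightarrow> factors C s t)"

definition splits :: "('o, 'm) tcat \<Rightarrow> 'm \<Rightarrow> 'm \<Rightarrow> 'm \<Rightarrow> bool"
  where "splits C b i p \<longleftrightarrow> i \<in> Arr C \<and> p \<in> mor C (Cod C i) (Dom C i) \<and>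
    p \<cdot>\<^bsub>C\<^esub> i = Idt C (Dom C i) \<and> i \<cdot>\<^bsub>C\<^esub> p = b"

text \<open>
  Let \<open>d\<close> be a selfduality of \<open>X\<close> (\<open>dob d = X\<close>). The ambient dual of a split subobject
  \<open>(B, i, p)\<close> of \<open>X\<close> is \<open>B'\<close> for a splitting \<open>(B', i', p')\<close> of \<open>(i \<cdot> p)\<^sup>*\<close>, with evaluation
  \<open>dev d \<cdot> (i' \<boxtimes> i)\<close> and coevaluation \<open>(p \<boxtimes> p') \<cdot> dcoev d\<close>; it depends on the splitting only up
  to isomorphism. \<open>(B, i, p)\<close> is ambiently selfdual if \<open>(B', i', p') = (B, i, p)\<close> is an
  admissible choice. A subobject is ambiently selfdual if this holds for some retraction \<open>p\<close> of its
  inclusion; there is at most one such \<open>p\<close>. For a Frobenius subalgebra it is \<open>p = i\<^sup>*\<close>.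
\<close>

definition ambiently_selfdual :: "('o, 'm) tcat \<Rightarrow> ('o, 'm) dual \<Rightarrow> 'm \<Rightarrow> bool"
  where "ambiently_selfdual C d i \<longleftrightarrow>
    (\<exists>p. splits C (i \<cdot>\<^bsub>C\<^esub> p) i p \<and> splits C (dual_arr C d d (i \<cdot>\<^bsub>C\<^esub> p)) i p)"

definition coherent_pair :: "('o, 'm) tcat \<Rightarrow> ('o, 'm) dual \<Rightarrow> 'm \<Rightarrow> 'm \<Rightarrow> bool"
  where "coherent_pair C d i j \<longleftrightarrow>
    ambiently_selfdual C d i \<and> ambiently_selfdual C d j \<and>
    (\<exists>k. sub_meet C i j k \<and> ambiently_selfdual C d k) \<and>
    (\<exists>s. sub_join C i j s \<and> ambiently_selfdual C d s)"

text \<open>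
  The ambient poset need not be a lattice: a sublattice is a set of classes that is a lattice in
  the induced order, and \<open>[A] \<and> [B]\<close> is the meet of that lattice. The class \<open>[A \<inter> B]\<close> is the class
  of a Frobenius subalgebra whose underlying subobject is the pullback of \<open>A\<close> and \<open>B\<close>.
\<close>

locale coherent_sublattice =
  fixes C :: "('o, 'm) tcat" (structure) and F :: "('o, 'm) frob"
    and L :: "(('o, 'm) frob \<times> 'm) set set"
  assumes L_sub: "L \<subseteq> carrier (frob_poset C F)"
    and L_lattice: "lattice (frob_poset C F\<lparr>carrier := L\<rparr>)"
    and L_bottom: "weak_partial_order_bottom (frob_poset C F\<lparr>carrier := L\<rparr>)"
    and L_coherent: "A \<in> frob_subs C F \<Longrightarrow> B \<in> frob_subs C F \<Longrightarrow>
      sub_class C F A \<in> L \<Longrightarrow> sub_class C F B \<in> L \<Longrightarrow>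
      coherent_pair C (frob_dual C F) (snd A) (snd B)"
    and L_meet: "A \<in> frob_subs C F \<Longrightarrow> B \<in> frob_subs C F \<Longrightarrow>
      sub_class C F A \<in> L \<Longrightarrow> sub_class C F B \<in> L \<Longrightarrow>
      \<exists>G\<in>frob_subs C F. sub_meet C (snd A) (snd B) (snd G) \<and>
        sub_class C F A \<sqinter>\<^bsub>frob_poset C F\<lparr>carrier := L\<rparr>\<^esub> sub_class C F B = sub_class C F G"

end

theory Submission
  imports Defs
begin

text \<open>
  Let \<open>T e\<close> be the trace of \<open>\<phi> \<cdot> e\<close> for an endomorphism \<open>e\<close> of \<open>X\<close>. Naturality of \<open>\<phi>\<close> makes \<open>T\<close>
  cyclic, so the trace of an idempotent is that of its image, and weak positivity makes it positive on
  nonzero idempotents. A Frobenius subalgebra \<open>A\<close> with inclusion \<open>i\<close> is recorded by its selfdual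
  idempotent \<open>a = i \<cdot> i\<^sup>*\<close>; the task is to show that only finitely many idempotents occur.

  The algebraic part compares two of them. The convolution of \<open>a\<close> and \<open>b\<close>, that is multiplication
  after \<open>a \<boxtimes> b\<close> after comultiplication, maps \<open>X\<close> to the product \<open>A B\<close>. Because \<open>a\<close> and \<open>b\<close> are
  bimodule maps over the subalgebras and \<open>X\<close> is connected, it is a nonzero multiple of an idempotent
  \<open>P\<close> that fixes \<open>A\<close> and \<open>B\<close>, and \<open>T (a \<cdot> b)\<close> is zero or equal to \<open>T a * T b / T P\<close>
  (\<open>product_idempotent\<close>); this is the analogue of the formula
  \<open>card (H K) = card H * card K / card (H \<inter> K)\<close> for subgroups. Coherence says that the intersection
  and the sum of \<open>A\<close> and \<open>B\<close> are direct summands of \<open>X\<close>, so \<open>T (A + B) = T A + T B - T (A \<inter> B)\<close>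
  (\<open>ptrace_sub_join\<close>), and \<open>T (A + B) \<le> T P\<close> since \<open>P\<close> fixes the sum. Together
  \<open>T (a \<cdot> b) * (T a + T b - T (A \<inter> B)) \<le> T a * T b\<close> (\<open>coherent_pair_estimate\<close>).

  By Fitting's lemma the traces of the nonzero idempotents of the finite-dimensional algebra of
  endomorphisms of \<open>X\<close> are bounded below by some \<open>\<epsilon> > 0\<close> (\<open>idempotent_trace_lower_bound\<close>). Hence for
  \<open>a \<noteq> b\<close> the intersection is smaller than \<open>A\<close> or \<open>B\<close> by at least \<open>\<epsilon>\<close>, and the estimate keeps
  \<open>T (a \<cdot> b)\<close> away from \<open>T a\<close> and \<open>T b\<close>. For infinitely many idempotents \<open>a j\<close> this is impossible:
  the matrix of the numbers \<open>T (a j \<cdot> a l)\<close> is bounded and has finite rank, so two of its rows are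
  arbitrarily close (\<open>bounded_finite_rank_close_rows\<close>). This compactness argument replaces the
  sphere packing that an inner product would give: the form \<open>T (f \<cdot> g)\<close> may be indefinite.
\<close>

section \<open>Finite rank and compactness\<close>

lemma homogeneous_system_nontrivial_solution:
  fixes a :: "nat \<Rightarrow> nat \<Rightarrow> 'a::field"
  shows "\<exists>c. (\<exists>i<Suc n. c i \<noteq> 0) \<and> (\<forall>k<n. (\<Sum>i<Suc n. c i * a i k) = 0)"
proof (induction n arbitrary: a)
  case 0
  show ?case by (intro exI[of _ "\<lambda>_. 1"]) auto
next
  case (Suc n)
  show ?case
  proof (cases "\<forall>i<Suc n. a i n = 0")
    case True
    obtain c where c: "\<exists>i<Suc n. c i \<noteq> 0" "\<forall>k<n. (\<Sum>i<Suc n. c i * a i k) = 0"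
      using Suc.IH by blast
    let ?c = "\<lambda>i. if i < Suc n then c i else 0"
    have eq: "(\<Sum>i<Suc (Suc n). ?c i * a i k) = (\<Sum>i<Suc n. c i * a i k)" for k
      by (simp add: sum.lessThan_Suc)
    show ?thesis
    proof (intro exI[of _ ?c] conjI allI impI)
      obtain i where "i < Suc n" "c i \<noteq> 0" using c(1) by blast
      then show "\<exists>i<Suc (Suc n). ?c i \<noteq> 0" by (intro exI[of _ i]) simp
      fix k assume "k < Suc n"
      then have "k < n \<or> k = n" by auto
      then show "(\<Sum>i<Suc (Suc n). ?c i * a i k) = 0"
        unfolding eq using c(2) True by auto
    qed
  next
    case False
    then obtain i0 where i0: "i0 < Suc n" "a i0 n \<noteq> 0" by blast
    \<comment> \<open>Eliminate row \<open>i0\<close>; \<open>\<sigma>\<close> enumerates the other rows and \<open>\<tau>\<close> is its inverse.\<close>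
    define \<sigma> where "\<sigma> = (\<lambda>i. if i = i0 then Suc n else i)"
    define h where "h = (\<lambda>i. a i n / a i0 n)"
    let ?b = "\<lambda>i k. a (\<sigma> i) k - h (\<sigma> i) * a i0 k"
    obtain c where c: "\<exists>i<Suc n. c i \<noteq> 0" "\<forall>k<n. (\<Sum>i<Suc n. c i * ?b i k) = 0"
      using Suc.IH[of ?b] by blast
    let ?J = "{..<Suc (Suc n)} - {i0}"
    have bij: "bij_betw \<sigma> {..<Suc n} ?J"
    proof (rule bij_betw_imageI)
      show "inj_on \<sigma> {..<Suc n}" by (auto simp: inj_on_def \<sigma>_def)
      have "j \<in> \<sigma> ` {..<Suc n}" if "j \<in> ?J" for j
        using that i0 by (cases "j = Suc n")
          (auto simp: \<sigma>_def intro!: image_eqI[where x = i0] image_eqI[where x = j])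
      then show "\<sigma> ` {..<Suc n} = ?J" using i0 by (auto simp: \<sigma>_def)
    qed
    define \<tau> where "\<tau> = (\<lambda>j. if j = Suc n then i0 else j)"
    have \<tau>\<sigma>: "\<tau> (\<sigma> i) = i" if "i < Suc n" for i using that by (auto simp: \<sigma>_def \<tau>_def)
    let ?c = "\<lambda>j. if j = i0 then - (\<Sum>i<Suc n. c i * h (\<sigma> i)) else c (\<tau> j)"
    have sums: "(\<Sum>j<Suc (Suc n). ?c j * a j k) = (\<Sum>i<Suc n. c i * ?b i k)" for k
    proof -
      have "(\<Sum>j<Suc (Suc n). ?c j * a j k)
          = ?c i0 * a i0 k + (\<Sum>j\<in>?J. ?c j * a j k)"
        using i0 by (subst sum.remove[of _ i0]) auto
      also have "(\<Sum>j\<in>?J. ?c j * a j k) = (\<Sum>j\<in>?J. c (\<tau> j) * a j k)"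
        by (rule sum.cong) auto
      also have "\<dots> = (\<Sum>i<Suc n. c (\<tau> (\<sigma> i)) * a (\<sigma> i) k)"
        by (rule sum.reindex_bij_betw[OF bij, symmetric])
      also have "\<dots> = (\<Sum>i<Suc n. c i * a (\<sigma> i) k)"
        by (rule sum.cong) (auto simp: \<tau>\<sigma>)
      finally show ?thesis
        by (simp add: algebra_simps sum_subtractf sum_distrib_left sum_distrib_right
            del: sum.lessThan_Suc)
    qed
    show ?thesis
    proof (intro exI[of _ ?c] conjI allI impI)
      obtain i where "i < Suc n" "c i \<noteq> 0" using c(1) by blast
      moreover have "\<sigma> i \<noteq> i0" "\<sigma> i < Suc (Suc n)" using \<open>i < Suc n\<close> i0 by (auto simp: \<sigma>_def)
      ultimately show "\<exists>j<Suc (Suc n). ?c j \<noteq> 0" using \<tau>\<sigma>[of i] by (intro exI[of _ "\<sigma> i"]) auto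
      fix k assume "k < Suc n"
      then consider "k < n" | "k = n" by linarith
      then show "(\<Sum>j<Suc (Suc n). ?c j * a j k) = 0"
      proof cases
        case 1 then show ?thesis unfolding sums using c(2) by blast
      next
        case 2 then show ?thesis unfolding sums using i0 by (simp add: h_def)
      qed
    qed
  qed
qed

lemma bounded_complex_subsequence:
  fixes f :: "nat \<Rightarrow> complex"
  assumes "\<And>n. norm (f n) \<le> M"
  shows "\<exists>r. strict_mono (r :: nat \<Rightarrow> nat) \<and> convergent (\<lambda>n. f (r n))"
proof -
  have real_case: "\<exists>r. strict_mono (r :: nat \<Rightarrow> nat) \<and> convergent (\<lambda>n. g (r n))"
    if "\<And>n. \<bar>g n\<bar> \<le> M" for g :: "nat \<Rightarrow> real"
  proof -
    obtain r where r: "strict_mono (r :: nat \<Rightarrow> nat)" "monoseq (\<lambda>n. g (r n))"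
      using seq_monosub by blast
    have "Bseq (\<lambda>n. g (r n))" using that by (intro BseqI'[of _ M]) simp
    then show ?thesis using r Bseq_monoseq_convergent by blast
  qed
  obtain r where r: "strict_mono r" "convergent (\<lambda>n. Re (f (r n)))"
    using real_case[of "\<lambda>n. Re (f n)"] order_trans[OF abs_Re_le_cmod assms] by blast
  obtain q where q: "strict_mono q" "convergent (\<lambda>n. Im (f (r (q n))))"
    using real_case[of "\<lambda>n. Im (f (r n))"] order_trans[OF abs_Im_le_cmod assms] by blast
  have "convergent (\<lambda>n. Re (f (r (q n))))"
    using convergent_subseq_convergent[OF r(2) q(1)] by (simp add: o_def)
  then have "convergent (\<lambda>n. f (r (q n)))"
    using q(2) unfolding convergent_def tendsto_complex_iff
    by (metis complex.sel)
  moreover have "strict_mono (\<lambda>n. r (q n))" using r(1) q(1) by (simp add: strict_mono_def)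
  ultimately show ?thesis by (intro exI[of _ "\<lambda>n. r (q n)"]) simp
qed

lemma bounded_family_subsequence:
  fixes f :: "'i \<Rightarrow> nat \<Rightarrow> complex"
  assumes "finite I" and "\<And>i. i \<in> I \<Longrightarrow> \<exists>M. \<forall>n. norm (f i n) \<le> M"
  shows "\<exists>r. strict_mono (r :: nat \<Rightarrow> nat) \<and> (\<forall>i\<in>I. convergent (\<lambda>n. f i (r n)))"
  using assms
proof (induction I rule: finite_induct)
  case empty
  show ?case by (intro exI[of _ id]) (simp add: strict_mono_def)
next
  case (insert k I)
  obtain r where r: "strict_mono r" "\<forall>i\<in>I. convergent (\<lambda>n. f i (r n))"
    using insert by blast
  obtain M where "\<forall>n. norm (f k n) \<le> M" using insert.prems by blast
  then obtain q where q: "strict_mono q" "convergent (\<lambda>n. f k (r (q n)))"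
    using bounded_complex_subsequence[of "\<lambda>n. f k (r n)" M] by blast
  have "convergent (\<lambda>n. f i (r (q n)))" if "i \<in> I" for i
    using convergent_subseq_convergent[OF bspec[OF r(2) that] q(1)] by (simp add: o_def)
  moreover have "strict_mono (\<lambda>n. r (q n))" using r(1) q(1) by (simp add: strict_mono_def)
  ultimately show ?case using q(2) by (intro exI[of _ "\<lambda>n. r (q n)"]) auto
qed

text \<open>
  Wedderburn's rank reduction: subtracting the rank one matrix through a nonzero entry of \<open>s\<close> lowers
  the number of terms, and the factors of that matrix, a column of \<open>s\<close> and a multiple of a row, are
  bounded. The given factors \<open>x\<close> and \<open>y\<close> may be unbounded.
\<close>

lemma bounded_finite_rank_factorization:
  fixes s :: "nat \<Rightarrow> nat \<Rightarrow> complex"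
  assumes "finite (I :: nat set)" and "\<And>j l. norm (s j l) \<le> M"
    and "\<And>j l. s j l = (\<Sum>i\<in>I. x i j * y i l)"
  shows "\<exists>(J :: nat set) x' y'. finite J \<and> (\<forall>j l. s j l = (\<Sum>i\<in>J. x' i j * y' i l)) \<and>
    (\<exists>K. \<forall>i\<in>J. \<forall>j. norm (x' i j :: complex) \<le> K \<and> norm (y' i j :: complex) \<le> K)"
  using assms
proof (induction "card I" arbitrary: I s M x y)
  case 0
  then have "I = {}" by simp
  then show ?case using 0 by (intro exI[of _ "{}"]) auto
next
  case (Suc n)
  show ?case
  proof (cases "\<forall>j l. s j l = 0")
    case True
    then show ?thesis by (intro exI[of _ "{}"]) auto
  next
    case False
    then obtain j0 l0 where p: "s j0 l0 \<noteq> 0" by blast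
    have "\<exists>i0\<in>I. x i0 j0 \<noteq> 0"
    proof (rule ccontr)
      assume "\<not> ?thesis"
      then have "s j0 l0 = 0" unfolding Suc.prems(3) by (intro sum.neutral) auto
      then show False using p by simp
    qed
    then obtain i0 where i0: "i0 \<in> I" "x i0 j0 \<noteq> 0" by blast
    let ?I = "I - {i0}" and ?p = "s j0 l0"
    define \<xi> where "\<xi> j = x i0 j / x i0 j0" for j
    define x' where "x' i j = x i j - \<xi> j * x i j0" for i j
    define y' where "y' i l = y i l - y i l0 * (s j0 l / ?p)" for i l
    define s' where "s' j l = s j l - s j l0 * (s j0 l / ?p)" for j l
    \<comment> \<open>Solve row \<open>j0\<close> for \<open>y i0\<close> and substitute: row \<open>j0\<close> takes the place of \<open>y i0\<close>.\<close>
    have split: "s j l = x i0 j * y i0 l + (\<Sum>i\<in>?I. x i j * y i l)" for j l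
      unfolding Suc.prems(3) using Suc.prems(1) i0(1) by (simp add: sum.remove)
    have via: "s j l = \<xi> j * s j0 l + (\<Sum>i\<in>?I. x' i j * y i l)" for j l
    proof -
      have "\<xi> j * x i0 j0 = x i0 j" using i0(2) by (simp add: \<xi>_def)
      then have "x i0 j * y i0 l = \<xi> j * (x i0 j0 * y i0 l)" by (simp add: mult.assoc [symmetric])
      then show ?thesis
        unfolding split[of j l] split[of j0 l] x'_def
        by (simp add: algebra_simps sum_subtractf sum_distrib_left del: mult_cancel_right mult_cancel_left)
    qed
    have fac: "s' j l = (\<Sum>i\<in>?I. x' i j * y' i l)" for j l
    proof -
      have "s' j l = (\<xi> j * s j0 l + (\<Sum>i\<in>?I. x' i j * y i l))
          - (\<xi> j * ?p + (\<Sum>i\<in>?I. x' i j * y i l0)) * (s j0 l / ?p)"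
        by (subst via[of j l, symmetric], subst via[of j l0, symmetric]) (simp add: s'_def)
      also have "\<dots> = (\<Sum>i\<in>?I. x' i j * y i l) - (\<Sum>i\<in>?I. x' i j * y i l0) * (s j0 l / ?p)"
        using p by (simp add: field_simps)
      also have "\<dots> = (\<Sum>i\<in>?I. x' i j * y' i l)"
        unfolding y'_def right_diff_distrib sum_subtractf by (simp only: sum_distrib_right mult.assoc)
      finally show ?thesis .
    qed
    have M0: "0 \<le> M" by (rule order_trans[OF norm_ge_zero Suc.prems(2)])
    have bdd: "norm (s j0 l / ?p) \<le> M / norm ?p" for l
      using Suc.prems(2)[of j0 l] by (simp add: norm_divide divide_right_mono)
    have bdd': "norm (s' j l) \<le> M + M * (M / norm ?p)" for j l
    proof -
      have "norm (s j l0 * (s j0 l / ?p)) \<le> M * (M / norm ?p)"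
        unfolding norm_mult using Suc.prems(2)[of j l0] bdd M0 by (intro mult_mono) auto
      then show ?thesis
        unfolding s'_def
        using Suc.prems(2)[of j l] norm_triangle_ineq4[of "s j l" "s j l0 * (s j0 l / ?p)"] by linarith
    qed
    have "n = card ?I" using Suc.hyps(2) Suc.prems(1) i0(1) by simp
    then obtain J x'' y'' K where J: "finite (J :: nat set)"
      "\<forall>j l. s' j l = (\<Sum>i\<in>J. x'' i j * y'' i l)"
      "\<forall>i\<in>J. \<forall>j. norm (x'' i j) \<le> K \<and> norm (y'' i j) \<le> K"
      using Suc.hyps(1)[of ?I s', OF _ _ bdd' fac] Suc.prems(1) by auto
    obtain m where m: "m \<notin> J" using J(1) ex_new_if_finite by blast
    let ?x = "\<lambda>i j. if i = m then s j l0 else x'' i j"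
    let ?y = "\<lambda>i l. if i = m then s j0 l / ?p else y'' i l"
    have "s j l = (\<Sum>i\<in>insert m J. ?x i j * ?y i l)" for j l
    proof -
      have "(\<Sum>i\<in>J. ?x i j * ?y i l) = s' j l"
        using m J(2) by (auto intro!: sum.cong)
      then show ?thesis using m J(1) by (simp add: s'_def)
    qed
    moreover have "\<forall>i\<in>insert m J. \<forall>j. norm (?x i j) \<le> max K (max M (M / norm ?p)) \<and>
        norm (?y i j) \<le> max K (max M (M / norm ?p))"
      using J(3) Suc.prems(2) bdd by (auto simp: le_max_iff_disj)
    ultimately show ?thesis
      using J(1) by (intro exI[of _ "insert m J"] exI[of _ ?x] exI[of _ ?y]) blast
  qed
qed

text \<open>
  Along a subsequence all left factors of a bounded factorization converge, and then the rows converge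
  uniformly because the right factors are bounded.
\<close>

lemma bounded_finite_rank_close_rows:
  fixes s :: "nat \<Rightarrow> nat \<Rightarrow> complex"
  assumes "finite (I :: nat set)" and "\<And>j l. norm (s j l) \<le> M"
    and "\<And>j l. s j l = (\<Sum>i\<in>I. x i j * y i l)" and "\<delta> > 0"
  shows "\<exists>j k. j \<noteq> k \<and> (\<forall>l. norm (s j l - s k l) < \<delta>)"
proof -
  obtain J u v where J: "finite (J :: nat set)"
    and s': "\<forall>j l. s j l = (\<Sum>i\<in>J. u i j * v i l)"
    and "\<exists>K. \<forall>i\<in>J. \<forall>j. norm (u i j :: complex) \<le> K \<and> norm (v i j :: complex) \<le> K"
    using bounded_finite_rank_factorization[of I s M x y, OF assms(1-3)] by blast
  then obtain K where K: "\<And>i j. i \<in> J \<Longrightarrow> norm (u i j) \<le> K \<and> norm (v i j) \<le> K" by blast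
  have s: "s j l = (\<Sum>i\<in>J. u i j * v i l)" for j l using s' by blast
  obtain r where r: "strict_mono r" "\<forall>i\<in>J. convergent (\<lambda>n. u i (r n))"
    using bounded_family_subsequence[OF J, of u] K by blast
  define \<eta> where "\<eta> = \<delta> / (2 * (1 + real (card J)) * (1 + \<bar>K\<bar>))"
  have \<eta>: "\<eta> > 0" using assms(4) by (simp add: \<eta>_def)
  have "\<exists>N. \<forall>m\<ge>N. \<forall>n\<ge>N. norm (u i (r m) - u i (r n)) < \<eta>" if "i \<in> J" for i
    using r(2) that \<eta> convergent_Cauchy[of "\<lambda>n. u i (r n)"] unfolding Cauchy_iff by blast
  then obtain N where N: "\<And>i m n. i \<in> J \<Longrightarrow> m \<ge> N i \<Longrightarrow> n \<ge> N i \<Longrightarrow>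
      norm (u i (r m) - u i (r n)) < \<eta>" by metis
  define m where "m = (\<Sum>i\<in>J. N i)"
  have m: "m \<ge> N i" if "i \<in> J" for i using J that by (simp add: m_def member_le_sum)
  have "norm (s (r m) l - s (r (Suc m)) l) < \<delta>" for l
  proof -
    have "norm (s (r m) l - s (r (Suc m)) l)
        = norm (\<Sum>i\<in>J. (u i (r m) - u i (r (Suc m))) * v i l)"
      unfolding s by (simp add: sum_subtractf algebra_simps)
    also have "\<dots> \<le> (\<Sum>i\<in>J. \<eta> * (1 + \<bar>K\<bar>))"
    proof (rule sum_norm_le)
      fix i assume "i \<in> J"
      then show "norm ((u i (r m) - u i (r (Suc m))) * v i l) \<le> \<eta> * (1 + \<bar>K\<bar>)"
        unfolding norm_mult using N[of i m "Suc m"] m[of i] K[of i l] \<eta>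
        by (intro mult_mono) auto
    qed
    also have "\<dots> = real (card J) * (\<eta> * (1 + \<bar>K\<bar>))" by simp
    also have "\<dots> \<le> (1 + real (card J)) * (\<eta> * (1 + \<bar>K\<bar>))"
      using \<eta> by (intro mult_right_mono) auto
    also have "\<dots> = \<delta> / 2"
    proof -
      have "(1 + real (card J)) * (1 + \<bar>K\<bar>) \<noteq> 0"
        by (smt (verit) mult_eq_0_iff of_nat_0_le_iff)
      then show ?thesis unfolding \<eta>_def by (simp add: field_simps)
    qed
    finally show ?thesis using assms(4) by simp
  qed
  moreover have "r m \<noteq> r (Suc m)" using r(1) by (metis lessI less_irrefl strict_mono_less)
  ultimately show ?thesis by blast
qed

section \<open>Linear categories\<close>

text \<open>
  The axioms are restated with \<open>Arr\<close>, \<open>Dom\<close> and \<open>Cod\<close> in place of \<open>Mor\<close>: then no premise mentions an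
  object that is absent from the conclusion, and the simplifier checks composability by itself.
\<close>

context plain_category
begin

lemma in_Mor_iff: "f \<in> Mor X Y \<longleftrightarrow> f \<in> Arr C \<and> Dom C f = X \<and> Cod C f = Y"
  by (simp add: mor_def)

lemma MorD:
  assumes "f \<in> Mor X Y"
  shows "f \<in> Arr C" "Dom C f = X" "Cod C f = Y" "X \<in> Ob C" "Y \<in> Ob C"
  using assms Dom_Ob Cod_Ob by (auto simp: in_Mor_iff)

lemma Cmp_Arr [simp]:
  assumes "f \<in> Arr C" "g \<in> Arr C" "Dom C g = Cod C f"
  shows "g \<cdot> f \<in> Arr C" "Dom C (g \<cdot> f) = Dom C f" "Cod C (g \<cdot> f) = Cod C g"
  using Cmp_mor[of f "Dom C f" "Cod C f" g "Cod C g"] assms by (auto simp: in_Mor_iff)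

lemma Idt_Arr [simp]:
  assumes "X \<in> Ob C"
  shows "idt X \<in> Arr C" "Dom C (idt X) = X" "Cod C (idt X) = X"
  using Idt_mor[OF assms] by (auto simp: in_Mor_iff)

lemma Cmp_assoc_Arr [simp]:
  assumes "f \<in> Arr C" "g \<in> Arr C" "h \<in> Arr C" "Dom C g = Cod C f" "Dom C h = Cod C g"
  shows "(h \<cdot> g) \<cdot> f = h \<cdot> (g \<cdot> f)"
  using Cmp_assoc[of f "Dom C f" "Cod C f" g "Cod C g" h "Cod C h"] assms by (auto simp: in_Mor_iff)

lemma Cmp_Idt [simp]:
  assumes "f \<in> Arr C"
  shows "Cod C f = Y \<Longrightarrow> idt Y \<cdot> f = f" "Dom C f = X \<Longrightarrow> f \<cdot> idt X = f"
  using Idt_left[of f "Dom C f" "Cod C f"] Idt_right[of f "Dom C f" "Cod C f"] assms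
  by (auto simp: in_Mor_iff)

lemma Dom_Cod_Ob [simp]: "f \<in> Arr C \<Longrightarrow> Dom C f \<in> Ob C" "f \<in> Arr C \<Longrightarrow> Cod C f \<in> Ob C"
  using Dom_Ob Cod_Ob by auto

lemma retraction_cancel:
  assumes "k \<in> Mor G X" "r \<in> Mor X G" "r \<cdot> k = idt G" "h \<in> Arr C" "Cod C h = G"
  shows "r \<cdot> (k \<cdot> h) = h"
proof -
  note [simp] = MorD(1-3)[OF assms(1)] MorD(1-3)[OF assms(2)] assms(4,5)
  have "r \<cdot> (k \<cdot> h) = (r \<cdot> k) \<cdot> h" by simp
  also have "\<dots> = h" unfolding assms(3) by simp
  finally show ?thesis .
qed

lemma monic_cancel:
  assumes "monic C k" "k \<cdot> g = k \<cdot> h" "g \<in> Mor Z (Dom C k)" "h \<in> Mor Z (Dom C k)"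
  shows "g = h"
  using assms MorD(4) unfolding monic_def by blast

end

context linear_category
begin

lemma Add_mor: "f \<in> Mor X Y \<Longrightarrow> g \<in> Mor X Y \<Longrightarrow> f \<boxplus> g \<in> Mor X Y"
  using module.axioms(2)[OF mor_module, of X Y] MorD(4,5)[of f X Y]
    abelian_group.axioms(1)[of "mor_space C X Y"]
    abelian_monoid.a_closed[of "mor_space C X Y" f g]
  by (simp add: mor_space_def)

lemma Zer_mor: "X \<in> Ob C \<Longrightarrow> Y \<in> Ob C \<Longrightarrow> Zer C X Y \<in> Mor X Y"
  using module.axioms(2)[OF mor_module, of X Y]
    abelian_group.axioms(1)[of "mor_space C X Y"]
    abelian_monoid.zero_closed[of "mor_space C X Y"]
  by (simp add: mor_space_def)

lemma Scl_mor: "f \<in> Mor X Y \<Longrightarrow> Scl C a f \<in> Mor X Y"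
  using module.smult_closed[OF mor_module, of X Y a f] MorD(4,5)[of f X Y]
  by (simp add: mor_space_def complex_ring_def)

lemma mor_abelian_monoid: "X \<in> Ob C \<Longrightarrow> Y \<in> Ob C \<Longrightarrow> abelian_monoid (mor_space C X Y)"
  using module.axioms(2)[OF mor_module] abelian_group.axioms(1) by blast

lemma Add_Arr [simp]:
  assumes "f \<in> Arr C" "g \<in> Arr C" "Dom C f = Dom C g" "Cod C f = Cod C g"
  shows "f \<boxplus> g \<in> Arr C" "Dom C (f \<boxplus> g) = Dom C g" "Cod C (f \<boxplus> g) = Cod C g"
  using Add_mor[of f "Dom C f" "Cod C f" g] assms by (auto simp: in_Mor_iff)

lemma Zer_Arr [simp]:
  assumes "X \<in> Ob C" "Y \<in> Ob C"
  shows "Zer C X Y \<in> Arr C" "Dom C (Zer C X Y) = X" "Cod C (Zer C X Y) = Y"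
  using Zer_mor[OF assms] by (auto simp: in_Mor_iff)

lemma Scl_Arr [simp]:
  assumes "f \<in> Arr C"
  shows "Scl C a f \<in> Arr C" "Dom C (Scl C a f) = Dom C f" "Cod C (Scl C a f) = Cod C f"
  using Scl_mor[of f "Dom C f" "Cod C f" a] assms by (auto simp: in_Mor_iff)

lemma Add_assoc:
  assumes "f \<in> Arr C" "g \<in> Arr C" "h \<in> Arr C" "Dom C f = Dom C g" "Cod C f = Cod C g"
    "Dom C g = Dom C h" "Cod C g = Cod C h"
  shows "(f \<boxplus> g) \<boxplus> h = f \<boxplus> (g \<boxplus> h)"
  using abelian_monoid.a_assoc[OF mor_abelian_monoid[of "Dom C f" "Cod C f"], of f g h] assms
  by (simp add: mor_space_def in_Mor_iff)

lemma Add_comm: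
  assumes "f \<in> Arr C" "g \<in> Arr C" "Dom C f = Dom C g" "Cod C f = Cod C g"
  shows "f \<boxplus> g = g \<boxplus> f"
  using abelian_monoid.a_comm[OF mor_abelian_monoid[of "Dom C f" "Cod C f"], of f g] assms
  by (simp add: mor_space_def in_Mor_iff)

lemma Add_left_comm:
  assumes "f \<in> Arr C" "g \<in> Arr C" "h \<in> Arr C" "Dom C f = Dom C g" "Cod C f = Cod C g"
    "Dom C g = Dom C h" "Cod C g = Cod C h"
  shows "f \<boxplus> (g \<boxplus> h) = g \<boxplus> (f \<boxplus> h)"
proof -
  have "f \<boxplus> (g \<boxplus> h) = (f \<boxplus> g) \<boxplus> h" using assms by (simp add: Add_assoc)
  also have "f \<boxplus> g = g \<boxplus> f" using assms by (intro Add_comm) auto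
  also have "(g \<boxplus> f) \<boxplus> h = g \<boxplus> (f \<boxplus> h)" using assms by (simp add: Add_assoc)
  finally show ?thesis .
qed

lemma Add_Zer [simp]:
  assumes "f \<in> Arr C" "Dom C f = X" "Cod C f = Y"
  shows "f \<boxplus> Zer C X Y = f" "Zer C X Y \<boxplus> f = f"
proof -
  show "f \<boxplus> Zer C X Y = f"
    using abelian_monoid.r_zero[OF mor_abelian_monoid[of X Y], of f] assms Dom_Ob Cod_Ob
    by (auto simp: mor_space_def in_Mor_iff)
  then show "Zer C X Y \<boxplus> f = f"
    using Add_comm[of "Zer C X Y" f] assms Dom_Ob[of f] Cod_Ob[of f]
    by (metis Zer_Arr)
qed

lemma Scl_Add:
  assumes "f \<in> Arr C" "g \<in> Arr C" "Dom C f = Dom C g" "Cod C f = Cod C g"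
  shows "Scl C a (f \<boxplus> g) = Scl C a f \<boxplus> Scl C a g"
  using module.smult_r_distr[OF mor_module[of "Dom C f" "Cod C f"], of a f g] assms
  by (simp add: mor_space_def in_Mor_iff complex_ring_def)

lemma Scl_plus:
  assumes "f \<in> Arr C"
  shows "Scl C (a + b) f = Scl C a f \<boxplus> Scl C b f"
  using module.smult_l_distr[OF mor_module[of "Dom C f" "Cod C f"], of a b f] assms
  by (simp add: mor_space_def in_Mor_iff complex_ring_def)

lemma Scl_Scl [simp]:
  assumes "f \<in> Arr C"
  shows "Scl C a (Scl C b f) = Scl C (a * b) f"
  using module.smult_assoc1[OF mor_module[of "Dom C f" "Cod C f"], of a b f] assms
  by (simp add: mor_space_def in_Mor_iff complex_ring_def)

lemma Scl_one [simp]: "f \<in> Arr C \<Longrightarrow> Scl C 1 f = f"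
  using module.smult_one[OF mor_module[of "Dom C f" "Cod C f"], of f]
  by (simp add: mor_space_def in_Mor_iff complex_ring_def)

lemma Scl_0 [simp]:
  assumes "f \<in> Arr C"
  shows "Scl C 0 f = Zer C (Dom C f) (Cod C f)"
  using module.smult_l_null[OF mor_module[of "Dom C f" "Cod C f"], of f] assms
  by (simp add: mor_space_def in_Mor_iff complex_ring_def)

lemma Add_neg [simp]:
  assumes "f \<in> Arr C"
  shows "f \<boxplus> Scl C (-1) f = Zer C (Dom C f) (Cod C f)"
    "Scl C (-1) f \<boxplus> f = Zer C (Dom C f) (Cod C f)"
  using Scl_plus[OF assms, of 1 "-1"] Scl_plus[OF assms, of "-1" 1] assms by auto

lemma Scl_Zer [simp]:
  assumes "X \<in> Ob C" "Y \<in> Ob C"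
  shows "Scl C a (Zer C X Y) = Zer C X Y"
  using Scl_Scl[of "Zer C X Y" a 0] Scl_0[of "Zer C X Y"] assms by simp

lemma Add_neg_cancel [simp]:
  assumes "f \<in> Arr C" "g \<in> Arr C" "Dom C f = Dom C g" "Cod C f = Cod C g"
  shows "f \<boxplus> (Scl C (-1) f \<boxplus> g) = g" "Scl C (-1) f \<boxplus> (f \<boxplus> g) = g"
  using assms by (simp_all add: Add_assoc[symmetric])

lemma Add_left_cancel:
  assumes "f \<boxplus> g = f \<boxplus> h" "f \<in> Mor X Y" "g \<in> Mor X Y" "h \<in> Mor X Y"
  shows "g = h"
  using Add_neg_cancel(2)[of f g] Add_neg_cancel(2)[of f h] assms by (simp add: in_Mor_iff)

lemma Add_right_cancel:
  assumes "g \<boxplus> f = h \<boxplus> f" "f \<in> Mor X Y" "g \<in> Mor X Y" "h \<in> Mor X Y"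
  shows "g = h"
proof (rule Add_left_cancel[OF _ assms(2-4)])
  have "f \<boxplus> g = g \<boxplus> f" "f \<boxplus> h = h \<boxplus> f"
    using assms(2-4) by (auto simp: in_Mor_iff intro!: Add_comm)
  then show "f \<boxplus> g = f \<boxplus> h" using assms(1) by (simp only:)
qed

lemma Cmp_Add [simp]:
  assumes "f \<in> Arr C" "g \<in> Arr C" "Dom C f = Dom C g" "Cod C f = Cod C g" "h \<in> Arr C"
  shows "Dom C g = Cod C h \<Longrightarrow> (f \<boxplus> g) \<cdot> h = (f \<cdot> h) \<boxplus> (g \<cdot> h)"
    "Dom C h = Cod C g \<Longrightarrow> h \<cdot> (f \<boxplus> g) = (h \<cdot> f) \<boxplus> (h \<cdot> g)"
  using Cmp_Add_left[of h "Dom C h" "Cod C h" f "Cod C f" g]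
    Cmp_Add_right[of f "Dom C f" "Cod C f" g h "Cod C h"] assms
  by (auto simp: in_Mor_iff)

lemma Cmp_Scl [simp]:
  assumes "f \<in> Arr C" "g \<in> Arr C" "Dom C g = Cod C f"
  shows "Scl C a g \<cdot> f = Scl C a (g \<cdot> f)" "g \<cdot> Scl C a f = Scl C a (g \<cdot> f)"
  using Cmp_Scl_left[of f "Dom C f" "Cod C f" g "Cod C g"]
    Cmp_Scl_right[of f "Dom C f" "Cod C f" g "Cod C g"] assms
  by (auto simp: in_Mor_iff)

lemma Cmp_Zer [simp]:
  assumes "f \<in> Arr C"
  shows "Cod C f = Y \<Longrightarrow> Z \<in> Ob C \<Longrightarrow> Zer C Y Z \<cdot> f = Zer C (Dom C f) Z"
    "Dom C f = Y \<Longrightarrow> Z \<in> Ob C \<Longrightarrow> f \<cdot> Zer C Z Y = Zer C Z (Cod C f)"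
proof -
  assume "Cod C f = Y" "Z \<in> Ob C"
  then show "Zer C Y Z \<cdot> f = Zer C (Dom C f) Z"
    using assms Cmp_Scl(1)[of f "Zer C Y Z" 0] by (auto simp del: Cmp_Scl)
next
  assume "Dom C f = Y" "Z \<in> Ob C"
  then show "f \<cdot> Zer C Z Y = Zer C Z (Cod C f)"
    using assms Cmp_Scl(2)[of "Zer C Z Y" f 0] by (auto simp del: Cmp_Scl)
qed

end

primrec lsum :: "('o, 'm) tcat \<Rightarrow> 'o \<Rightarrow> 'o \<Rightarrow> (nat \<Rightarrow> 'm) \<Rightarrow> nat \<Rightarrow> 'm" where
  "lsum C X Y f 0 = Zer C X Y"
| "lsum C X Y f (Suc n) = lsum C X Y f n \<boxplus>\<^bsub>C\<^esub> f n"

context linear_category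
begin

lemma lsum_mor:
  assumes "X \<in> Ob C" "Y \<in> Ob C" "\<And>i. i < n \<Longrightarrow> f i \<in> Mor X Y"
  shows "lsum C X Y f n \<in> Mor X Y"
  using assms(3) by (induction n) (auto intro: Add_mor Zer_mor assms(1,2))

lemma lsum_cong:
  "(\<And>i. i < n \<Longrightarrow> f i = g i) \<Longrightarrow> lsum C X Y f n = lsum C X Y g n"
  by (induction n) auto

lemma lsum_shift:
  assumes "\<And>i. i < Suc n \<Longrightarrow> f i \<in> Mor X Y"
  shows "lsum C X Y f (Suc n) = f 0 \<boxplus> lsum C X Y (\<lambda>i. f (Suc i)) n"
  using assms
proof (induction n)
  case 0
  then show ?case using MorD[of "f 0" X Y] by simp
next
  case (Suc n)
  have ob: "X \<in> Ob C" "Y \<in> Ob C" using Suc.prems[of 0] MorD by auto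
  have "lsum C X Y (\<lambda>i. f (Suc i)) n \<in> Mor X Y"
    by (rule lsum_mor[OF ob]) (use Suc.prems in auto)
  moreover have "lsum C X Y f (Suc n) = f 0 \<boxplus> lsum C X Y (\<lambda>i. f (Suc i)) n"
    using Suc by simp
  moreover have "f 0 \<in> Mor X Y" "f (Suc n) \<in> Mor X Y" using Suc.prems by simp_all
  ultimately show ?case
    by (simp add: in_Mor_iff Add_assoc lsum.simps(2)[of _ _ _ _ "Suc n"] del: lsum.simps)
       (simp add: in_Mor_iff Add_assoc)
qed

lemma lsum_Cmp_left:
  assumes "X \<in> Ob C" "\<And>i. i < n \<Longrightarrow> f i \<in> Mor X Y" "g \<in> Mor Y Z"
  shows "g \<cdot> lsum C X Y f n = lsum C X Z (\<lambda>i. g \<cdot> f i) n"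
  using assms(2)
proof (induction n)
  case 0
  then show ?case using assms(1,3) MorD[of g Y Z] by simp
next
  case (Suc n)
  have "lsum C X Y f n \<in> Mor X Y" by (rule lsum_mor) (use assms MorD Suc.prems in auto)
  moreover have "g \<cdot> lsum C X Y f n = lsum C X Z (\<lambda>i. g \<cdot> f i) n" using Suc by simp
  moreover have "f n \<in> Mor X Y" using Suc.prems by simp
  ultimately show ?case using MorD(1-3)[OF assms(3)] by (simp add: in_Mor_iff)
qed

lemma lsum_Cmp_right:
  assumes "Z \<in> Ob C" "\<And>i. i < n \<Longrightarrow> f i \<in> Mor Y Z" "g \<in> Mor X Y"
  shows "lsum C Y Z f n \<cdot> g = lsum C X Z (\<lambda>i. f i \<cdot> g) n"
  using assms(2)
proof (induction n)
  case 0
  then show ?case using assms(1,3) MorD[of g X Y] by simp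
next
  case (Suc n)
  have "lsum C Y Z f n \<in> Mor Y Z" by (rule lsum_mor) (use assms MorD Suc.prems in auto)
  moreover have "lsum C Y Z f n \<cdot> g = lsum C X Z (\<lambda>i. f i \<cdot> g) n" using Suc by simp
  moreover have "f n \<in> Mor Y Z" using Suc.prems by simp
  ultimately show ?case using MorD(1-3)[OF assms(3)] by (simp add: in_Mor_iff)
qed

lemma lsum_Scl:
  assumes "X \<in> Ob C" "Y \<in> Ob C" "\<And>i. i < n \<Longrightarrow> f i \<in> Mor X Y"
  shows "Scl C a (lsum C X Y f n) = lsum C X Y (\<lambda>i. Scl C a (f i)) n"
  using assms(3)
proof (induction n)
  case (Suc n)
  have "lsum C X Y f n \<in> Mor X Y" by (rule lsum_mor) (use assms Suc.prems in auto)
  moreover have "Scl C a (lsum C X Y f n) = lsum C X Y (\<lambda>i. Scl C a (f i)) n" using Suc by simp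
  moreover have "f n \<in> Mor X Y" using Suc.prems by simp
  ultimately show ?case by (simp add: in_Mor_iff Scl_Add)
qed (use assms in auto)

lemma lsum_Add:
  assumes "X \<in> Ob C" "Y \<in> Ob C" "\<And>i. i < n \<Longrightarrow> f i \<in> Mor X Y" "\<And>i. i < n \<Longrightarrow> g i \<in> Mor X Y"
  shows "lsum C X Y f n \<boxplus> lsum C X Y g n = lsum C X Y (\<lambda>i. f i \<boxplus> g i) n"
  using assms(3,4)
proof (induction n)
  case (Suc n)
  have "lsum C X Y f n \<in> Mor X Y" "lsum C X Y g n \<in> Mor X Y"
    by (rule lsum_mor; use Suc.prems assms(1,2) in auto)+
  moreover have "lsum C X Y (\<lambda>i. f i \<boxplus> g i) n = lsum C X Y f n \<boxplus> lsum C X Y g n"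
    using Suc by simp
  moreover have "f n \<in> Mor X Y" "g n \<in> Mor X Y" using Suc.prems by simp_all
  ultimately show ?case by (simp add: in_Mor_iff Add_assoc Add_left_comm)
qed (use assms in auto)

lemma lsum_Zer:
  assumes "X \<in> Ob C" "Y \<in> Ob C" "\<And>i. i < n \<Longrightarrow> f i = Zer C X Y"
  shows "lsum C X Y f n = Zer C X Y"
  using assms(3) by (induction n) (use assms(1,2) in auto)

lemma lsum_single:
  assumes "k < n" "f k \<in> Mor X Y" "\<And>i. i < n \<Longrightarrow> i \<noteq> k \<Longrightarrow> f i = Zer C X Y"
  shows "lsum C X Y f n = f k"
  using assms(1,3)
proof (induction n)
  case (Suc n)
  have ob: "X \<in> Ob C" "Y \<in> Ob C" using MorD[OF assms(2)] by auto
  show ?case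
  proof (cases "k = n")
    case True
    then have "lsum C X Y f n = Zer C X Y" using Suc.prems by (intro lsum_Zer[OF ob]) auto
    then show ?thesis using True assms(2) by (simp add: in_Mor_iff)
  next
    case False
    then show ?thesis using Suc assms(2) by (simp add: in_Mor_iff)
  qed
qed simp

lemma lsum_Scl_sum:
  fixes c :: "nat \<Rightarrow> complex"
  assumes "v \<in> Mor X Y"
  shows "lsum C X Y (\<lambda>i. Scl C (c i) v) n = Scl C (\<Sum>i<n. c i) v"
  using assms by (induction n) (auto simp: in_Mor_iff Scl_plus)

lemma lsum_swap:
  assumes "X \<in> Ob C" "Y \<in> Ob C" "\<And>i k. i < n \<Longrightarrow> k < m \<Longrightarrow> f i k \<in> Mor X Y"
  shows "lsum C X Y (\<lambda>i. lsum C X Y (f i) m) n = lsum C X Y (\<lambda>k. lsum C X Y (\<lambda>i. f i k) n) m"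
  using assms(3)
proof (induction n)
  case 0
  show ?case using assms(1,2) by (simp add: lsum_Zer)
next
  case (Suc n)
  have "lsum C X Y (\<lambda>k. lsum C X Y (\<lambda>i. f i k) n) m \<boxplus> lsum C X Y (f n) m
      = lsum C X Y (\<lambda>k. lsum C X Y (\<lambda>i. f i k) n \<boxplus> f n k) m"
    by (rule lsum_Add) (use assms(1,2) Suc.prems in \<open>auto intro!: lsum_mor\<close>)
  then show ?case using Suc.IH Suc.prems by simp
qed

lemma finsum_lessThan:
  assumes "X \<in> Ob C" "Y \<in> Ob C" "\<And>i. i < n \<Longrightarrow> f i \<in> Mor X Y"
  shows "finsum (mor_space C X Y) f {..<n} = lsum C X Y f n"
  using assms(3)
proof (induction n)
  case 0
  then show ?case
    using abelian_monoid.finsum_empty[OF mor_abelian_monoid[OF assms(1,2)]]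
    by (simp add: mor_space_def)
next
  case (Suc n)
  have "finsum (mor_space C X Y) f (insert n {..<n})
      = f n \<oplus>\<^bsub>mor_space C X Y\<^esub> finsum (mor_space C X Y) f {..<n}"
    by (rule abelian_monoid.finsum_insert[OF mor_abelian_monoid[OF assms(1,2)]])
      (use Suc.prems in \<open>auto simp: mor_space_def\<close>)
  also have "\<dots> = f n \<boxplus> lsum C X Y f n"
    using Suc by (simp add: mor_space_def)
  also have "\<dots> = lsum C X Y f n \<boxplus> f n"
    using lsum_mor[OF assms(1,2), of n f] Suc.prems
    by (intro Add_comm) (auto simp: in_Mor_iff)
  finally show ?case by (simp add: lessThan_Suc)
qed

lemma mor_dim_spanning:
  assumes "X \<in> Ob C" "Y \<in> Ob C" "mor_dim C X Y n"
  shows "\<exists>v. (\<forall>i<n. v i \<in> Mor X Y) \<and>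
    (\<forall>f\<in>Mor X Y. \<exists>c. f = lsum C X Y (\<lambda>i. Scl C (c i) (v i)) n)"
proof -
  obtain B where B: "B \<subseteq> Mor X Y" "finite B" "card B = n"
    and ex1: "\<forall>f\<in>Mor X Y. \<exists>!c. c \<in> B \<rightarrow>\<^sub>E (UNIV :: complex set) \<and>
      f = finsum (mor_space C X Y) (\<lambda>v. Scl C (c v) v) B"
    using assms(3) unfolding mor_dim_def by (elim exE conjE) (rule that)
  have ex: "\<exists>c. f = finsum (mor_space C X Y) (\<lambda>v. Scl C (c v) v) B" if "f \<in> Mor X Y" for f
    using ex1[rule_format, OF that] by (elim ex1E conjE) (rule exI)
  obtain v where v: "bij_betw v {..<n} B"
    using ex_bij_betw_nat_finite[OF B(2)] B(3) by (auto simp: atLeast0LessThan)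
  have vm: "v i \<in> Mor X Y" if "i < n" for i
    using v that B(1) by (auto simp: bij_betw_def)
  have "\<exists>c. f = lsum C X Y (\<lambda>i. Scl C (c i) (v i)) n" if f: "f \<in> Mor X Y" for f
  proof -
    obtain c where "f = finsum (mor_space C X Y) (\<lambda>v. Scl C (c v) v) B" using ex[OF f] by blast
    also have "B = v ` {..<n}" using v by (simp add: bij_betw_def)
    also have "finsum (mor_space C X Y) (\<lambda>v. Scl C (c v) v) (v ` {..<n})
        = finsum (mor_space C X Y) (\<lambda>i. Scl C (c (v i)) (v i)) {..<n}"
      by (rule abelian_monoid.finsum_reindex[OF mor_abelian_monoid[OF assms(1,2)]])
        (use v vm in \<open>auto simp: mor_space_def bij_betw_def intro: Scl_mor\<close>)
    also have "\<dots> = lsum C X Y (\<lambda>i. Scl C (c (v i)) (v i)) n"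
      by (rule finsum_lessThan[OF assms(1,2)]) (auto intro: Scl_mor vm)
    finally show ?thesis by (intro exI[of _ "\<lambda>i. c (v i)"])
  qed
  then show ?thesis using vm by blast
qed

text \<open>
  Coordinates with respect to \<open>n\<close> spanning arrows turn a linear relation among \<open>n + 1\<close> arrows into a
  homogeneous system with more unknowns than equations.
\<close>

lemma mor_dim_dependent:
  assumes "X \<in> Ob C" "Y \<in> Ob C" "mor_dim C X Y n" "\<And>i. i < Suc n \<Longrightarrow> f i \<in> Mor X Y"
  shows "\<exists>c. (\<exists>i<Suc n. c i \<noteq> 0) \<and> lsum C X Y (\<lambda>i. Scl C (c i) (f i)) (Suc n) = Zer C X Y"
proof -
  obtain v where v: "\<And>i. i < n \<Longrightarrow> v i \<in> Mor X Y"
    and span: "\<And>f. f \<in> Mor X Y \<Longrightarrow> \<exists>c. f = lsum C X Y (\<lambda>i. Scl C (c i) (v i)) n"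
    using mor_dim_spanning[OF assms(1-3)] by (elim exE conjE) (rule that, auto)
  have "\<forall>i. \<exists>a. i < Suc n \<longrightarrow> f i = lsum C X Y (\<lambda>k. Scl C (a k) (v k)) n"
    using span[OF assms(4)] by simp
  then obtain a where a: "\<forall>i. i < Suc n \<longrightarrow> f i = lsum C X Y (\<lambda>k. Scl C (a i k) (v k)) n"
    using choice[of "\<lambda>i a. i < Suc n \<longrightarrow> f i = lsum C X Y (\<lambda>k. Scl C (a k) (v k)) n"] by auto
  obtain c where c: "\<exists>i<Suc n. c i \<noteq> 0" "\<forall>k<n. (\<Sum>i<Suc n. c i * a i k) = 0"
    using homogeneous_system_nontrivial_solution by blast
  have "lsum C X Y (\<lambda>i. Scl C (c i) (f i)) (Suc n)
      = lsum C X Y (\<lambda>i. lsum C X Y (\<lambda>k. Scl C (c i * a i k) (v k)) n) (Suc n)"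
  proof (rule lsum_cong)
    fix i assume "i < Suc n"
    then have "Scl C (c i) (f i) = Scl C (c i) (lsum C X Y (\<lambda>k. Scl C (a i k) (v k)) n)"
      using a by simp
    also have "\<dots> = lsum C X Y (\<lambda>k. Scl C (c i) (Scl C (a i k) (v k))) n"
      by (rule lsum_Scl[OF assms(1,2)]) (auto intro: Scl_mor v)
    also have "\<dots> = lsum C X Y (\<lambda>k. Scl C (c i * a i k) (v k)) n"
      by (rule lsum_cong) (simp add: Scl_Scl[OF MorD(1)[OF v]])
    finally show "Scl C (c i) (f i) = lsum C X Y (\<lambda>k. Scl C (c i * a i k) (v k)) n" .
  qed
  also have "\<dots> = lsum C X Y (\<lambda>k. lsum C X Y (\<lambda>i. Scl C (c i * a i k) (v k)) (Suc n)) n"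
    by (rule lsum_swap[OF assms(1,2)]) (auto intro: Scl_mor v)
  also have "\<dots> = lsum C X Y (\<lambda>k. Zer C X Y) n"
  proof (rule lsum_cong)
    fix k assume "k < n"
    then show "lsum C X Y (\<lambda>i. Scl C (c i * a i k) (v k)) (Suc n) = Zer C X Y"
      using c(2) v[of k] lsum_Scl_sum[of "v k" X Y "\<lambda>i. c i * a i k" "Suc n"]
      by (simp add: in_Mor_iff del: lsum.simps sum.lessThan_Suc)
  qed
  also have "\<dots> = Zer C X Y" by (rule lsum_Zer[OF assms(1,2)]) simp
  finally show ?thesis using c(1) by blast
qed

end

section \<open>Idempotents in a finite-dimensional algebra with a positive trace\<close>

text \<open>
  A cyclic linear functional on the endomorphism algebra of \<open>X\<close>. Positivity concerns idempotents only,
  where \<open>T e\<close> stands for the dimension of the image of \<open>e\<close>.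
\<close>

locale positive_trace = linear_category +
  fixes X :: 'a and T :: "'b \<Rightarrow> complex" and d :: nat
  assumes X_Ob: "X \<in> Ob C"
    and End_dim: "mor_dim C X X d"
    and T_Add: "f \<in> Mor X X \<Longrightarrow> g \<in> Mor X X \<Longrightarrow> T (f \<boxplus> g) = T f + T g"
    and T_Scl: "f \<in> Mor X X \<Longrightarrow> T (Scl C a f) = a * T f"
    and T_cyclic: "f \<in> Mor X X \<Longrightarrow> g \<in> Mor X X \<Longrightarrow> T (f \<cdot> g) = T (g \<cdot> f)"
    and T_idem_pos: "e \<in> Mor X X \<Longrightarrow> e \<cdot> e = e \<Longrightarrow> e \<noteq> Zer C X X \<Longrightarrow>
      Im (T e) = 0 \<and> Re (T e) > 0"
begin

definition idem :: "'b \<Rightarrow> bool"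
  where "idem e \<longleftrightarrow> e \<in> Mor X X \<and> e \<cdot> e = e"

lemma EndD: "f \<in> Mor X X \<Longrightarrow> f \<in> Arr C \<and> Dom C f = X \<and> Cod C f = X"
  by (simp add: in_Mor_iff)

lemma idemD:
  assumes "idem e"
  shows "e \<in> Arr C" "Dom C e = X" "Cod C e = X" "e \<cdot> e = e" "e \<in> Mor X X"
  using assms by (auto simp: idem_def in_Mor_iff)

lemma T_Zer: "T (Zer C X X) = 0"
  using T_Scl[of "idt X" 0] X_Ob by (simp add: in_Mor_iff)

lemma T_idem: "idem e \<Longrightarrow> Im (T e) = 0 \<and> Re (T e) \<ge> 0"
  using T_idem_pos[of e] T_Zer by (cases "e = Zer C X X") (auto simp: idem_def)

lemma idem_nonzero_iff: "idem e \<Longrightarrow> e \<noteq> Zer C X X \<longleftrightarrow> Re (T e) > 0"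
  using T_idem_pos[of e] T_Zer by (auto simp: idem_def)

text \<open>
  The idempotents \<open>e\<close> and \<open>f\<close> need not commute, but \<open>f \<cdot> e\<close> is an idempotent below \<open>e\<close> with the image
  of \<open>f\<close>, and it has the same trace as \<open>f\<close> by cyclicity.
\<close>

lemma relative_complement:
  assumes e: "idem e" and f: "idem f" and ef: "e \<cdot> f = f"
  shows "idem (e \<boxplus> Scl C (-1) (f \<cdot> e))" "T (e \<boxplus> Scl C (-1) (f \<cdot> e)) = T e - T f"
proof -
  note [simp] = idemD(1-4)[OF e] idemD(1-4)[OF f] X_Ob
  have [simp]: "e \<cdot> (f \<cdot> e) = f \<cdot> e" "f \<cdot> (f \<cdot> e) = f \<cdot> e"
    using Cmp_assoc_Arr[of e f e, symmetric] Cmp_assoc_Arr[of e f f, symmetric] ef by simp_all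
  show "idem (e \<boxplus> Scl C (-1) (f \<cdot> e))"
    by (simp add: idem_def in_Mor_iff)
  have "T (f \<cdot> e) = T f" using T_cyclic[of f e] ef by (simp add: in_Mor_iff)
  then show "T (e \<boxplus> Scl C (-1) (f \<cdot> e)) = T e - T f"
    by (simp add: T_Add T_Scl in_Mor_iff)
qed

lemma T_mono:
  assumes "idem e" "idem f" "e \<cdot> f = f"
  shows "Re (T f) \<le> Re (T e)"
  using relative_complement[OF assms] T_idem by (metis Re_complex_of_real diff_ge_0_iff_ge minus_complex.sel(1))

text \<open>
  The arrows \<open>u\<close> and \<open>v\<close> restrict to inverse isomorphisms between the images of \<open>v \<cdot> (f \<cdot> u)\<close> and \<open>f\<close>.
\<close>

lemma idem_transfer:
  assumes f: "idem f" and uv: "u \<in> Mor X X" "v \<in> Mor X X" "f = u \<cdot> v"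
  shows "idem (v \<cdot> (f \<cdot> u))" "T (v \<cdot> (f \<cdot> u)) = T f"
proof -
  note [simp] = idemD(1-4)[OF f] MorD(1-3)[OF uv(1)] MorD(1-3)[OF uv(2)]
  have 2: "f \<cdot> (f \<cdot> u) = f \<cdot> u" using Cmp_assoc_Arr[of u f f] by simp
  have "u \<cdot> (v \<cdot> (f \<cdot> u)) = (u \<cdot> v) \<cdot> (f \<cdot> u)" by simp
  then have 1: "u \<cdot> (v \<cdot> (f \<cdot> u)) = f \<cdot> u" by (simp only: uv(3)[symmetric] 2)
  show "idem (v \<cdot> (f \<cdot> u))" by (simp add: idem_def in_Mor_iff 1 2)
  have "T (v \<cdot> (f \<cdot> u)) = T ((f \<cdot> u) \<cdot> v)" by (rule T_cyclic) (simp_all add: in_Mor_iff)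
  also have "(f \<cdot> u) \<cdot> v = f" using uv(3)[symmetric] by simp
  finally show "T (v \<cdot> (f \<cdot> u)) = T f" .
qed

primrec pw :: "'b \<Rightarrow> nat \<Rightarrow> 'b" where
  "pw x 0 = idt X"
| "pw x (Suc k) = x \<cdot> pw x k"

lemma pw_mor: "x \<in> Mor X X \<Longrightarrow> pw x k \<in> Mor X X"
  by (induction k) (auto intro: Cmp_mor Idt_mor X_Ob)

lemma pw_add: "x \<in> Mor X X \<Longrightarrow> pw x (m + n) = pw x m \<cdot> pw x n"
  by (induction m) (use pw_mor in \<open>auto simp: in_Mor_iff\<close>)

lemma pw_commute:
  assumes "x \<in> Mor X X" "q \<in> Mor X X" "q \<cdot> x = x \<cdot> q"
  shows "q \<cdot> pw x n = pw x n \<cdot> q"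
proof (induction n)
  case (Suc n)
  note [simp] = EndD[OF assms(1)] EndD[OF assms(2)] EndD[OF pw_mor[OF assms(1)]]
  have "q \<cdot> (x \<cdot> pw x n) = x \<cdot> (q \<cdot> pw x n)"
    using assms(3) by (simp flip: Cmp_assoc_Arr)
  then show ?case using Suc by simp
qed (use assms X_Ob in \<open>simp add: in_Mor_iff\<close>)

text \<open>Divide the relation by the lowest power of \<open>x\<close> that occurs in it.\<close>

lemma power_relation:
  assumes x: "x \<in> Mor X X"
    and "\<exists>i<N. c i \<noteq> 0" "lsum C X X (\<lambda>i. Scl C (c i) (pw x (i + k))) N = Zer C X X"
  shows "\<exists>m q. q \<in> Mor X X \<and> q \<cdot> x = x \<cdot> q \<and> pw x m = pw x (Suc m) \<cdot> q"
  using assms(2,3)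
proof (induction N arbitrary: c k)
  case (Suc N)
  note p = pw_mor[OF x]
  note [simp] = X_Ob EndD[OF x] EndD[OF p]
  let ?R = "lsum C X X (\<lambda>i. Scl C (c (Suc i)) (pw x (i + Suc k))) N"
  have S: "Scl C a (pw x j) \<in> Mor X X" for a j by (intro Scl_mor p)
  have R: "?R \<in> Mor X X" by (rule lsum_mor[OF X_Ob X_Ob S])
  have "lsum C X X (\<lambda>i. Scl C (c i) (pw x (i + k))) (Suc N) = Scl C (c 0) (pw x k) \<boxplus> ?R"
    by (subst lsum_shift) (auto intro: Scl_mor p)
  then have eq: "Scl C (c 0) (pw x k) \<boxplus> ?R = Zer C X X" using Suc.prems(2) by simp
  show ?case
  proof (cases "c 0 = 0")
    case True
    then have "?R = Zer C X X" using eq R by (simp add: in_Mor_iff)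
    moreover have "\<exists>i<N. c (Suc i) \<noteq> 0"
      using Suc.prems(1) True by (metis Suc_less_eq not0_implies_Suc)
    ultimately show ?thesis using Suc.IH[of "\<lambda>i. c (Suc i)" "Suc k"] by blast
  next
    case False
    let ?Q = "lsum C X X (\<lambda>i. Scl C (c (Suc i)) (pw x i)) N"
    have Q: "?Q \<in> Mor X X" by (rule lsum_mor) (auto intro: Scl_mor p)
    note [simp] = EndD[OF Q] EndD[OF R]
    have comm: "?Q \<cdot> x = x \<cdot> ?Q"
      by (subst lsum_Cmp_left[OF X_Ob _ x], auto intro: Scl_mor p)
         (subst lsum_Cmp_right[OF X_Ob _ x], auto intro: Scl_mor p lsum_cong
            simp: pw_commute[OF x x, symmetric])
    have "pw x (Suc k) \<cdot> ?Q = lsum C X X (\<lambda>i. pw x (Suc k) \<cdot> Scl C (c (Suc i)) (pw x i)) N"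
      by (rule lsum_Cmp_left[OF X_Ob _ p]) (auto intro: Scl_mor p)
    also have "\<dots> = ?R"
    proof (rule lsum_cong)
      fix i
      have "pw x (Suc k) \<cdot> Scl C (c (Suc i)) (pw x i) = Scl C (c (Suc i)) (pw x (Suc k) \<cdot> pw x i)"
        by (rule Cmp_Scl) auto
      also have "pw x (Suc k) \<cdot> pw x i = pw x (i + Suc k)"
        by (metis pw_add[OF x] add.commute)
      finally show "pw x (Suc k) \<cdot> Scl C (c (Suc i)) (pw x i)
        = Scl C (c (Suc i)) (pw x (i + Suc k))" .
    qed
    finally have PQ: "pw x (Suc k) \<cdot> ?Q = ?R" .
    have "Scl C (c 0) (pw x k) = Scl C (-1) ?R"
      by (rule Add_right_cancel[of _ ?R _ X X]) (simp_all add: eq in_Mor_iff del: pw.simps add_Suc_right)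
    then have "Scl C (1 / c 0) (Scl C (c 0) (pw x k)) = Scl C (1 / c 0) (Scl C (-1) ?R)"
      by (simp only:)
    then have "pw x k = Scl C (- (1 / c 0)) ?R" using False by (simp del: pw.simps add_Suc_right)
    also have "\<dots> = pw x (Suc k) \<cdot> Scl C (- (1 / c 0)) ?Q"
      using Cmp_Scl(2)[of ?Q "pw x (Suc k)" "- (1 / c 0)"] PQ by (simp del: pw.simps)
    finally show ?thesis
      using comm by (intro exI[of _ k] exI[of _ "Scl C (- (1 / c 0)) ?Q"]) (simp add: in_Mor_iff)
  qed
qed simp

text \<open>
  Fitting's lemma: a power of \<open>x\<close> agrees up to a commuting factor with the idempotent \<open>x \<cdot> z\<close>, which
  projects onto the part on which \<open>x\<close> is invertible.
\<close>

lemma fitting_idempotent: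
  assumes x: "x \<in> Mor X X"
  shows "\<exists>z m. z \<in> Mor X X \<and> x \<cdot> z = z \<cdot> x \<and> idem (x \<cdot> z) \<and>
    (x \<cdot> z = Zer C X X \<longrightarrow> pw x (Suc m) = Zer C X X)"
proof -
  note [simp] = X_Ob EndD[OF x] EndD[OF pw_mor[OF x]]
  obtain c where c: "\<exists>i<Suc d. c i \<noteq> 0"
    "lsum C X X (\<lambda>i. Scl C (c i) (pw x i)) (Suc d) = Zer C X X"
    using mor_dim_dependent[OF X_Ob X_Ob End_dim, of "pw x"] pw_mor[OF x] by blast
  then obtain m q where q: "q \<in> Mor X X" "q \<cdot> x = x \<cdot> q" "pw x m = pw x (Suc m) \<cdot> q"
    using power_relation[OF x, of "Suc d" c 0] by (auto simp del: lsum.simps)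
  note [simp] = EndD[OF q(1)] EndD[OF pw_mor[OF q(1)]]
  define M where "M = Suc m"
  have qM: "pw x M = pw x (Suc M) \<cdot> q"
  proof -
    have "pw x M = x \<cdot> pw x m" by (simp add: M_def)
    also have "\<dots> = x \<cdot> (pw x (Suc m) \<cdot> q)" by (rule arg_cong[OF q(3)])
    also have "\<dots> = pw x (Suc M) \<cdot> q" by (simp add: M_def)
    finally show ?thesis .
  qed
  have qx: "q \<cdot> pw x k = pw x k \<cdot> q" for k using pw_commute[OF x q(1,2)] .
  have xq: "pw x k \<cdot> pw q j = pw q j \<cdot> pw x k" for j k
    using pw_commute[OF q(1) pw_mor[OF x], of k j] qx by simp
  have iter: "pw x M = pw x (M + j) \<cdot> pw q j" for j
  proof (induction j)
    case (Suc j)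
    have "pw x (M + Suc j) \<cdot> pw q (Suc j) = pw x j \<cdot> (pw x (Suc M) \<cdot> q) \<cdot> pw q j"
      using pw_add[OF x, of j "Suc M"] by (simp add: add.commute del: pw.simps(2)[of x])
    also have "\<dots> = pw x (M + j) \<cdot> pw q j"
      using pw_add[OF x, of j M] qM[symmetric] by (simp add: add.commute del: pw.simps)
    finally show ?case using Suc by simp
  qed simp
  define z where "z = pw x m \<cdot> pw q M"
  have z: "z \<in> Mor X X" by (simp add: z_def in_Mor_iff)
  have xz: "x \<cdot> z = pw x M \<cdot> pw q M" by (simp add: z_def M_def del: pw.simps(2)[of q])
  have "z \<cdot> x = pw x m \<cdot> (pw q M \<cdot> pw x (Suc 0))" by (simp add: z_def)
  also have "\<dots> = pw x m \<cdot> (pw x (Suc 0) \<cdot> pw q M)" by (simp only: xq)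
  also have "\<dots> = (pw x m \<cdot> pw x (Suc 0)) \<cdot> pw q M" by simp
  also have "pw x m \<cdot> pw x (Suc 0) = pw x M" by (simp only: pw_add[OF x, symmetric] M_def) simp
  finally have zx: "x \<cdot> z = z \<cdot> x" using xz by simp
  have absorb: "pw x M \<cdot> (pw x M \<cdot> pw q M) = pw x M"
    using iter[of M] by (simp add: pw_add[OF x])
  have "(pw x M \<cdot> pw q M) \<cdot> (pw x M \<cdot> pw q M) = pw x M \<cdot> ((pw q M \<cdot> pw x M) \<cdot> pw q M)" by simp
  also have "\<dots> = (pw x M \<cdot> (pw x M \<cdot> pw q M)) \<cdot> pw q M" by (simp only: xq[symmetric]) simp
  also have "\<dots> = pw x M \<cdot> pw q M" by (simp only: absorb)
  finally have "idem (x \<cdot> z)" unfolding xz by (simp add: idem_def in_Mor_iff)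
  moreover have "pw x (Suc m) = Zer C X X" if "x \<cdot> z = Zer C X X"
  proof -
    have "pw x M = pw x M \<cdot> (pw x M \<cdot> pw q M)" by (simp only: absorb)
    also have "\<dots> = Zer C X X" unfolding xz[symmetric] that by simp
    finally show ?thesis by (simp add: M_def)
  qed
  ultimately show ?thesis using z zx by blast
qed

text \<open>
  In the corner with unit \<open>e\<close> the arrow \<open>w\<close> is a partial sum of the geometric series for the inverse of
  \<open>y = e - x\<close>, and \<open>pw x (Suc k)\<close> is the remainder.
\<close>

lemma nilpotent_complement:
  assumes "idem e" and x: "x \<in> Mor X X" "e \<cdot> x = x" "x \<cdot> e = x"
    and y: "y \<in> Mor X X" "e \<cdot> y = y" "y \<cdot> e = y" and xy: "x \<boxplus> y = e"
  shows "\<exists>w. w \<in> Mor X X \<and> y \<cdot> w \<boxplus> pw x (Suc k) = e"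
proof (induction k)
  note [simp] = X_Ob idemD(1-4)[OF assms(1)] EndD[OF x(1)] EndD[OF y(1)] EndD[OF pw_mor[OF x(1)]]
  note [simp] = x(2,3) y(2,3)
  {
    case 0
    show ?case using xy Add_comm[of x y] by (intro exI[of _ e]) (simp add: in_Mor_iff)
  next
    case (Suc k)
    then obtain w where w: "w \<in> Mor X X" "y \<cdot> w \<boxplus> pw x (Suc k) = e" by blast
    note [simp] = EndD[OF w(1)]
    have "x \<cdot> x \<boxplus> x \<cdot> y = x \<cdot> x \<boxplus> y \<cdot> x"
      using Cmp_Add(1)[of x y x] Cmp_Add(2)[of x y x] unfolding xy by simp
    then have yx: "x \<cdot> y = y \<cdot> x"
      by (rule Add_left_cancel[of _ _ _ X X]) (simp_all add: in_Mor_iff)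
    have yxw: "y \<cdot> (x \<cdot> w) = x \<cdot> (y \<cdot> w)"
      using Cmp_assoc_Arr[of w x y] Cmp_assoc_Arr[of w y x] yx by simp
    have "y \<cdot> (e \<boxplus> x \<cdot> w) \<boxplus> pw x (Suc (Suc k)) = y \<boxplus> x \<cdot> (y \<cdot> w \<boxplus> pw x (Suc k))"
      by (simp add: yxw Add_assoc)
    also have "\<dots> = e" unfolding w(2) using xy Add_comm[of x y] by simp
    finally show ?case by (intro exI[of _ "e \<boxplus> x \<cdot> w"]) (simp add: in_Mor_iff)
  }
qed

text \<open>
  Either Fitting's idempotent of \<open>x\<close> is nonzero, or \<open>x\<close> is nilpotent and \<open>y\<close> is invertible in the
  corner of \<open>e\<close>; in the second case \<open>f = e\<close>.
\<close>

lemma idempotent_in_summand: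
  assumes e: "idem e" "e \<noteq> Zer C X X" and x: "x \<in> Mor X X" "e \<cdot> x = x" "x \<cdot> e = x"
    and y: "y \<in> Mor X X" "e \<cdot> y = y" "y \<cdot> e = y" and xy: "x \<boxplus> y = e"
  shows "\<exists>f z. idem f \<and> f \<noteq> Zer C X X \<and> e \<cdot> f = f \<and> f \<cdot> e = f \<and> z \<in> Mor X X \<and>
    (f = x \<cdot> z \<or> f = y \<cdot> z)"
proof -
  note [simp] = X_Ob idemD(1-4)[OF e(1)] EndD[OF x(1)] EndD[OF y(1)]
  obtain z m where z: "z \<in> Mor X X" "x \<cdot> z = z \<cdot> x" "idem (x \<cdot> z)"
    "x \<cdot> z = Zer C X X \<Longrightarrow> pw x (Suc m) = Zer C X X"
    using fitting_idempotent[OF x(1)] by blast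
  note [simp] = EndD[OF z(1)]
  show ?thesis
  proof (cases "x \<cdot> z = Zer C X X")
    case False
    have "e \<cdot> (x \<cdot> z) = x \<cdot> z" using Cmp_assoc_Arr[of z x e] x(2) by simp
    moreover have "(x \<cdot> z) \<cdot> e = x \<cdot> z" unfolding z(2) using x(3) by simp
    ultimately show ?thesis using False z by blast
  next
    case True
    obtain w where w: "w \<in> Mor X X" "y \<cdot> w \<boxplus> pw x (Suc m) = e"
      using nilpotent_complement[OF e(1) x y xy] by blast
    then have "y \<cdot> w = e" using z(4)[OF True] EndD[OF w(1)] by simp
    then show ?thesis using e w(1) idemD(4)[OF e(1)] by metis
  qed
qed

text \<open>
  The idempotents \<open>e\<close> with \<open>p \<cdot> e = e = e \<cdot> p\<close> correspond to the direct summands of the image of \<open>p\<close>.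
\<close>

definition bounded_below :: "'b \<Rightarrow> bool"
  where "bounded_below p \<longleftrightarrow> (\<exists>\<epsilon>>0. \<forall>e. idem e \<and> p \<cdot> e = e \<and> e \<cdot> p = e \<and> e \<noteq> Zer C X X \<longrightarrow>
    \<epsilon> \<le> Re (T e))"

text \<open>
  Since \<open>f\<close> factors through \<open>p\<close>, its image is isomorphic to a direct summand of the image of \<open>p\<close>.
\<close>

lemma transfer_to_summand:
  assumes e: "idem e" and p: "idem p" and f: "idem f" "f \<noteq> Zer C X X" "e \<cdot> f = f"
    and z: "z \<in> Mor X X" "f = (e \<cdot> (p \<cdot> e)) \<cdot> z"
  shows "\<exists>g. idem g \<and> g \<noteq> Zer C X X \<and> p \<cdot> g = g \<and> g \<cdot> p = g \<and> Re (T g) \<le> Re (T e)"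
proof -
  note [simp] = X_Ob idemD(1-4)[OF e] idemD(1-4)[OF p] idemD(1-4)[OF f(1)] EndD[OF z(1)]
  let ?u = "e \<cdot> p" and ?v = "p \<cdot> (e \<cdot> z)"
  have pp: "p \<cdot> (p \<cdot> h) = p \<cdot> h" if "h \<in> Arr C" "Cod C h = X" for h
    using that Cmp_assoc_Arr[of h p p] by simp
  have "f = ?u \<cdot> ?v" using z(2) by (simp add: pp)
  then have g: "idem (?v \<cdot> (f \<cdot> ?u))" "T (?v \<cdot> (f \<cdot> ?u)) = T f"
    using idem_transfer[OF f(1), of ?u ?v] by (simp_all add: in_Mor_iff)
  have "p \<cdot> (?v \<cdot> (f \<cdot> ?u)) = ?v \<cdot> (f \<cdot> ?u)" "(?v \<cdot> (f \<cdot> ?u)) \<cdot> p = ?v \<cdot> (f \<cdot> ?u)"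
    by (simp_all add: pp)
  moreover have "Re (T f) \<le> Re (T e)" by (rule T_mono[OF e f(1,3)])
  ultimately show ?thesis using g idem_nonzero_iff f by metis
qed

text \<open>
  If \<open>e\<close> lies below \<open>p \<boxplus> q\<close>, then \<open>e = e \<cdot> p \<cdot> e \<boxplus> e \<cdot> q \<cdot> e\<close>, so a nonzero summand of \<open>e\<close> is isomorphic
  to a summand of \<open>p\<close> or of \<open>q\<close>. This is the exchange argument of the Krull-Schmidt theorem.
\<close>

lemma bounded_below_sum:
  assumes p: "idem p" "bounded_below p" and q: "idem q" "bounded_below q"
  shows "bounded_below (p \<boxplus> q)"
proof -
  obtain \<epsilon>1 where \<epsilon>1: "\<epsilon>1 > 0" "\<And>e. idem e \<Longrightarrow> p \<cdot> e = e \<Longrightarrow> e \<cdot> p = e \<Longrightarrow> e \<noteq> Zer C X X \<Longrightarrow>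
      \<epsilon>1 \<le> Re (T e)"
    using p(2) unfolding bounded_below_def by blast
  obtain \<epsilon>2 where \<epsilon>2: "\<epsilon>2 > 0" "\<And>e. idem e \<Longrightarrow> q \<cdot> e = e \<Longrightarrow> e \<cdot> q = e \<Longrightarrow> e \<noteq> Zer C X X \<Longrightarrow>
      \<epsilon>2 \<le> Re (T e)"
    using q(2) unfolding bounded_below_def by blast
  have "min \<epsilon>1 \<epsilon>2 \<le> Re (T e)"
    if e: "idem e" "(p \<boxplus> q) \<cdot> e = e" "e \<cdot> (p \<boxplus> q) = e" "e \<noteq> Zer C X X" for e
  proof -
    note [simp] = X_Ob idemD(1-4)[OF e(1)] idemD(1-4)[OF p(1)] idemD(1-4)[OF q(1)]
    have ee: "e \<cdot> (e \<cdot> h) = e \<cdot> h" if "h \<in> Arr C" "Cod C h = X" for h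
      using that Cmp_assoc_Arr[of h e e] by simp
    let ?x = "e \<cdot> (p \<cdot> e)" and ?y = "e \<cdot> (q \<cdot> e)"
    have "?x \<boxplus> ?y = e \<cdot> ((p \<boxplus> q) \<cdot> e)" by simp
    also have "\<dots> = e" by (simp only: e(2) idemD(4)[OF e(1)])
    finally have "?x \<boxplus> ?y = e" .
    then obtain f z where f: "idem f" "f \<noteq> Zer C X X" "e \<cdot> f = f" "z \<in> Mor X X"
      "f = ?x \<cdot> z \<or> f = ?y \<cdot> z"
      using idempotent_in_summand[OF e(1,4), of ?x ?y] by (auto simp: in_Mor_iff ee)
    from f(5) show ?thesis
    proof
      assume "f = ?x \<cdot> z"
      then show ?thesis
        using transfer_to_summand[OF e(1) p(1) f(1-4)] \<epsilon>1(2) by force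
    next
      assume "f = ?y \<cdot> z"
      then show ?thesis
        using transfer_to_summand[OF e(1) q(1) f(1-4)] \<epsilon>2(2) by force
    qed
  qed
  then show ?thesis
    unfolding bounded_below_def using \<epsilon>1(1) \<epsilon>2(1) by (intro exI[of _ "min \<epsilon>1 \<epsilon>2"]) auto
qed

text \<open>
  Without a proper nonzero idempotent below \<open>p\<close>, the number \<open>Re (T p)\<close> itself would be a lower bound.
\<close>

lemma not_bounded_below_split:
  assumes p: "idem p" "\<not> bounded_below p"
  shows "\<exists>e f. idem e \<and> \<not> bounded_below e \<and> idem f \<and> f \<noteq> Zer C X X \<and> p \<cdot> e = e \<and> e \<cdot> p = e \<and>
    p \<cdot> f = f \<and> f \<cdot> p = f \<and> e \<cdot> f = Zer C X X \<and> f \<cdot> e = Zer C X X"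
proof -
  have "p \<noteq> Zer C X X"
  proof
    assume "p = Zer C X X"
    then have "e = Zer C X X" if "idem e" "p \<cdot> e = e" for e
      using that idemD[OF that(1)] X_Ob by auto
    then have "bounded_below p" unfolding bounded_below_def by (intro exI[of _ 1]) auto
    then show False using p by simp
  qed
  then have "Re (T p) > 0" using p idem_nonzero_iff by blast
  have "\<exists>e. idem e \<and> p \<cdot> e = e \<and> e \<cdot> p = e \<and> e \<noteq> Zer C X X \<and> e \<noteq> p"
  proof (rule ccontr)
    assume "\<not> ?thesis"
    then have "bounded_below p"
      unfolding bounded_below_def using \<open>Re (T p) > 0\<close> by (intro exI[of _ "Re (T p)"]) auto
    then show False using p by simp
  qed
  then obtain e where e: "idem e" "p \<cdot> e = e" "e \<cdot> p = e" "e \<noteq> Zer C X X" "e \<noteq> p" by blast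
  let ?f = "p \<boxplus> Scl C (-1) e"
  note [simp] = X_Ob idemD(1-4)[OF p(1)] idemD(1-4)[OF e(1)] e(2,3)
  have f: "idem ?f" using relative_complement(1)[OF p(1) e(1,2)] by simp
  have sum: "e \<boxplus> ?f = p"
    using Add_left_comm[of e p "Scl C (-1) e"] by simp
  have nz: "?f \<noteq> Zer C X X"
  proof
    assume "?f = Zer C X X"
    then have "e = p" using sum by simp
    then show False using e(5) by simp
  qed
  have rel: "p \<cdot> ?f = ?f" "?f \<cdot> p = ?f" "e \<cdot> ?f = Zer C X X" "?f \<cdot> e = Zer C X X" by simp_all
  have "\<not> bounded_below e \<or> \<not> bounded_below ?f"
    using bounded_below_sum[OF e(1) _ f] sum p(2) by auto
  then show ?thesis using e f nz rel by metis
qed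

lemma orthogonal_family:
  assumes "\<not> bounded_below (idt X)"
  shows "\<exists>p q. idem p \<and> \<not> bounded_below p \<and>
    (\<forall>i<k::nat. idem (q i) \<and> q i \<noteq> Zer C X X \<and> q i \<cdot> p = Zer C X X \<and> p \<cdot> q i = Zer C X X) \<and>
    (\<forall>i<k. \<forall>j<k. i \<noteq> j \<longrightarrow> q i \<cdot> q j = Zer C X X)"
proof (induction k)
  case 0
  show ?case using assms X_Ob by (intro exI[of _ "idt X"]) (simp add: idem_def in_Mor_iff)
next
  case (Suc k)
  then obtain p q where p: "idem p" "\<not> bounded_below p"
    and q: "\<And>i. i < k \<Longrightarrow> idem (q i) \<and> q i \<noteq> Zer C X X \<and> q i \<cdot> p = Zer C X X \<and> p \<cdot> q i = Zer C X X"
    and qq: "\<And>i j. i < k \<Longrightarrow> j < k \<Longrightarrow> i \<noteq> j \<Longrightarrow> q i \<cdot> q j = Zer C X X" by blast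
  obtain e f where ef: "idem e" "\<not> bounded_below e" "idem f" "f \<noteq> Zer C X X" "p \<cdot> e = e" "e \<cdot> p = e"
    "p \<cdot> f = f" "f \<cdot> p = f" "e \<cdot> f = Zer C X X" "f \<cdot> e = Zer C X X"
    using not_bounded_below_split[OF p] by blast
  have orth: "q i \<cdot> h = Zer C X X \<and> h \<cdot> q i = Zer C X X"
    if "i < k" "idem h" "p \<cdot> h = h" "h \<cdot> p = h" for i h
  proof -
    note [simp] = X_Ob idemD(1-4)[OF p(1)] idemD(1-4)[OF that(2)] idemD(1-4)[of "q i"]
    have qi: "idem (q i)" "q i \<cdot> p = Zer C X X" "p \<cdot> q i = Zer C X X" using q that by auto
    have "q i \<cdot> h = (q i \<cdot> p) \<cdot> h" using qi(1) that(3) by simp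
    also have "\<dots> = Zer C X X" unfolding qi(2) by simp
    finally have 1: "q i \<cdot> h = Zer C X X" .
    have "h \<cdot> q i = h \<cdot> (p \<cdot> q i)" using qi(1) that(4) Cmp_assoc_Arr[of "q i" p h] by simp
    also have "\<dots> = Zer C X X" unfolding qi(3) by simp
    finally show ?thesis using 1 by simp
  qed
  show ?case
    using ef q qq orth
    by (intro exI[of _ e] exI[of _ "q(k := f)"]) (auto simp: less_Suc_eq)
qed

text \<open>
  Otherwise splitting never ends and yields orthogonal families of any size, but nonzero orthogonal
  idempotents are linearly independent.
\<close>

theorem idempotent_trace_lower_bound:
  "\<exists>\<epsilon>>0. \<forall>e. idem e \<and> e \<noteq> Zer C X X \<longrightarrow> \<epsilon> \<le> Re (T e)"
proof -
  have "bounded_below (idt X)"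
  proof (rule ccontr)
    assume "\<not> ?thesis"
    then obtain q where q: "\<And>i. i < Suc d \<Longrightarrow> idem (q i) \<and> q i \<noteq> Zer C X X"
      and qq: "\<And>i j. i < Suc d \<Longrightarrow> j < Suc d \<Longrightarrow> i \<noteq> j \<Longrightarrow> q i \<cdot> q j = Zer C X X"
      using orthogonal_family[of "Suc d"] by blast
    have qm: "q i \<in> Mor X X" if "i < Suc d" for i using q[OF that] idemD(5) by blast
    obtain c j where c: "j < Suc d" "c j \<noteq> 0"
      "lsum C X X (\<lambda>i. Scl C (c i) (q i)) (Suc d) = Zer C X X"
      using mor_dim_dependent[OF X_Ob X_Ob End_dim, of q] qm by blast
    note [simp] = X_Ob EndD[OF qm[OF c(1)]] idemD(4)[OF q[OF c(1), THEN conjunct1]]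
    have "lsum C X X (\<lambda>i. Scl C (c i) (q i)) (Suc d) \<cdot> q j
        = lsum C X X (\<lambda>i. Scl C (c i) (q i) \<cdot> q j) (Suc d)"
      by (rule lsum_Cmp_right[OF X_Ob _ qm[OF c(1)]]) (auto intro: Scl_mor qm)
    also have "\<dots> = Scl C (c j) (q j) \<cdot> q j"
    proof (rule lsum_single[OF c(1)])
      show "Scl C (c j) (q j) \<cdot> q j \<in> Mor X X" by (simp add: in_Mor_iff)
      fix i assume "i < Suc d" "i \<noteq> j"
      then show "Scl C (c i) (q i) \<cdot> q j = Zer C X X"
        using qq[of i j] c(1) EndD[OF qm[of i]] by simp
    qed
    finally have "Scl C (c j) (q j) = Zer C X X" unfolding c(3) by simp
    then have "Scl C (1 / c j) (Scl C (c j) (q j)) = Scl C (1 / c j) (Zer C X X)" by (simp only:)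
    then have "q j = Zer C X X" using c(2) by simp
    then show False using q[OF c(1)] by blast
  qed
  then show ?thesis
    unfolding bounded_below_def using idemD by (metis Cmp_Idt)
qed

lemma T_lsum:
  assumes "\<And>i. i < n \<Longrightarrow> f i \<in> Mor X X"
  shows "T (lsum C X X f n) = (\<Sum>i<n. T (f i))"
  using assms
proof (induction n)
  case 0
  show ?case by (simp add: T_Zer)
next
  case (Suc n)
  have "lsum C X X f n \<in> Mor X X" by (rule lsum_mor[OF X_Ob X_Ob]) (use Suc.prems in auto)
  then show ?case using Suc by (simp add: T_Add)
qed

lemma trace_form_finite_rank:
  assumes "\<And>j. a j \<in> Mor X X"
  shows "\<exists>x y. \<forall>j l. T (a j \<cdot> a l) = (\<Sum>i<d. x i j * y i l)"
proof -
  obtain v where v: "\<And>i. i < d \<Longrightarrow> v i \<in> Mor X X"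
    and span: "\<And>f. f \<in> Mor X X \<Longrightarrow> \<exists>c. f = lsum C X X (\<lambda>i. Scl C (c i) (v i)) d"
    using mor_dim_spanning[OF X_Ob X_Ob End_dim] by (elim exE conjE) (rule that, auto)
  have "\<forall>j. \<exists>c. a j = lsum C X X (\<lambda>i. Scl C (c i) (v i)) d" using span[OF assms] by blast
  then obtain c where c: "\<And>j. a j = lsum C X X (\<lambda>i. Scl C (c j i) (v i)) d"
    using choice[of "\<lambda>j c. a j = lsum C X X (\<lambda>i. Scl C (c i) (v i)) d"] by auto
  have "T (a j \<cdot> a l) = (\<Sum>i<d. c j i * T (v i \<cdot> a l))" for j l
  proof -
    have "a j \<cdot> a l = lsum C X X (\<lambda>i. Scl C (c j i) (v i)) d \<cdot> a l" using c[of j] by simp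
    also have "\<dots> = lsum C X X (\<lambda>i. Scl C (c j i) (v i) \<cdot> a l) d"
      by (rule lsum_Cmp_right[OF X_Ob _ assms]) (auto intro: Scl_mor v)
    finally have "T (a j \<cdot> a l) = (\<Sum>i<d. T (Scl C (c j i) (v i) \<cdot> a l))"
      using T_lsum[of d "\<lambda>i. Scl C (c j i) (v i) \<cdot> a l"] by (auto intro: Cmp_mor Scl_mor v assms)
    also have "\<dots> = (\<Sum>i<d. c j i * T (v i \<cdot> a l))"
    proof (rule sum.cong)
      fix i assume "i \<in> {..<d}"
      then have vi: "v i \<in> Mor X X" using v by simp
      have "Scl C (c j i) (v i) \<cdot> a l = Scl C (c j i) (v i \<cdot> a l)"
        by (rule Cmp_Scl(1)) (use MorD[OF vi] MorD[OF assms[of l]] in simp_all)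
      then show "T (Scl C (c j i) (v i) \<cdot> a l) = c j i * T (v i \<cdot> a l)"
        using T_Scl[OF Cmp_mor[OF assms vi]] by simp
    qed simp
    finally show ?thesis .
  qed
  then show ?thesis by (intro exI[of _ "\<lambda>i j. c j i"] exI[of _ "\<lambda>i l. T (v i \<cdot> a l)"]) blast
qed

end

section \<open>Duals and traces\<close>

context strict_monoidal_category
begin

lemmas TensO_simps [simp] = Uni_Ob TensO_Ob TensO_assoc TensO_Uni_left TensO_Uni_right

lemma TensM_Arr [simp]:
  assumes "f \<in> Arr C" "g \<in> Arr C"
  shows "f \<boxtimes> g \<in> Arr C" "Dom C (f \<boxtimes> g) = Dom C f \<star> Dom C g" "Cod C (f \<boxtimes> g) = Cod C f \<star> Cod C g"
  using TensM_mor[of f "Dom C f" "Cod C f" g "Dom C g" "Cod C g"] assms by (auto simp: in_Mor_iff)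

lemmas TensM_simps [simp] = TensM_assoc TensM_Uni_left TensM_Uni_right

lemma interchange_Arr:
  assumes "f \<in> Arr C" "g \<in> Arr C" "h \<in> Arr C" "k \<in> Arr C" "Dom C g = Cod C f" "Dom C k = Cod C h"
  shows "(g \<boxtimes> k) \<cdot> (f \<boxtimes> h) = (g \<cdot> f) \<boxtimes> (k \<cdot> h)"
  using interchange[of f "Dom C f" "Cod C f" g "Cod C g" h "Dom C h" "Cod C h" k "Cod C k"] assms
  by (simp add: in_Mor_iff)

lemma Idt_TensO: "X \<in> Ob C \<Longrightarrow> Y \<in> Ob C \<Longrightarrow> idt (X \<star> Y) = idt X \<boxtimes> idt Y"
  using TensM_Idt by simp

text \<open>Arrows into or out of the unit object slide past other arrows.\<close>

lemma slide_to_unit: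
  assumes "n \<in> Arr C" "m \<in> Arr C" "Cod C n = \<I>" "Dom C m = B"
  shows "m \<cdot> (n \<boxtimes> idt B) = n \<boxtimes> m" "m \<cdot> (idt B \<boxtimes> n) = m \<boxtimes> n"
  using interchange_Arr[of n "idt \<I>" "idt B" m] interchange_Arr[of "idt B" m n "idt \<I>"] assms
  by auto

lemma slide_from_unit:
  assumes "n \<in> Arr C" "m \<in> Arr C" "Dom C n = \<I>" "Cod C m = B"
  shows "(n \<boxtimes> idt B) \<cdot> m = n \<boxtimes> m" "(idt B \<boxtimes> n) \<cdot> m = m \<boxtimes> n"
  using interchange_Arr[of "idt \<I>" n m "idt B"] interchange_Arr[of m "idt B" "idt \<I>" n] assms
  by auto

text \<open>
  The bijection between arrows \<open>Z \<star> X \<rightarrow> \<I>\<close> and arrows from \<open>Z\<close> to the dual of \<open>X\<close>; its inverse is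
  composition with the evaluation (\<open>dev_curry_dual\<close> and \<open>curry_dual_dev\<close>).
\<close>

definition curry_dual :: "('a, 'b) dual \<Rightarrow> 'a \<Rightarrow> 'b \<Rightarrow> 'b"
  where "curry_dual d Z n = (n \<boxtimes> idt (dob d)) \<cdot> (idt Z \<boxtimes> dcoev d)"

lemma left_dual_simps:
  assumes "left_dual C X d"
  shows "dob d \<in> Ob C" "dev d \<in> Arr C" "Dom C (dev d) = dob d \<star> X" "Cod C (dev d) = \<I>"
    "dcoev d \<in> Arr C" "Dom C (dcoev d) = \<I>" "Cod C (dcoev d) = X \<star> dob d"
  using left_dual.dob_Ob[OF assms] left_dual.dev_mor[OF assms] left_dual.dcoev_mor[OF assms]
  by (auto simp: in_Mor_iff)

lemma curry_dual_mor:
  assumes "X \<in> Ob C" "Z \<in> Ob C" "left_dual C X d" "n \<in> Mor (Z \<star> X) \<I>"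
  shows "curry_dual d Z n \<in> Mor Z (dob d)"
  using assms(1,2) MorD(1-3)[OF assms(4)] left_dual_simps[OF assms(3)]
  by (simp add: curry_dual_def in_Mor_iff)

lemma dev_curry_dual:
  assumes "X \<in> Ob C" "Z \<in> Ob C" "left_dual C X d" "n \<in> Mor (Z \<star> X) \<I>"
  shows "dev d \<cdot> (curry_dual d Z n \<boxtimes> idt X) = n"
proof -
  note [simp] = assms(1,2) MorD(1-3)[OF assms(4)] left_dual_simps[OF assms(3)]
  have "curry_dual d Z n \<boxtimes> idt X
      = (n \<boxtimes> idt (dob d) \<boxtimes> idt X) \<cdot> (idt Z \<boxtimes> dcoev d \<boxtimes> idt X)"
    using interchange_Arr[of "idt Z \<boxtimes> dcoev d" "n \<boxtimes> idt (dob d)" "idt X" "idt X"]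
    by (simp add: curry_dual_def)
  then have "dev d \<cdot> (curry_dual d Z n \<boxtimes> idt X)
      = (dev d \<cdot> (n \<boxtimes> idt (dob d \<star> X))) \<cdot> (idt Z \<boxtimes> dcoev d \<boxtimes> idt X)"
    by (simp add: Idt_TensO)
  also have "dev d \<cdot> (n \<boxtimes> idt (dob d \<star> X)) = n \<cdot> (idt (Z \<star> X) \<boxtimes> dev d)"
    by (simp add: slide_to_unit)
  also have "(n \<cdot> (idt (Z \<star> X) \<boxtimes> dev d)) \<cdot> (idt Z \<boxtimes> dcoev d \<boxtimes> idt X)
      = n \<cdot> (idt Z \<boxtimes> ((idt X \<boxtimes> dev d) \<cdot> (dcoev d \<boxtimes> idt X)))"
    by (simp add: Idt_TensO interchange_Arr)
  also have "\<dots> = n"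
    unfolding left_dual.zigzag[OF assms(3)] by (simp add: TensM_Idt)
  finally show ?thesis .
qed

lemma curry_dual_dev:
  assumes "X \<in> Ob C" "left_dual C X d" "h \<in> Mor Z (dob d)"
  shows "curry_dual d Z (dev d \<cdot> (h \<boxtimes> idt X)) = h"
proof -
  note [simp] = assms(1) MorD[OF assms(3)] left_dual_simps[OF assms(2)]
  have "curry_dual d Z (dev d \<cdot> (h \<boxtimes> idt X))
      = (dev d \<boxtimes> idt (dob d)) \<cdot> ((h \<boxtimes> idt X \<boxtimes> idt (dob d)) \<cdot> (idt Z \<boxtimes> dcoev d))"
    using interchange_Arr[of "h \<boxtimes> idt X" "dev d" "idt (dob d)" "idt (dob d)", symmetric]
    by (simp add: curry_dual_def)
  also have "(h \<boxtimes> idt X \<boxtimes> idt (dob d)) \<cdot> (idt Z \<boxtimes> dcoev d) = h \<boxtimes> dcoev d"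
    using interchange_Arr[of "idt Z" h "dcoev d" "idt X \<boxtimes> idt (dob d)"] by (simp add: TensM_Idt)
  also have "\<dots> = (idt (dob d) \<boxtimes> dcoev d) \<cdot> h"
    by (simp add: slide_from_unit)
  also have "(dev d \<boxtimes> idt (dob d)) \<cdot> ((idt (dob d) \<boxtimes> dcoev d) \<cdot> h) = h"
    using left_dual.zigzag_dual[OF assms(2)]
      Cmp_assoc_Arr[of h "idt (dob d) \<boxtimes> dcoev d" "dev d \<boxtimes> idt (dob d)"] by simp
  finally show ?thesis .
qed

lemma dual_arr_curry:
  assumes "X \<in> Ob C" "Y \<in> Ob C" "left_dual C X dX" "left_dual C Y dY" "f \<in> Mor X Y"
  shows "dual_arr C dX dY f = curry_dual dX (dob dY) (dev dY \<cdot> (idt (dob dY) \<boxtimes> f))"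
proof -
  note [simp] = assms(1,2) MorD[OF assms(5)] left_dual_simps[OF assms(3)] left_dual_simps[OF assms(4)]
  show ?thesis
    using interchange_Arr[of "idt (dob dY) \<boxtimes> f" "dev dY" "idt (dob dX)" "idt (dob dX)"]
    by (simp add: dual_arr_def curry_dual_def)
qed

lemma dual_arr_mor:
  assumes "X \<in> Ob C" "Y \<in> Ob C" "left_dual C X dX" "left_dual C Y dY" "f \<in> Mor X Y"
  shows "dual_arr C dX dY f \<in> Mor (dob dY) (dob dX)"
  unfolding dual_arr_curry[OF assms]
  by (rule curry_dual_mor[OF assms(1) _ assms(3)])
    (use assms MorD[OF assms(5)] left_dual_simps[OF assms(4)] in \<open>auto simp: in_Mor_iff\<close>)

lemma dual_arr_dev:
  assumes "X \<in> Ob C" "Y \<in> Ob C" "left_dual C X dX" "left_dual C Y dY" "f \<in> Mor X Y"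
  shows "dev dX \<cdot> (dual_arr C dX dY f \<boxtimes> idt X) = dev dY \<cdot> (idt (dob dY) \<boxtimes> f)"
  unfolding dual_arr_curry[OF assms]
  by (rule dev_curry_dual[OF assms(1) _ assms(3)])
    (use assms MorD[OF assms(5)] left_dual_simps[OF assms(4)] in \<open>auto simp: in_Mor_iff\<close>)

text \<open>
  The identity \<open>dual_arr_dev\<close> characterizes the dual arrow. This gives functoriality for any choice of
  duals, without computing with coevaluations.
\<close>

lemma dual_arr_unique:
  assumes "X \<in> Ob C" "Y \<in> Ob C" "left_dual C X dX" "left_dual C Y dY" "f \<in> Mor X Y"
    and "h \<in> Mor (dob dY) (dob dX)" "dev dX \<cdot> (h \<boxtimes> idt X) = dev dY \<cdot> (idt (dob dY) \<boxtimes> f)"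
  shows "dual_arr C dX dY f = h"
  unfolding dual_arr_curry[OF assms(1-5)] assms(7)[symmetric]
  by (rule curry_dual_dev[OF assms(1,3,6)])

lemma dual_arr_dcoev:
  assumes "X \<in> Ob C" "Y \<in> Ob C" "left_dual C X dX" "left_dual C Y dY" "f \<in> Mor X Y"
  shows "(idt Y \<boxtimes> dual_arr C dX dY f) \<cdot> dcoev dY = (f \<boxtimes> idt (dob dX)) \<cdot> dcoev dX"
proof -
  note [simp] = assms(1,2) MorD[OF assms(5)] left_dual_simps[OF assms(3)] left_dual_simps[OF assms(4)]
  define n where "n = dev dY \<cdot> (idt (dob dY) \<boxtimes> f)"
  have [simp]: "n \<in> Arr C" "Dom C n = dob dY \<star> X" "Cod C n = \<I>" by (simp_all add: n_def)
  have "idt Y \<boxtimes> dual_arr C dX dY f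
      = (idt Y \<boxtimes> n \<boxtimes> idt (dob dX)) \<cdot> (idt (Y \<star> dob dY) \<boxtimes> dcoev dX)"
    using interchange_Arr[of "idt Y" "idt Y" "idt (dob dY) \<boxtimes> dcoev dX" "n \<boxtimes> idt (dob dX)"]
    unfolding dual_arr_curry[OF assms] n_def[symmetric] by (simp add: curry_dual_def Idt_TensO)
  then have "(idt Y \<boxtimes> dual_arr C dX dY f) \<cdot> dcoev dY
      = (idt Y \<boxtimes> n \<boxtimes> idt (dob dX)) \<cdot> ((idt (Y \<star> dob dY) \<boxtimes> dcoev dX) \<cdot> dcoev dY)"
    by simp
  also have "(idt (Y \<star> dob dY) \<boxtimes> dcoev dX) \<cdot> dcoev dY = (dcoev dY \<boxtimes> idt (X \<star> dob dX)) \<cdot> dcoev dX"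
    by (simp add: slide_from_unit)
  also have "(idt Y \<boxtimes> n \<boxtimes> idt (dob dX)) \<cdot> ((dcoev dY \<boxtimes> idt (X \<star> dob dX)) \<cdot> dcoev dX)
      = (((idt Y \<boxtimes> n) \<cdot> (dcoev dY \<boxtimes> idt X)) \<boxtimes> idt (dob dX)) \<cdot> dcoev dX"
    using interchange_Arr[of "dcoev dY \<boxtimes> idt X" "idt Y \<boxtimes> n" "idt (dob dX)" "idt (dob dX)"]
      Cmp_assoc_Arr[of "dcoev dX" "dcoev dY \<boxtimes> idt (X \<star> dob dX)" "idt Y \<boxtimes> n \<boxtimes> idt (dob dX)"]
    by (simp add: Idt_TensO)
  also have "(idt Y \<boxtimes> n) \<cdot> (dcoev dY \<boxtimes> idt X) = f"
  proof -
    have "idt Y \<boxtimes> n = (idt Y \<boxtimes> dev dY) \<cdot> (idt (Y \<star> dob dY) \<boxtimes> f)"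
      using interchange_Arr[of "idt Y" "idt Y" "idt (dob dY) \<boxtimes> f" "dev dY"]
      by (simp add: n_def Idt_TensO)
    then have "(idt Y \<boxtimes> n) \<cdot> (dcoev dY \<boxtimes> idt X)
        = (idt Y \<boxtimes> dev dY) \<cdot> ((idt (Y \<star> dob dY) \<boxtimes> f) \<cdot> (dcoev dY \<boxtimes> idt X))"
      by simp
    also have "(idt (Y \<star> dob dY) \<boxtimes> f) \<cdot> (dcoev dY \<boxtimes> idt X) = (dcoev dY \<boxtimes> idt Y) \<cdot> f"
      using interchange_Arr[of "dcoev dY" "idt (Y \<star> dob dY)" "idt X" f]
      by (simp add: slide_from_unit)
    also have "(idt Y \<boxtimes> dev dY) \<cdot> ((dcoev dY \<boxtimes> idt Y) \<cdot> f) = f"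
      using left_dual.zigzag[OF assms(4)]
        Cmp_assoc_Arr[of f "dcoev dY \<boxtimes> idt Y" "idt Y \<boxtimes> dev dY"] by simp
    finally show ?thesis .
  qed
  finally show ?thesis .
qed

lemma dual_arr_comp:
  assumes "X \<in> Ob C" "Y \<in> Ob C" "Z \<in> Ob C"
    and "left_dual C X dX" "left_dual C Y dY" "left_dual C Z dZ" "f \<in> Mor X Y" "g \<in> Mor Y Z"
  shows "dual_arr C dX dZ (g \<cdot> f) = dual_arr C dX dY f \<cdot> dual_arr C dY dZ g"
proof -
  note f = assms(1,2,4,5,7) and g = assms(2,3,5,6,8)
  note [simp] = assms(1-3) MorD[OF assms(7)] MorD[OF assms(8)]
    left_dual_simps[OF assms(4)] left_dual_simps[OF assms(5)] left_dual_simps[OF assms(6)]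
    MorD(1-3)[OF dual_arr_mor[OF f]] MorD(1-3)[OF dual_arr_mor[OF g]]
  have "dev dX \<cdot> ((dual_arr C dX dY f \<cdot> dual_arr C dY dZ g) \<boxtimes> idt X)
      = (dev dX \<cdot> (dual_arr C dX dY f \<boxtimes> idt X)) \<cdot> (dual_arr C dY dZ g \<boxtimes> idt X)"
    by (simp add: interchange_Arr)
  also have "\<dots> = dev dY \<cdot> ((dual_arr C dY dZ g \<boxtimes> idt Y) \<cdot> (idt (dob dZ) \<boxtimes> f))"
    unfolding dual_arr_dev[OF f] by (simp add: interchange_Arr)
  also have "\<dots> = (dev dY \<cdot> (dual_arr C dY dZ g \<boxtimes> idt Y)) \<cdot> (idt (dob dZ) \<boxtimes> f)" by simp
  also have "\<dots> = dev dZ \<cdot> (idt (dob dZ) \<boxtimes> (g \<cdot> f))"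
    unfolding dual_arr_dev[OF g] by (simp add: interchange_Arr)
  finally show ?thesis
    by (intro dual_arr_unique[OF assms(1,3,4,6)]) (simp_all add: in_Mor_iff)
qed

end

context tensor_category
begin

text \<open>
  The inverse of the identification of complex numbers with endomorphisms of the unit object.
\<close>

definition scalar :: "'b \<Rightarrow> complex"
  where "scalar h = (THE a. h = Scl C a (idt \<I>))"

lemma scalar_Scl [simp]: "scalar (Scl C a (idt \<I>)) = a"
proof -
  have "inj (\<lambda>a. Scl C a (idt \<I>))" using End_Uni by (simp add: bij_betw_def)
  then show ?thesis unfolding scalar_def by (auto dest: injD)
qed

lemma Scl_scalar:
  assumes "h \<in> Mor \<I> \<I>"
  shows "Scl C (scalar h) (idt \<I>) = h"
proof -
  have "h \<in> range (\<lambda>a. Scl C a (idt \<I>))" using End_Uni assms by (simp add: bij_betw_def)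
  then obtain a where "h = Scl C a (idt \<I>)" by blast
  then show ?thesis by simp
qed

lemma scalar_Add: "h \<in> Mor \<I> \<I> \<Longrightarrow> k \<in> Mor \<I> \<I> \<Longrightarrow> scalar (h \<boxplus> k) = scalar h + scalar k"
  by (metis Scl_scalar scalar_Scl Scl_plus Idt_Arr(1) Uni_Ob)

lemma scalar_scale: "h \<in> Mor \<I> \<I> \<Longrightarrow> scalar (Scl C a h) = a * scalar h"
  by (metis Scl_scalar scalar_Scl Scl_Scl Idt_Arr(1) Uni_Ob)

lemma TensM_Add_Arr:
  assumes "f \<in> Arr C" "g \<in> Arr C" "Dom C f = Dom C g" "Cod C f = Cod C g" "h \<in> Arr C"
  shows "(f \<boxplus> g) \<boxtimes> h = (f \<boxtimes> h) \<boxplus> (g \<boxtimes> h)" "h \<boxtimes> (f \<boxplus> g) = (h \<boxtimes> f) \<boxplus> (h \<boxtimes> g)"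
  using TensM_Add_left[of f "Dom C f" "Cod C f" g h "Dom C h" "Cod C h"]
    TensM_Add_right[of h "Dom C h" "Cod C h" f "Dom C f" "Cod C f" g] assms
  by (auto simp: in_Mor_iff)

end

context quasi_pivotal_category
begin

abbreviation DD :: "'a \<Rightarrow> ('a, 'b) dual" where "DD Y \<equiv> D (dob (D Y))"

lemma D_simps [simp]:
  assumes "X \<in> Ob C"
  shows "left_dual C X (D X)" "dob (D X) \<in> Ob C" "dev (D X) \<in> Arr C" "Dom C (dev (D X)) = dob (D X) \<star> X"
    "Cod C (dev (D X)) = \<I>" "dcoev (D X) \<in> Arr C" "Dom C (dcoev (D X)) = \<I>"
    "Cod C (dcoev (D X)) = X \<star> dob (D X)"
    "\<phi> X \<in> Arr C" "Dom C (\<phi> X) = X" "Cod C (\<phi> X) = dob (DD X)"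
  using D_dual[OF assms] left_dual_simps[OF D_dual[OF assms]] phi_mor[OF assms]
  by (auto simp: in_Mor_iff)

definition ptrace :: "'a \<Rightarrow> 'b \<Rightarrow> complex"
  where "ptrace Y f = scalar (trace C D Y (\<phi> Y \<cdot> f))"

lemma trace_mor:
  assumes "f \<in> Mor Y Y"
  shows "trace C D Y (\<phi> Y \<cdot> f) \<in> Mor \<I> \<I>"
  using MorD[OF assms] by (simp add: trace_def in_Mor_iff)

lemma ptrace_Add:
  assumes "f \<in> Mor Y Y" "g \<in> Mor Y Y"
  shows "ptrace Y (f \<boxplus> g) = ptrace Y f + ptrace Y g"
proof -
  note [simp] = MorD[OF assms(1)] MorD[OF assms(2)]
  have "trace C D Y (\<phi> Y \<cdot> (f \<boxplus> g)) = trace C D Y (\<phi> Y \<cdot> f) \<boxplus> trace C D Y (\<phi> Y \<cdot> g)"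
    by (simp add: trace_def TensM_Add_Arr)
  then show ?thesis by (simp add: ptrace_def scalar_Add trace_mor assms)
qed

lemma ptrace_Scl:
  assumes "f \<in> Mor Y Y"
  shows "ptrace Y (Scl C a f) = a * ptrace Y f"
proof -
  note [simp] = MorD[OF assms]
  have "trace C D Y (\<phi> Y \<cdot> Scl C a f) = Scl C a (trace C D Y (\<phi> Y \<cdot> f))"
    by (simp add: trace_def TensM_Scl_left)
  then show ?thesis by (simp add: ptrace_def scalar_scale trace_mor assms)
qed

text \<open>
  Naturality of \<open>\<phi>\<close> turns \<open>v\<close> into its double dual, which travels around the loop: once through the
  evaluation and once through the coevaluation.
\<close>

lemma trace_cyclic:
  assumes u: "u \<in> Mor Y Z" and v: "v \<in> Mor Z Y"
  shows "trace C D Y (\<phi> Y \<cdot> (v \<cdot> u)) = trace C D Z (\<phi> Z \<cdot> (u \<cdot> v))"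
proof -
  note [simp] = MorD[OF u] MorD[OF v]
  let ?v = "dual_arr C (D Z) (D Y) v"
  let ?vv = "dual_arr C (DD Y) (DD Z) ?v"
  have vm: "?v \<in> Mor (dob (D Y)) (dob (D Z))" by (rule dual_arr_mor[of Z Y]) (simp_all add: v)
  have vvm: "?vv \<in> Mor (dob (DD Z)) (dob (DD Y))"
    by (rule dual_arr_mor[of "dob (D Y)" "dob (D Z)"]) (simp_all add: vm)
  note [simp] = MorD(1-3)[OF vm] MorD(1-3)[OF vvm]
  have "\<phi> Y \<cdot> v = ?vv \<cdot> \<phi> Z" using phi_natural[OF v] by (simp add: ddual_arr_def)
  then have "\<phi> Y \<cdot> (v \<cdot> u) = ?vv \<cdot> (\<phi> Z \<cdot> u)"
    using Cmp_assoc_Arr[of u v "\<phi> Y"] by simp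
  then have "trace C D Y (\<phi> Y \<cdot> (v \<cdot> u))
      = (dev (DD Y) \<cdot> (?vv \<boxtimes> idt (dob (D Y)))) \<cdot> (((\<phi> Z \<cdot> u) \<boxtimes> idt (dob (D Y))) \<cdot> dcoev (D Y))"
    using interchange_Arr[of "\<phi> Z \<cdot> u" ?vv "idt (dob (D Y))" "idt (dob (D Y))", symmetric]
    by (simp add: trace_def)
  also have "dev (DD Y) \<cdot> (?vv \<boxtimes> idt (dob (D Y))) = dev (DD Z) \<cdot> (idt (dob (DD Z)) \<boxtimes> ?v)"
    by (rule dual_arr_dev[of "dob (D Y)" "dob (D Z)"]) (simp_all add: vm)
  also have "(dev (DD Z) \<cdot> (idt (dob (DD Z)) \<boxtimes> ?v)) \<cdot> (((\<phi> Z \<cdot> u) \<boxtimes> idt (dob (D Y))) \<cdot> dcoev (D Y))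
      = dev (DD Z) \<cdot> (((\<phi> Z \<cdot> u) \<boxtimes> idt (dob (D Z))) \<cdot> ((idt Y \<boxtimes> ?v) \<cdot> dcoev (D Y)))"
  proof -
    have "(idt (dob (DD Z)) \<boxtimes> ?v) \<cdot> ((\<phi> Z \<cdot> u) \<boxtimes> idt (dob (D Y)))
        = ((\<phi> Z \<cdot> u) \<boxtimes> idt (dob (D Z))) \<cdot> (idt Y \<boxtimes> ?v)"
      by (simp add: interchange_Arr)
    then show ?thesis
      using Cmp_assoc_Arr[of "dcoev (D Y)" "(\<phi> Z \<cdot> u) \<boxtimes> idt (dob (D Y))" "idt (dob (DD Z)) \<boxtimes> ?v"]
      by simp
  qed
  also have "(idt Y \<boxtimes> ?v) \<cdot> dcoev (D Y) = (v \<boxtimes> idt (dob (D Z))) \<cdot> dcoev (D Z)"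
    by (rule dual_arr_dcoev[of Z Y]) (simp_all add: v)
  also have "dev (DD Z) \<cdot> (((\<phi> Z \<cdot> u) \<boxtimes> idt (dob (D Z))) \<cdot> ((v \<boxtimes> idt (dob (D Z))) \<cdot> dcoev (D Z)))
      = trace C D Z (\<phi> Z \<cdot> (u \<cdot> v))"
    using interchange_Arr[of v "\<phi> Z \<cdot> u" "idt (dob (D Z))" "idt (dob (D Z))"]
      Cmp_assoc_Arr[of "dcoev (D Z)" "v \<boxtimes> idt (dob (D Z))" "(\<phi> Z \<cdot> u) \<boxtimes> idt (dob (D Z))"]
    by (simp add: trace_def)
  finally show ?thesis .
qed

lemma ptrace_cyclic: "u \<in> Mor Y Z \<Longrightarrow> v \<in> Mor Z Y \<Longrightarrow> ptrace Y (v \<cdot> u) = ptrace Z (u \<cdot> v)"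
  unfolding ptrace_def by (rule arg_cong[OF trace_cyclic])

lemma ptrace_Zer:
  assumes "Y \<in> Ob C"
  shows "ptrace Y (Zer C Y Y) = 0"
  using ptrace_Scl[of "idt Y" Y 0] assms by (simp add: in_Mor_iff)

end

context linear_abelian_category
begin

lemma kernel_monic:
  assumes "is_kernel C f k"
  shows "monic C k"
  unfolding monic_def
proof (intro conjI ballI impI)
  show k: "k \<in> Arr C" using assms by (simp add: is_kernel_def)
  have f: "f \<in> Arr C" "Dom C f = Cod C k" using assms by (simp_all add: is_kernel_def)
  fix Z g h assume Z: "Z \<in> Ob C" and g: "g \<in> Mor Z (Dom C k)" and h: "h \<in> Mor Z (Dom C k)"
    and eq: "k \<cdot> g = k \<cdot> h"
  note [simp] = MorD(1-3)[OF g] MorD(1-3)[OF h] k f Z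
  have "f \<cdot> (k \<cdot> g) = (f \<cdot> k) \<cdot> g" by simp
  also have "f \<cdot> k = Zer C (Dom C k) (Cod C f)" using assms by (simp add: is_kernel_def)
  finally have "f \<cdot> (k \<cdot> g) = Zer C Z (Cod C f)" by simp
  moreover have "k \<cdot> g \<in> Mor Z (Dom C f)" by (simp add: in_Mor_iff)
  ultimately have "\<exists>!u. u \<in> Mor Z (Dom C k) \<and> k \<cdot> u = k \<cdot> g"
    using assms Z unfolding is_kernel_def by blast
  then show "g = h" using g h eq by metis
qed

lemma kernel_factor:
  assumes "is_kernel C f k" "g \<in> Mor Z (Dom C f)" "f \<cdot> g = Zer C Z (Cod C f)"
  shows "\<exists>u. u \<in> Mor Z (Dom C k) \<and> k \<cdot> u = g"
  using assms MorD(4)[OF assms(2)] unfolding is_kernel_def by blast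

text \<open>The image of an idempotent \<open>e\<close> is the kernel of \<open>1 - e\<close>.\<close>

lemma idempotent_splits:
  assumes e: "e \<in> Mor X X" "e \<cdot> e = e"
  shows "\<exists>K k u. K \<in> Ob C \<and> k \<in> Mor K X \<and> u \<in> Mor X K \<and> u \<cdot> k = idt K \<and> k \<cdot> u = e"
proof -
  note [simp] = MorD[OF e(1)] e(2)
  let ?f = "idt X \<boxplus> Scl C (-1) e"
  obtain k where k: "is_kernel C ?f k" using kernel_exists[of ?f] by auto
  define K where "K = Dom C k"
  have km: "k \<in> Mor K X" using k by (simp add: is_kernel_def in_Mor_iff K_def)
  note [simp] = MorD[OF km]
  have "?f \<cdot> e = Zer C X (Cod C ?f)" by simp
  then obtain u where u: "u \<in> Mor X K" "k \<cdot> u = e"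
    using kernel_factor[OF k, of e X] e(1) unfolding K_def[symmetric] by auto
  note [simp] = MorD[OF u(1)]
  have "?f \<cdot> k = Zer C K X" using k by (simp add: is_kernel_def)
  then have "k \<boxplus> Scl C (-1) (e \<cdot> k) = Zer C K X" by simp
  then have "k = e \<cdot> k"
    by (intro Add_right_cancel[of k "Scl C (-1) (e \<cdot> k)" "e \<cdot> k" K X]) (simp_all add: in_Mor_iff)
  then have "k \<cdot> (u \<cdot> k) = k \<cdot> idt K" using u(2) Cmp_assoc_Arr[of k u k] by simp
  then have "u \<cdot> k = idt K"
    by (rule monic_cancel[OF kernel_monic[OF k], of _ _ K]) (simp_all add: in_Mor_iff)
  then show ?thesis using km u MorD(4)[OF km] by blast
qed

end

context weakly_positive_category
begin

text \<open>
  By cyclicity the trace of an idempotent is the trace of the identity of its image.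
\<close>

lemma ptrace_idempotent_pos:
  assumes e: "e \<in> Mor X X" "e \<cdot> e = e" "e \<noteq> Zer C X X"
  shows "Im (ptrace X e) = 0 \<and> Re (ptrace X e) > 0"
proof -
  obtain K k u where K: "K \<in> Ob C" "k \<in> Mor K X" "u \<in> Mor X K" "u \<cdot> k = idt K" "k \<cdot> u = e"
    using idempotent_splits[OF e(1,2)] by blast
  note [simp] = MorD[OF K(2)] MorD[OF K(3)]
  have "\<not> zero_object C K"
  proof
    assume "zero_object C K"
    moreover have "Zer C K X \<in> Mor K X" by (simp add: in_Mor_iff)
    ultimately have "k = Zer C K X" using K(2) MorD(5)[OF K(2)] unfolding zero_object_def by blast
    then show False using K(5) e(3) by simp
  qed
  then obtain r :: real where "r > 0" "trace C D K (\<phi> K) = Scl C (complex_of_real r) (idt \<I>)"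
    using trace_pos K(1) by blast
  then have "ptrace K (idt K) = complex_of_real r" by (simp add: ptrace_def)
  then show ?thesis using ptrace_cyclic[OF K(3,2)] K(4,5) \<open>r > 0\<close> by simp
qed

lemma positive_trace:
  assumes "X \<in> Ob C" "mor_dim C X X n"
  shows "positive_trace C X (ptrace X) n"
proof (intro positive_trace.intro positive_trace_axioms.intro linear_category_axioms assms)
  fix f g a
  assume fg: "f \<in> Mor X X" "g \<in> Mor X X"
  show "ptrace X (f \<boxplus> g) = ptrace X f + ptrace X g" by (rule ptrace_Add[OF fg])
  show "ptrace X (f \<cdot> g) = ptrace X (g \<cdot> f)" by (rule ptrace_cyclic[OF fg(2,1)])
next
  fix f a
  assume "f \<in> Mor X X"
  then show "ptrace X (Scl C a f) = a * ptrace X f" by (rule ptrace_Scl)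
next
  fix e
  assume "e \<in> Mor X X" "e \<cdot> e = e" "e \<noteq> Zer C X X"
  then show "Im (ptrace X e) = 0 \<and> Re (ptrace X e) > 0" by (rule ptrace_idempotent_pos)
qed

end

section \<open>Calculus in a Frobenius algebra\<close>

locale frobenius_in_category = tensor_category C + frobenius_algebra C F
  for C :: "('o, 'm) tcat" (structure) and F :: "('o, 'm) frob"
begin

abbreviation X where "X \<equiv> fob F"
abbreviation mu where "mu \<equiv> fmul F"
abbreviation dl where "dl \<equiv> fcomul F"
abbreviation un where "un \<equiv> funit F"
abbreviation ct where "ct \<equiv> fcounit F"
abbreviation cup where "cup \<equiv> dl \<cdot> un"
abbreviation fd where "fd \<equiv> frob_dual C F"

lemma X_Ob [simp]: "X \<in> Ob C" by (rule fob_Ob)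

lemmas frob_simps [simp] = MorD(1-3)[OF fmul_mor] MorD(1-3)[OF fcomul_mor]
  MorD(1-3)[OF funit_mor] MorD(1-3)[OF fcounit_mor]

text \<open>
  Arrows \<open>p : A \<rightarrow> X\<close> are treated as generalized elements of \<open>X\<close>; the product of two of them lives
  over the tensor product of their domains.
\<close>

definition emul :: "'m \<Rightarrow> 'm \<Rightarrow> 'm" (infixl \<open>\<bullet>\<close> 72)
  where "p \<bullet> q = mu \<cdot> (p \<boxtimes> q)"

lemma emul_Arr [simp]:
  assumes "p \<in> Arr C" "q \<in> Arr C" "Cod C p = X" "Cod C q = X"
  shows "p \<bullet> q \<in> Arr C" "Dom C (p \<bullet> q) = Dom C p \<star> Dom C q" "Cod C (p \<bullet> q) = X"
  using assms by (simp_all add: emul_def)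

lemma emul_comp:
  assumes "p \<in> Arr C" "q \<in> Arr C" "Cod C p = X" "Cod C q = X" "s \<in> Arr C" "t \<in> Arr C"
    "Dom C p = Cod C s" "Dom C q = Cod C t"
  shows "(p \<bullet> q) \<cdot> (s \<boxtimes> t) = (p \<cdot> s) \<bullet> (q \<cdot> t)"
  using assms by (simp add: emul_def interchange_Arr)

lemma emul_assoc:
  assumes "p \<in> Arr C" "q \<in> Arr C" "r \<in> Arr C" "Cod C p = X" "Cod C q = X" "Cod C r = X"
  shows "(p \<bullet> q) \<bullet> r = p \<bullet> (q \<bullet> r)"
proof -
  have "(p \<bullet> q) \<bullet> r = mu \<cdot> ((mu \<boxtimes> idt X) \<cdot> (p \<boxtimes> q \<boxtimes> r))"
    using interchange_Arr[of "p \<boxtimes> q" mu r "idt X"] assms by (simp add: emul_def)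
  also have "\<dots> = (mu \<cdot> (mu \<boxtimes> idt X)) \<cdot> (p \<boxtimes> q \<boxtimes> r)" using assms by simp
  also have "\<dots> = (mu \<cdot> (idt X \<boxtimes> mu)) \<cdot> (p \<boxtimes> q \<boxtimes> r)" by (simp only: mul_assoc)
  also have "\<dots> = mu \<cdot> ((idt X \<boxtimes> mu) \<cdot> (p \<boxtimes> q \<boxtimes> r))" using assms by simp
  also have "\<dots> = p \<bullet> (q \<bullet> r)"
    using interchange_Arr[of p "idt X" "q \<boxtimes> r" mu] assms by (simp add: emul_def)
  finally show ?thesis .
qed

lemma mu_emul: "mu = idt X \<bullet> idt X"
  by (simp add: emul_def TensM_Idt)

lemma emul_unit:
  assumes "p \<in> Arr C" "Cod C p = X"
  shows "un \<bullet> p = p" "p \<bullet> un = p"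
proof -
  have "un \<bullet> p = (mu \<cdot> (un \<boxtimes> idt X)) \<cdot> p"
    using slide_from_unit(1)[of un p X] assms by (simp add: emul_def)
  then show "un \<bullet> p = p" using assms by (simp add: unit_left)
  have "p \<bullet> un = (mu \<cdot> (idt X \<boxtimes> un)) \<cdot> p"
    using slide_from_unit(2)[of un p X] assms by (simp add: emul_def)
  then show "p \<bullet> un = p" using assms by (simp add: unit_right)
qed

lemma emul_Scl:
  assumes "p \<in> Arr C" "q \<in> Arr C" "Cod C p = X" "Cod C q = X"
  shows "Scl C a p \<bullet> q = Scl C a (p \<bullet> q)" "p \<bullet> Scl C a q = Scl C a (p \<bullet> q)"
  using assms by (simp_all add: emul_def TensM_Scl_left TensM_Scl_right)

lemma fd_simps [simp]: "dob fd = X" "dev fd = ct \<cdot> mu" "dcoev fd = cup"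
  by (simp_all add: frob_dual_def)

lemma comul_cup: "dl = (idt X \<boxtimes> mu) \<cdot> (cup \<boxtimes> idt X)" "dl = (mu \<boxtimes> idt X) \<cdot> (idt X \<boxtimes> cup)"
proof -
  have "(idt X \<boxtimes> mu) \<cdot> (cup \<boxtimes> idt X) = (idt X \<boxtimes> mu) \<cdot> ((dl \<boxtimes> idt X) \<cdot> (un \<boxtimes> idt X))"
    by (simp add: interchange_Arr)
  also have "\<dots> = ((idt X \<boxtimes> mu) \<cdot> (dl \<boxtimes> idt X)) \<cdot> (un \<boxtimes> idt X)" by simp
  also have "\<dots> = dl \<cdot> (mu \<cdot> (un \<boxtimes> idt X))" unfolding frobenius_left by simp
  finally show "dl = (idt X \<boxtimes> mu) \<cdot> (cup \<boxtimes> idt X)" by (simp add: unit_left)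
  have "(mu \<boxtimes> idt X) \<cdot> (idt X \<boxtimes> cup) = (mu \<boxtimes> idt X) \<cdot> ((idt X \<boxtimes> dl) \<cdot> (idt X \<boxtimes> un))"
    by (simp add: interchange_Arr)
  also have "\<dots> = ((mu \<boxtimes> idt X) \<cdot> (idt X \<boxtimes> dl)) \<cdot> (idt X \<boxtimes> un)" by simp
  also have "\<dots> = dl \<cdot> (mu \<cdot> (idt X \<boxtimes> un))" unfolding frobenius_right by simp
  finally show "dl = (mu \<boxtimes> idt X) \<cdot> (idt X \<boxtimes> cup)" by (simp add: unit_right)
qed

lemma fd_dual: "left_dual C X fd"
proof
  show "dob fd \<in> Ob C" "dev fd \<in> Mor (dob fd \<star> X) \<I>" "dcoev fd \<in> Mor \<I> (X \<star> dob fd)"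
    by (simp_all add: in_Mor_iff)
  have "(idt X \<boxtimes> (ct \<cdot> mu)) \<cdot> (cup \<boxtimes> idt X)
      = (idt X \<boxtimes> ct) \<cdot> ((idt X \<boxtimes> mu) \<cdot> (cup \<boxtimes> idt X))"
    using interchange_Arr[of "idt X" "idt X" mu ct, symmetric] by simp
  also have "\<dots> = idt X" unfolding comul_cup(1)[symmetric] by (rule counit_right)
  finally show "(idt X \<boxtimes> dev fd) \<cdot> (dcoev fd \<boxtimes> idt X) = idt X" by simp
  have "((ct \<cdot> mu) \<boxtimes> idt X) \<cdot> (idt X \<boxtimes> cup)
      = (ct \<boxtimes> idt X) \<cdot> ((mu \<boxtimes> idt X) \<cdot> (idt X \<boxtimes> cup))"
    using interchange_Arr[of mu ct "idt X" "idt X", symmetric] by simp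
  also have "\<dots> = idt X" unfolding comul_cup(2)[symmetric] by (rule counit_left)
  finally show "(dev fd \<boxtimes> idt (dob fd)) \<cdot> (idt (dob fd) \<boxtimes> dcoev fd) = idt (dob fd)" by simp
qed

text \<open>
  An arrow into \<open>X\<close> is recovered from its pairing with the identity by a zigzag.
\<close>

lemma pairing_nondegenerate:
  assumes "f \<in> Mor A X" "g \<in> Mor A X" "ct \<cdot> (idt X \<bullet> f) = ct \<cdot> (idt X \<bullet> g)"
  shows "f = g"
proof -
  have rec: "h = (idt X \<boxtimes> (ct \<cdot> (idt X \<bullet> h))) \<cdot> (cup \<boxtimes> idt A)" if "h \<in> Mor A X" for h
  proof -
    note [simp] = MorD[OF that]
    have "h = ((idt X \<boxtimes> (ct \<cdot> mu)) \<cdot> (cup \<boxtimes> idt X)) \<cdot> h"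
      using left_dual.zigzag[OF fd_dual] by simp
    also have "\<dots> = (idt X \<boxtimes> (ct \<cdot> mu)) \<cdot> ((cup \<boxtimes> idt X) \<cdot> h)" by simp
    also have "(cup \<boxtimes> idt X) \<cdot> h = (idt (X \<star> X) \<boxtimes> h) \<cdot> (cup \<boxtimes> idt A)"
      using interchange_Arr[of cup "idt (X \<star> X)" "idt A" h] by (simp add: slide_from_unit)
    also have "(idt X \<boxtimes> (ct \<cdot> mu)) \<cdot> ((idt (X \<star> X) \<boxtimes> h) \<cdot> (cup \<boxtimes> idt A))
        = ((idt X \<boxtimes> (ct \<cdot> mu)) \<cdot> (idt X \<boxtimes> (idt X \<boxtimes> h))) \<cdot> (cup \<boxtimes> idt A)"
      by (simp add: Idt_TensO)
    also have "(idt X \<boxtimes> (ct \<cdot> mu)) \<cdot> (idt X \<boxtimes> (idt X \<boxtimes> h)) = idt X \<boxtimes> (ct \<cdot> (idt X \<bullet> h))"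
      using interchange_Arr[of "idt X" "idt X" "idt X \<boxtimes> h" "ct \<cdot> mu"] by (simp add: emul_def)
    finally show ?thesis .
  qed
  show ?thesis using rec[OF assms(1)] rec[OF assms(2)] assms(3) by simp
qed

text \<open>
  A selfdual idempotent onto a unital subalgebra. The idempotents \<open>i \<cdot> i\<^sup>*\<close> of Frobenius subalgebras
  have these properties (\<open>frobenius_subalgebra_idem\<close>).
\<close>

definition frob_idem :: "'m \<Rightarrow> bool"
  where "frob_idem a \<longleftrightarrow> a \<in> Mor X X \<and> a \<cdot> a = a \<and> a \<cdot> un = un \<and> a \<cdot> (a \<bullet> a) = a \<bullet> a \<and>
    dual_arr C fd fd a = a"

lemma frob_idemD:
  assumes "frob_idem a"
  shows "a \<in> Arr C" "Dom C a = X" "Cod C a = X" "a \<cdot> a = a" "a \<cdot> un = un"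
    "a \<cdot> (a \<bullet> a) = a \<bullet> a" "a \<in> Mor X X"
  using assms by (auto simp: frob_idem_def in_Mor_iff)

lemma frob_idem_pairing:
  assumes "frob_idem a" "p \<in> Arr C" "q \<in> Arr C" "Cod C p = X" "Cod C q = X"
  shows "ct \<cdot> ((a \<cdot> p) \<bullet> q) = ct \<cdot> (p \<bullet> (a \<cdot> q))"
proof -
  note [simp] = frob_idemD(1-3)[OF assms(1)] assms(2-5)
  have "(ct \<cdot> mu) \<cdot> (a \<boxtimes> idt X) = (ct \<cdot> mu) \<cdot> (idt X \<boxtimes> a)"
    using dual_arr_dev[OF X_Ob X_Ob fd_dual fd_dual frob_idemD(7)[OF assms(1)]] assms(1)
    by (simp add: frob_idem_def)
  then have "((ct \<cdot> mu) \<cdot> (a \<boxtimes> idt X)) \<cdot> (p \<boxtimes> q) = ((ct \<cdot> mu) \<cdot> (idt X \<boxtimes> a)) \<cdot> (p \<boxtimes> q)"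
    by (simp only:)
  then show ?thesis by (simp add: emul_def interchange_Arr)
qed

lemma frob_idem_cup:
  assumes "frob_idem a"
  shows "(idt X \<boxtimes> a) \<cdot> cup = (a \<boxtimes> idt X) \<cdot> cup"
  using dual_arr_dcoev[OF X_Ob X_Ob fd_dual fd_dual frob_idemD(7)[OF assms]] assms
  by (simp add: frob_idem_def)

text \<open>
  A selfdual projection onto a subalgebra is a bimodule map over it (a conditional expectation):
  move \<open>a\<close> across the invariant pairing, multiply inside the subalgebra, and move it back.
\<close>

lemma frob_idem_left_module:
  assumes a: "frob_idem a" and "p \<in> Arr C" "q \<in> Arr C" "Cod C p = X" "Cod C q = X"
  shows "a \<cdot> ((a \<cdot> p) \<bullet> q) = (a \<cdot> p) \<bullet> (a \<cdot> q)"
proof -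
  note [simp] = frob_idemD(1-4)[OF a] assms(2-5)
  note pair = frob_idem_pairing[OF a]
  have "a \<cdot> (a \<bullet> idt X) = a \<bullet> a"
  proof (rule pairing_nondegenerate)
    have "ct \<cdot> (idt X \<bullet> (a \<cdot> (a \<bullet> idt X))) = ct \<cdot> (a \<bullet> (a \<bullet> idt X))"
      using pair[of "idt X" "a \<bullet> idt X"] by simp
    also have "\<dots> = ct \<cdot> ((a \<cdot> (a \<bullet> a)) \<bullet> idt X)"
      by (simp add: emul_assoc frob_idemD(6)[OF a])
    also have "\<dots> = ct \<cdot> ((a \<bullet> a) \<bullet> a)"
      using pair[of "a \<bullet> a" "idt X"] by simp
    also have "\<dots> = ct \<cdot> (a \<bullet> (a \<cdot> (a \<bullet> a)))"
      by (simp add: emul_assoc frob_idemD(6)[OF a])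
    also have "\<dots> = ct \<cdot> (idt X \<bullet> (a \<bullet> a))"
      using pair[of "idt X" "a \<cdot> (a \<bullet> a)"] by (simp add: frob_idemD(6)[OF a])
    finally show "ct \<cdot> (idt X \<bullet> (a \<cdot> (a \<bullet> idt X))) = ct \<cdot> (idt X \<bullet> (a \<bullet> a))" .
  qed (simp_all add: in_Mor_iff)
  then have "(a \<cdot> (a \<bullet> idt X)) \<cdot> (p \<boxtimes> q) = (a \<bullet> a) \<cdot> (p \<boxtimes> q)" by (simp only:)
  then show ?thesis by (simp add: emul_comp)
qed

lemma pairing_nondegenerate':
  assumes "f \<in> Mor A X" "g \<in> Mor A X" "ct \<cdot> (f \<bullet> idt X) = ct \<cdot> (g \<bullet> idt X)"
  shows "f = g"
proof -
  have "dev fd \<cdot> (h \<boxtimes> idt X) = ct \<cdot> (h \<bullet> idt X)" if "h \<in> Mor A X" for h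
    using MorD[OF that] by (simp add: emul_def)
  then show ?thesis
    using assms curry_dual_dev[OF X_Ob fd_dual, of f A] curry_dual_dev[OF X_Ob fd_dual, of g A]
    by (metis fd_simps(1))
qed

lemma frob_idem_right_module:
  assumes a: "frob_idem a" and "p \<in> Arr C" "q \<in> Arr C" "Cod C p = X" "Cod C q = X"
  shows "a \<cdot> (p \<bullet> (a \<cdot> q)) = (a \<cdot> p) \<bullet> (a \<cdot> q)"
proof -
  note [simp] = frob_idemD(1-4)[OF a] assms(2-5)
  note pair = frob_idem_pairing[OF a]
  have "a \<cdot> (idt X \<bullet> a) = a \<bullet> a"
  proof (rule pairing_nondegenerate')
    have "ct \<cdot> ((a \<cdot> (idt X \<bullet> a)) \<bullet> idt X) = ct \<cdot> ((idt X \<bullet> a) \<bullet> a)"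
      using pair[of "idt X \<bullet> a" "idt X"] by simp
    also have "\<dots> = ct \<cdot> (idt X \<bullet> (a \<cdot> (a \<bullet> a)))"
      by (simp add: emul_assoc frob_idemD(6)[OF a])
    also have "\<dots> = ct \<cdot> (a \<bullet> (a \<bullet> a))"
      using pair[of "idt X" "a \<bullet> a"] by simp
    also have "\<dots> = ct \<cdot> ((a \<cdot> (a \<bullet> a)) \<bullet> a)"
      by (simp add: emul_assoc frob_idemD(6)[OF a])
    also have "\<dots> = ct \<cdot> ((a \<bullet> a) \<bullet> idt X)"
      using pair[of "a \<cdot> (a \<bullet> a)" "idt X"] by (simp add: frob_idemD(6)[OF a])
    finally show "ct \<cdot> ((a \<cdot> (idt X \<bullet> a)) \<bullet> idt X) = ct \<cdot> ((a \<bullet> a) \<bullet> idt X)" .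
  qed (simp_all add: in_Mor_iff)
  then have "(a \<cdot> (idt X \<bullet> a)) \<cdot> (p \<boxtimes> q) = (a \<bullet> a) \<cdot> (p \<boxtimes> q)" by (simp only:)
  then show ?thesis by (simp add: emul_comp)
qed

text \<open>
  The convolution product of endomorphisms; for subalgebra idempotents \<open>f\<close> and \<open>b\<close> its image lies in
  the product of the two subalgebras.
\<close>

definition conv :: "'m \<Rightarrow> 'm \<Rightarrow> 'm"
  where "conv f b = (f \<bullet> b) \<cdot> dl"

lemma conv_mor:
  assumes "f \<in> Mor X X" "b \<in> Mor X X"
  shows "conv f b \<in> Mor X X"
  using MorD[OF assms(1)] MorD[OF assms(2)] by (simp add: conv_def in_Mor_iff)

text \<open>
  In Sweedler notation, with \<open>cup\<close> written as a sum of \<open>u \<boxtimes> v\<close>: the convolution maps \<open>h\<close> to the sum of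
  \<open>f u \<bullet> b (v \<bullet> h)\<close>, and equally to the sum of \<open>f (h \<bullet> u) \<bullet> b v\<close>.
\<close>

lemma conv_apply:
  assumes "f \<in> Mor X X" "b \<in> Mor X X" "h \<in> Arr C" "Cod C h = X"
  shows "conv f b \<cdot> h = (f \<bullet> (b \<cdot> mu)) \<cdot> (cup \<boxtimes> h)"
    "conv f b \<cdot> h = ((f \<cdot> mu) \<bullet> b) \<cdot> (h \<boxtimes> cup)"
proof -
  note [simp] = MorD[OF assms(1)] MorD[OF assms(2)] assms(3,4)
  have "conv f b \<cdot> h = (f \<bullet> b) \<cdot> (((idt X \<boxtimes> mu) \<cdot> (cup \<boxtimes> idt X)) \<cdot> h)"
    unfolding comul_cup(1)[symmetric] by (simp add: conv_def)
  also have "\<dots> = ((f \<bullet> b) \<cdot> (idt X \<boxtimes> mu)) \<cdot> ((cup \<boxtimes> idt X) \<cdot> h)" by simp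
  also have "(cup \<boxtimes> idt X) \<cdot> h = cup \<boxtimes> h" by (simp add: slide_from_unit)
  finally show "conv f b \<cdot> h = (f \<bullet> (b \<cdot> mu)) \<cdot> (cup \<boxtimes> h)" by (simp add: emul_comp)
  have "conv f b \<cdot> h = (f \<bullet> b) \<cdot> (((mu \<boxtimes> idt X) \<cdot> (idt X \<boxtimes> cup)) \<cdot> h)"
    unfolding comul_cup(2)[symmetric] by (simp add: conv_def)
  also have "\<dots> = ((f \<bullet> b) \<cdot> (mu \<boxtimes> idt X)) \<cdot> ((idt X \<boxtimes> cup) \<cdot> h)" by simp
  also have "(idt X \<boxtimes> cup) \<cdot> h = h \<boxtimes> cup" by (simp add: slide_from_unit)
  finally show "conv f b \<cdot> h = ((f \<cdot> mu) \<bullet> b) \<cdot> (h \<boxtimes> cup)" by (simp add: emul_comp)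
qed

text \<open>
  In the first form of \<open>conv_apply\<close> a factor \<open>b \<cdot> q\<close> on the right stays inside the argument of \<open>b\<close>, which
  is a right module map over its image.
\<close>

lemma conv_right_module:
  assumes f: "f \<in> Mor X X" and b: "frob_idem b" and p: "p \<in> Arr C" "Cod C p = X"
    and q: "q \<in> Arr C" "Cod C q = X"
  shows "conv f b \<cdot> (p \<bullet> (b \<cdot> q)) = (conv f b \<cdot> p) \<bullet> (b \<cdot> q)"
proof -
  note [simp] = MorD[OF f] frob_idemD(1-3)[OF b] p q
  note ap = conv_apply(1)[OF f frob_idemD(7)[OF b]]
  have "conv f b \<cdot> (p \<bullet> (b \<cdot> q))
      = ((f \<bullet> (b \<cdot> mu)) \<cdot> (idt (X \<star> X) \<boxtimes> mu)) \<cdot> (cup \<boxtimes> p \<boxtimes> (b \<cdot> q))"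
    using interchange_Arr[of cup "idt (X \<star> X)" "p \<boxtimes> (b \<cdot> q)" mu, symmetric]
    by (simp add: ap emul_def)
  also have "(f \<bullet> (b \<cdot> mu)) \<cdot> (idt (X \<star> X) \<boxtimes> mu) = f \<bullet> (b \<cdot> (idt X \<bullet> mu))"
    using emul_comp[of f "b \<cdot> mu" "idt X" "idt X \<boxtimes> mu"] by (simp add: Idt_TensO emul_def)
  also have "idt X \<bullet> mu = mu \<bullet> idt X"
    by (simp add: mu_emul emul_assoc)
  also have "(f \<bullet> (b \<cdot> (mu \<bullet> idt X))) \<cdot> (cup \<boxtimes> p \<boxtimes> (b \<cdot> q))
      = ((f \<bullet> (b \<cdot> (mu \<bullet> idt X))) \<cdot> (idt X \<boxtimes> (idt (X \<star> X) \<boxtimes> b))) \<cdot> (cup \<boxtimes> p \<boxtimes> q)"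
  proof -
    have "idt X \<boxtimes> (idt (X \<star> X) \<boxtimes> b) = idt (X \<star> (X \<star> X)) \<boxtimes> b"
      by (simp add: Idt_TensO)
    then have "(idt X \<boxtimes> (idt (X \<star> X) \<boxtimes> b)) \<cdot> (cup \<boxtimes> p \<boxtimes> q) = cup \<boxtimes> p \<boxtimes> (b \<cdot> q)"
      using interchange_Arr[of "cup \<boxtimes> p" "idt (X \<star> (X \<star> X))" q b] by simp
    then show ?thesis by simp
  qed
  also have "(f \<bullet> (b \<cdot> (mu \<bullet> idt X))) \<cdot> (idt X \<boxtimes> (idt (X \<star> X) \<boxtimes> b)) = f \<bullet> (b \<cdot> (mu \<bullet> b))"
    by (simp add: emul_comp)
  also have "b \<cdot> (mu \<bullet> b) = (b \<cdot> mu) \<bullet> b"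
    using frob_idem_right_module[OF b, of mu "idt X"] by simp
  also have "f \<bullet> ((b \<cdot> mu) \<bullet> b) = (f \<bullet> (b \<cdot> mu)) \<bullet> b"
    by (simp add: emul_assoc)
  also have "((f \<bullet> (b \<cdot> mu)) \<bullet> b) \<cdot> (cup \<boxtimes> p \<boxtimes> q) = (conv f b \<cdot> p) \<bullet> (b \<cdot> q)"
    using emul_comp[of "f \<bullet> (b \<cdot> mu)" b "cup \<boxtimes> p" q] by (simp add: ap)
  finally show ?thesis .
qed

text \<open>
  Satisfied by \<open>f = a\<close> for a subalgebra idempotent \<open>a\<close>, and by \<open>f = \<psi> \<cdot> a\<close> for an algebra
  endomorphism \<open>\<psi>\<close>; the twisted case is what relates the convolution to the trace.
\<close>

definition multiplicative_over :: "'m \<Rightarrow> 'm \<Rightarrow> bool"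
  where "multiplicative_over a f \<longleftrightarrow> (\<forall>r s. r \<in> Arr C \<longrightarrow> s \<in> Arr C \<longrightarrow> Cod C r = X \<longrightarrow> Cod C s = X \<longrightarrow>
    f \<cdot> ((a \<cdot> r) \<bullet> s) = (f \<cdot> r) \<bullet> (f \<cdot> s))"

lemma conv_left_module:
  assumes f: "f \<in> Mor X X" and a: "frob_idem a" and b: "b \<in> Mor X X"
    and p: "p \<in> Arr C" "Cod C p = X" and q: "q \<in> Arr C" "Cod C q = X"
    and fa: "multiplicative_over a f"
  shows "conv f b \<cdot> ((a \<cdot> p) \<bullet> q) = (f \<cdot> p) \<bullet> (conv f b \<cdot> q)"
proof -
  note [simp] = MorD[OF f] frob_idemD(1-3)[OF a] MorD[OF b] p q
  note ap = conv_apply(2)[OF f b]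
  have "conv f b \<cdot> ((a \<cdot> p) \<bullet> q)
      = (((f \<cdot> mu) \<bullet> b) \<cdot> (mu \<boxtimes> idt (X \<star> X))) \<cdot> ((a \<cdot> p) \<boxtimes> q \<boxtimes> cup)"
    using interchange_Arr[of "(a \<cdot> p) \<boxtimes> q" mu cup "idt (X \<star> X)", symmetric]
    by (simp add: ap emul_def)
  also have "((f \<cdot> mu) \<bullet> b) \<cdot> (mu \<boxtimes> idt (X \<star> X)) = (f \<cdot> (mu \<bullet> idt X)) \<bullet> b"
    using emul_comp[of "f \<cdot> mu" b "mu \<boxtimes> idt X" "idt X"] by (simp add: Idt_TensO emul_def)
  also have "mu \<bullet> idt X = idt X \<bullet> mu"
    by (simp add: mu_emul emul_assoc)
  also have "((f \<cdot> (idt X \<bullet> mu)) \<bullet> b) \<cdot> ((a \<cdot> p) \<boxtimes> q \<boxtimes> cup)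
      = (((f \<cdot> (idt X \<bullet> mu)) \<bullet> b) \<cdot> ((a \<boxtimes> idt (X \<star> X)) \<boxtimes> idt X)) \<cdot> (p \<boxtimes> q \<boxtimes> cup)"
    by (simp add: Idt_TensO interchange_Arr) (simp add: TensM_Idt)
  also have "((f \<cdot> (idt X \<bullet> mu)) \<bullet> b) \<cdot> ((a \<boxtimes> idt (X \<star> X)) \<boxtimes> idt X) = (f \<cdot> (a \<bullet> mu)) \<bullet> b"
    using emul_comp[of "f \<cdot> (idt X \<bullet> mu)" b "a \<boxtimes> idt (X \<star> X)" "idt X"]
      emul_comp[of "idt X" mu a "idt (X \<star> X)"] by simp
  also have "f \<cdot> (a \<bullet> mu) = f \<bullet> (f \<cdot> mu)"
    using fa[unfolded multiplicative_over_def, rule_format, of "idt X" mu] by simp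
  also have "(f \<bullet> (f \<cdot> mu)) \<bullet> b = f \<bullet> ((f \<cdot> mu) \<bullet> b)"
    by (simp add: emul_assoc)
  also have "(f \<bullet> ((f \<cdot> mu) \<bullet> b)) \<cdot> (p \<boxtimes> q \<boxtimes> cup) = (f \<cdot> p) \<bullet> (conv f b \<cdot> q)"
    using emul_comp[of f "(f \<cdot> mu) \<bullet> b" p "q \<boxtimes> cup"] by (simp add: ap)
  finally show ?thesis .
qed

lemma conv_unit_left_module:
  assumes f: "f \<in> Mor X X" and a: "frob_idem a" and b: "b \<in> Mor X X"
    and fa: "multiplicative_over a f"
    and k: "conv f b \<cdot> un = Scl C k un"
  shows "conv f b \<cdot> a = Scl C k f"
proof -
  note [simp] = MorD[OF f] frob_idemD(1-3)[OF a] MorD[OF b]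
  show ?thesis
    using conv_left_module[OF f a b _ _ _ _ fa, of "idt X" un] k
    by (simp add: emul_unit emul_Scl)
qed

lemma conv_unit_right_module:
  assumes f: "f \<in> Mor X X" and b: "frob_idem b" and k: "conv f b \<cdot> un = Scl C k un"
  shows "conv f b \<cdot> b = Scl C k b"
proof -
  note [simp] = MorD[OF f] frob_idemD(1-3)[OF b]
  show ?thesis
    using conv_right_module[OF f b, of un "idt X"] k by (simp add: emul_unit emul_Scl)
qed

text \<open>
  Composition of convolutions: push the outer convolution past \<open>b\<close>, then past \<open>g\<close>, until it meets
  the unit, where it is a scalar.
\<close>

lemma conv_conv:
  assumes f: "f \<in> Mor X X" and g: "g \<in> Mor X X" and a: "frob_idem a" and b: "frob_idem b"
    and fa: "multiplicative_over a f"
    and ag: "a \<cdot> g = g" and k: "conv f b \<cdot> un = Scl C k un"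
  shows "conv f b \<cdot> conv g b = Scl C k (conv (f \<cdot> g) b)"
proof -
  note [simp] = MorD[OF f] MorD[OF g] frob_idemD(1-4)[OF a] frob_idemD(1-4)[OF b]
    MorD(1-3)[OF conv_mor[OF f frob_idemD(7)[OF b]]] MorD(1-3)[OF conv_mor[OF g frob_idemD(7)[OF b]]]
  have "conv f b \<cdot> g = (conv f b \<cdot> a) \<cdot> g" using ag by simp
  also have "\<dots> = Scl C k (f \<cdot> g)"
    using conv_unit_left_module[OF f a frob_idemD(7)[OF b] fa k] by simp
  finally have cg: "conv f b \<cdot> g = Scl C k (f \<cdot> g)" .
  have "conv f b \<cdot> conv g b = (conv f b \<cdot> (g \<bullet> (b \<cdot> idt X))) \<cdot> dl"
    by (simp add: conv_def[of g])
  also have "\<dots> = ((conv f b \<cdot> g) \<bullet> (b \<cdot> idt X)) \<cdot> dl"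
    by (subst conv_right_module[OF f b]) simp_all
  also have "\<dots> = Scl C k (conv (f \<cdot> g) b)"
    unfolding cg by (simp add: emul_Scl conv_def)
  finally show ?thesis .
qed

lemma cup_comul: "(dl \<boxtimes> idt X) \<cdot> cup = (idt X \<boxtimes> dl) \<cdot> cup"
  using arg_cong[OF comul_coassoc, of "\<lambda>h. h \<cdot> un"] by simp

text \<open>
  The trace of \<open>f : X \<rightarrow> X\<^sup>*\<^sup>* = X\<close> formed with the Frobenius selfduality of \<open>X\<close>.
\<close>

definition loop :: "'m \<Rightarrow> complex"
  where "loop f = scalar (ct \<cdot> ((f \<bullet> idt X) \<cdot> cup))"

text \<open>
  By coassociativity the strand through \<open>k\<close> can be closed up first; what it leaves is the scalar \<open>w\<close>
  times the identity, and the strand through \<open>h\<close> remains.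
\<close>

lemma loop_conv:
  assumes h: "h \<in> Mor X X" and k: "k \<in> Mor X X" and w: "(k \<bullet> idt X) \<cdot> cup = Scl C w un"
  shows "loop (conv h k) = w * loop h" "loop k = w * scalar (ct \<cdot> un)"
proof -
  note [simp] = MorD[OF h] MorD[OF k]
  have "(k \<bullet> idt X) \<cdot> dl = ((k \<bullet> idt X) \<cdot> (idt X \<boxtimes> mu)) \<cdot> (cup \<boxtimes> idt X)"
    using arg_cong[OF comul_cup(1), of "\<lambda>h. (k \<bullet> idt X) \<cdot> h"] by simp
  also have "(k \<bullet> idt X) \<cdot> (idt X \<boxtimes> mu) = (k \<bullet> idt X) \<bullet> idt X"
    by (simp add: emul_comp emul_assoc mu_emul)
  also have "((k \<bullet> idt X) \<bullet> idt X) \<cdot> (cup \<boxtimes> idt X) = Scl C w (idt X)"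
    using emul_comp[of "k \<bullet> idt X" "idt X" cup "idt X"] by (simp add: w emul_Scl emul_unit)
  finally have kw: "(k \<bullet> idt X) \<cdot> dl = Scl C w (idt X)" .
  have "(conv h k \<bullet> idt X) \<cdot> cup = ((h \<bullet> k) \<bullet> idt X) \<cdot> ((dl \<boxtimes> idt X) \<cdot> cup)"
    using emul_comp[of "h \<bullet> k" "idt X" dl "idt X"]
      Cmp_assoc_Arr[of cup "dl \<boxtimes> idt X" "(h \<bullet> k) \<bullet> idt X"] by (simp add: conv_def)
  also have "\<dots> = ((h \<bullet> (k \<bullet> idt X)) \<cdot> (idt X \<boxtimes> dl)) \<cdot> cup"
    unfolding cup_comul by (simp add: emul_assoc)
  also have "\<dots> = Scl C w ((h \<bullet> idt X) \<cdot> cup)"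
    using emul_comp[of h "k \<bullet> idt X" "idt X" dl] by (simp add: kw emul_Scl)
  finally show "loop (conv h k) = w * loop h"
    by (simp add: loop_def scalar_scale in_Mor_iff)
  show "loop k = w * scalar (ct \<cdot> un)"
    by (simp add: loop_def w scalar_scale in_Mor_iff)
qed

text \<open>
  Selfduality moves \<open>b\<close> to the other leg of \<open>cup\<close>, which turns the loop into the convolution applied to
  the unit.
\<close>

lemma loop_conv_unit:
  assumes f: "f \<in> Mor X X" and b: "frob_idem b" and k: "conv f b \<cdot> un = Scl C k un"
  shows "loop (f \<cdot> b) = k * scalar (ct \<cdot> un)"
proof -
  note [simp] = MorD[OF f] frob_idemD(1-3)[OF b]
  have "((f \<cdot> b) \<bullet> idt X) \<cdot> cup = (f \<bullet> idt X) \<cdot> ((b \<boxtimes> idt X) \<cdot> cup)"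
    using emul_comp[of f "idt X" b "idt X"] Cmp_assoc_Arr[of cup "b \<boxtimes> idt X" "f \<bullet> idt X"] by simp
  also have "\<dots> = ((f \<bullet> idt X) \<cdot> (idt X \<boxtimes> b)) \<cdot> cup"
    unfolding frob_idem_cup[OF b, symmetric] by simp
  also have "\<dots> = conv f b \<cdot> un"
    using emul_comp[of f "idt X" "idt X" b] by (simp add: conv_def)
  finally show ?thesis by (simp add: loop_def k scalar_scale in_Mor_iff)
qed

text \<open>
  Selfduality of \<open>i \<cdot> i\<^sup>*\<close> is where \<open>i\<^sup>*\<^sup>* = i\<close> enters.
\<close>

lemma frobenius_subalgebra_idem:
  assumes "frobenius_subalgebra C F G i"
  defines "p \<equiv> dual_arr C (frob_dual C G) fd i"
  shows "frob_idem (i \<cdot> p)" "i \<in> Mor (fob G) X" "p \<in> Mor X (fob G)" "p \<cdot> i = idt (fob G)"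
proof -
  interpret S: frobenius_subalgebra C F G i by (rule assms(1))
  interpret G: frobenius_in_category C G
    by (intro frobenius_in_category.intro tensor_category_axioms S.sub_frob)
  note i = S.incl_mor
  have pm: "p \<in> Mor X (fob G)"
    using dual_arr_mor[OF G.X_Ob X_Ob G.fd_dual fd_dual i] by (simp add: p_def)
  note [simp] = MorD[OF i] MorD[OF pm]
  have pi: "p \<cdot> i = idt (fob G)" using S.incl_split by (simp add: p_def)
  then have aa: "(i \<cdot> p) \<cdot> (i \<cdot> p) = i \<cdot> p"
    using Cmp_assoc_Arr[of p i p] by simp
  have un: "(i \<cdot> p) \<cdot> un = un"
    unfolding S.incl_unit[symmetric] using pi Cmp_assoc_Arr[of G.un i p] by simp
  have "(i \<cdot> p) \<bullet> (i \<cdot> p) = (mu \<cdot> (i \<boxtimes> i)) \<cdot> (p \<boxtimes> p)"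
    by (simp add: emul_def interchange_Arr)
  also have "\<dots> = i \<cdot> (G.mu \<cdot> (p \<boxtimes> p))"
    using S.incl_mul by (simp add: multiplicative_def)
  finally have mul: "(i \<cdot> p) \<bullet> (i \<cdot> p) = i \<cdot> (G.mu \<cdot> (p \<boxtimes> p))" .
  then have mm: "(i \<cdot> p) \<cdot> ((i \<cdot> p) \<bullet> (i \<cdot> p)) = (i \<cdot> p) \<bullet> (i \<cdot> p)"
    using pi Cmp_assoc_Arr[of "G.mu \<cdot> (p \<boxtimes> p)" i p] by simp
  have "dual_arr C fd fd (i \<cdot> p) = dual_arr C fd G.fd p \<cdot> dual_arr C G.fd fd i"
    by (rule dual_arr_comp[OF X_Ob G.X_Ob X_Ob fd_dual G.fd_dual fd_dual pm i])
  also have "dual_arr C fd G.fd p = i"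
    using S.incl_ddual by (simp add: ddual_arr_def p_def)
  finally have "dual_arr C fd fd (i \<cdot> p) = i \<cdot> p" by (simp add: p_def)
  then show "frob_idem (i \<cdot> p)" using aa un mm by (simp add: frob_idem_def in_Mor_iff)
  show "i \<in> Mor (fob G) X" "p \<in> Mor X (fob G)" "p \<cdot> i = idt (fob G)" using i pm pi by auto
qed

text \<open>
  Dualizing \<open>b \<cdot> a = a\<close> gives \<open>a \<cdot> b = a\<close>.
\<close>

lemma frob_idem_eqI:
  assumes a: "frob_idem a" and b: "frob_idem b" and ab: "a \<cdot> b = b" and ba: "b \<cdot> a = a"
  shows "a = b"
proof -
  have "dual_arr C fd fd (b \<cdot> a) = dual_arr C fd fd a \<cdot> dual_arr C fd fd b"
    by (rule dual_arr_comp[OF X_Ob X_Ob X_Ob fd_dual fd_dual fd_dual])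
      (use a b in \<open>simp_all add: frob_idem_def\<close>)
  then show ?thesis using a b ab ba by (simp add: frob_idem_def)
qed

end

section \<open>The trace of a sum of subobjects\<close>

context weakly_positive_category
begin

text \<open>
  If \<open>(i, p)\<close> and \<open>(j, q)\<close> are split subobjects of \<open>X\<close> with split intersection \<open>(k, r)\<close> and split
  sum \<open>(s, z)\<close>, then a complement of the intersection in the first subobject is also a complement
  of the second subobject in the sum.
\<close>

lemma ptrace_sub_join:
  assumes i: "i \<in> Mor A X" and p: "p \<in> Mor X A" and ip: "p \<cdot> i = idt A"
    and j: "j \<in> Mor B X" and q: "q \<in> Mor X B" and jq: "q \<cdot> j = idt B"
    and k: "k \<in> Mor G X" and r: "r \<in> Mor X G" and kr: "r \<cdot> k = idt G" and meet: "sub_meet C i j k"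
    and s: "s \<in> Mor S X" and z: "z \<in> Mor X S" and sz: "z \<cdot> s = idt S" and join: "sub_join C i j s"
  shows "ptrace X (s \<cdot> z) = ptrace X (i \<cdot> p) + ptrace X (j \<cdot> q) - ptrace X (k \<cdot> r)"
    "P \<in> Mor X X \<Longrightarrow> P \<cdot> (i \<cdot> p) = i \<cdot> p \<Longrightarrow> P \<cdot> (j \<cdot> q) = j \<cdot> q \<Longrightarrow> P \<cdot> (s \<cdot> z) = s \<cdot> z"
proof -
  note [simp] = MorD[OF i] MorD[OF p] MorD[OF j] MorD[OF q] MorD[OF k] MorD[OF r] MorD[OF s] MorD[OF z]
    ip jq kr sz
  obtain n where n: "mor_dim C X X n" using mor_finite_dim[of X X] by auto
  interpret PT: positive_trace C X "ptrace X" n by (rule positive_trace) (simp_all add: n)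
  note pid = retraction_cancel[OF i p ip] and qid = retraction_cancel[OF j q jq]
    and rid = retraction_cancel[OF k r kr] and zid = retraction_cancel[OF s z sz]
  obtain u v where uv: "u \<in> Mor G A" "v \<in> Mor G B" "i \<cdot> u = k" "j \<cdot> v = k"
    and pb: "\<And>Z f g. Z \<in> Ob C \<Longrightarrow> f \<in> Mor Z A \<Longrightarrow> g \<in> Mor Z B \<Longrightarrow> i \<cdot> f = j \<cdot> g \<Longrightarrow>
      \<exists>h. h \<in> Mor Z G \<and> u \<cdot> h = f \<and> v \<cdot> h = g"
    using meet unfolding sub_meet_def by auto blast
  note [simp] = MorD[OF uv(1)] MorD[OF uv(2)]
  define a where "a = i \<cdot> p"
  define \<gamma> where "\<gamma> = k \<cdot> r"
  have idem: "PT.idem a" "PT.idem \<gamma>" unfolding PT.idem_def a_def \<gamma>_def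
    by (simp_all add: in_Mor_iff pid rid)
  note [simp] = PT.idemD(1-3)[OF idem(1)] PT.idemD(1-3)[OF idem(2)]
  have ai: "a \<cdot> (i \<cdot> h) = i \<cdot> h" if "h \<in> Arr C" "Cod C h = A" for h
    using that by (simp add: a_def pid)
  have ak: "a \<cdot> k = k" using ai[of u] uv(3) by simp
  have a\<gamma>: "a \<cdot> \<gamma> = \<gamma>"
    using ak Cmp_assoc_Arr[of r k a] by (simp add: \<gamma>_def)
  \<comment> \<open>\<open>a'\<close> projects onto a complement \<open>K\<close> of the intersection in the first subobject.\<close>
  define a' where "a' = a \<boxplus> Scl C (-1) (\<gamma> \<cdot> a)"
  have a': "PT.idem a'" "ptrace X a' = ptrace X a - ptrace X \<gamma>"
    unfolding a'_def by (rule PT.relative_complement[OF idem a\<gamma>])+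
  obtain K i' p' where K: "K \<in> Ob C" "i' \<in> Mor K X" "p' \<in> Mor X K" "p' \<cdot> i' = idt K" "i' \<cdot> p' = a'"
    using idempotent_splits[OF PT.idemD(5,4)[OF a'(1)]] by blast
  note [simp] = K(1) MorD[OF K(2)] MorD[OF K(3)] PT.idemD(1-3)[OF a'(1)]
  note p'id = retraction_cancel[OF K(2-4)]
  have a'i': "a' \<cdot> i' = i'" using K(4,5) Cmp_assoc_Arr[of i' p' i'] by simp
  have aa': "a \<cdot> a' = a'"
    using a\<gamma> PT.idemD(4)[OF idem(1)] Cmp_assoc_Arr[of a \<gamma> a] by (simp add: a'_def)
  have ai': "a \<cdot> i' = i'" using aa' a'i' Cmp_assoc_Arr[of i' a' a] by simp
  have a'k: "a' \<cdot> k = Zer C G X" using ak kr by (simp add: a'_def \<gamma>_def)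
  obtain S0 i1 j1 p1 q1 where S0: "S0 \<in> Ob C" "i1 \<in> Mor K S0" "j1 \<in> Mor B S0" "p1 \<in> Mor S0 K" "q1 \<in> Mor S0 B"
    "p1 \<cdot> i1 = idt K" "q1 \<cdot> j1 = idt B" "q1 \<cdot> i1 = Zer C K B" "p1 \<cdot> j1 = Zer C B K"
    "(i1 \<cdot> p1) \<boxplus> (j1 \<cdot> q1) = idt S0"
    using biproduct_exists[of K B] by auto
  note [simp] = S0(1) MorD[OF S0(2)] MorD[OF S0(3)] MorD[OF S0(4)] MorD[OF S0(5)]
  define h where "h = (i' \<cdot> p1) \<boxplus> (j \<cdot> q1)"
  have [simp]: "h \<in> Arr C" "Dom C h = S0" "Cod C h = X" by (simp_all add: h_def)
  have hi: "h \<cdot> i1 = i'" and hj: "h \<cdot> j1 = j" by (simp_all add: h_def S0(6-9))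
  \<comment> \<open>\<open>K\<close> meets the second subobject in zero, so \<open>h\<close> embeds the direct sum of the two.\<close>
  have kernel: "t = Zer C Z S0" if t: "t \<in> Mor Z S0" and ht: "h \<cdot> t = Zer C Z X" for t Z
  proof -
    note [simp] = MorD[OF t]
    have sum: "(i' \<cdot> (p1 \<cdot> t)) \<boxplus> (j \<cdot> (q1 \<cdot> t)) = Zer C Z X" using ht by (simp add: h_def)
    have eq: "i' \<cdot> (p1 \<cdot> t) = j \<cdot> Scl C (-1) (q1 \<cdot> t)"
      by (rule Add_right_cancel[of _ "j \<cdot> (q1 \<cdot> t)" _ Z X]) (simp_all add: sum in_Mor_iff)
    have "i \<cdot> (p \<cdot> (i' \<cdot> (p1 \<cdot> t))) = (a \<cdot> i') \<cdot> (p1 \<cdot> t)" by (simp add: a_def)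
    also have "\<dots> = j \<cdot> Scl C (-1) (q1 \<cdot> t)" unfolding ai' by (rule eq)
    finally obtain w where w: "w \<in> Mor Z G" "u \<cdot> w = p \<cdot> (i' \<cdot> (p1 \<cdot> t))"
      using pb[of Z "p \<cdot> (i' \<cdot> (p1 \<cdot> t))" "Scl C (-1) (q1 \<cdot> t)"] by (auto simp: in_Mor_iff)
    note [simp] = MorD[OF w(1)]
    have "i' \<cdot> (p1 \<cdot> t) = (a \<cdot> i') \<cdot> (p1 \<cdot> t)" unfolding ai' by simp
    also have "\<dots> = i \<cdot> (u \<cdot> w)" unfolding w(2) by (simp add: a_def)
    also have "\<dots> = k \<cdot> w" using uv(3) Cmp_assoc_Arr[of w u i] by simp
    finally have kw: "i' \<cdot> (p1 \<cdot> t) = k \<cdot> w" .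
    have "i' \<cdot> (p1 \<cdot> t) = (a' \<cdot> i') \<cdot> (p1 \<cdot> t)" unfolding a'i' by simp
    also have "\<dots> = a' \<cdot> (k \<cdot> w)" using kw by simp
    also have "\<dots> = (a' \<cdot> k) \<cdot> w" by simp
    also have "\<dots> = Zer C Z X" unfolding a'k by simp
    finally have z1: "i' \<cdot> (p1 \<cdot> t) = Zer C Z X" .
    then have "p1 \<cdot> t = p' \<cdot> Zer C Z X" using p'id[of "p1 \<cdot> t"] by simp
    then have p1t: "p1 \<cdot> t = Zer C Z K" by simp
    have "j \<cdot> (q1 \<cdot> t) = Zer C Z X" using sum z1 by simp
    then have "q1 \<cdot> t = q \<cdot> Zer C Z X" using qid[of "q1 \<cdot> t"] by simp
    then have q1t: "q1 \<cdot> t = Zer C Z B" by simp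
    have "t = ((i1 \<cdot> p1) \<boxplus> (j1 \<cdot> q1)) \<cdot> t" unfolding S0(10) by simp
    also have "\<dots> = Zer C Z S0" by (simp add: p1t q1t)
    finally show ?thesis .
  qed
  have monic: "monic C h"
    unfolding monic_def
  proof (intro conjI ballI impI)
    fix Z g g' assume "Z \<in> Ob C" and g: "g \<in> Mor Z (Dom C h)" "g' \<in> Mor Z (Dom C h)"
      and eq: "h \<cdot> g = h \<cdot> g'"
    note [simp] = MorD[OF g(1), simplified] MorD[OF g(2), simplified]
    have "g \<boxplus> Scl C (-1) g' = Zer C Z S0"
      by (rule kernel) (simp_all add: in_Mor_iff eq)
    then show "g = g'"
      by (intro Add_right_cancel[of g "Scl C (-1) g'" g' Z S0]) (simp_all add: in_Mor_iff)
  qed simp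
  have "factors C i h"
  proof -
    have "h \<cdot> ((i1 \<cdot> (p' \<cdot> i)) \<boxplus> (j1 \<cdot> (v \<cdot> (r \<cdot> i)))) = (h \<cdot> i1) \<cdot> (p' \<cdot> i) \<boxplus> (h \<cdot> j1) \<cdot> (v \<cdot> (r \<cdot> i))"
      by simp
    also have "\<dots> = (i' \<cdot> p') \<cdot> i \<boxplus> (j \<cdot> v) \<cdot> (r \<cdot> i)" unfolding hi hj by simp
    also have "\<dots> = a' \<cdot> i \<boxplus> \<gamma> \<cdot> i" unfolding K(5) uv(4) \<gamma>_def by simp
    also have "\<dots> = i" using ai[of "idt A"] by (simp add: a'_def Add_assoc)
    finally show ?thesis unfolding factors_def
      by (intro bexI[of _ "(i1 \<cdot> (p' \<cdot> i)) \<boxplus> (j1 \<cdot> (v \<cdot> (r \<cdot> i)))"]) (simp_all add: in_Mor_iff)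
  qed
  moreover have "factors C j h"
    unfolding factors_def using hj by (intro bexI[of _ j1]) (simp_all add: in_Mor_iff)
  ultimately have "factors C s h" using join monic unfolding sub_join_def by auto
  then obtain w0 where w0: "w0 \<in> Mor S S0" "s = h \<cdot> w0" unfolding factors_def by auto
  note [simp] = MorD[OF w0(1)]
  obtain x y where xy: "x \<in> Mor A S" "y \<in> Mor B S" "i = s \<cdot> x" "j = s \<cdot> y"
    using join unfolding sub_join_def factors_def by auto
  have "(s \<cdot> z) \<cdot> i = i" "(s \<cdot> z) \<cdot> j = j"
    using xy(1,2) by (simp_all add: xy(3,4) zid in_Mor_iff)
  \<comment> \<open>For \<open>Q = s \<cdot> z\<close> this shows that \<open>h\<close> and \<open>s\<close> are the same subobject.\<close>
  have fixed: "Q \<cdot> h = h" if Q: "Q \<in> Mor X X" "Q \<cdot> i = i" "Q \<cdot> j = j" for Q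
  proof -
    note [simp] = MorD[OF Q(1)]
    have "Q \<cdot> a = (Q \<cdot> i) \<cdot> p" by (simp add: a_def)
    then have Qa: "Q \<cdot> a = a" unfolding Q(2) by (simp add: a_def)
    have "Q \<cdot> \<gamma> = (Q \<cdot> a) \<cdot> \<gamma>" using a\<gamma> by simp
    then have Q\<gamma>: "Q \<cdot> \<gamma> = \<gamma>" unfolding Qa using a\<gamma> by simp
    have "Q \<cdot> (\<gamma> \<cdot> a) = (Q \<cdot> \<gamma>) \<cdot> a" by simp
    then have "Q \<cdot> a' = a'" unfolding Q\<gamma> by (simp add: a'_def Qa)
    then have "Q \<cdot> i' = i'" using a'i' Cmp_assoc_Arr[of i' a' Q] by simp
    then show ?thesis
      using Q(3) Cmp_assoc_Arr[of p1 i' Q] Cmp_assoc_Arr[of q1 j Q] by (simp add: h_def)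
  qed
  have "(s \<cdot> z) \<cdot> h = h"
    by (rule fixed) (simp_all add: in_Mor_iff \<open>(s \<cdot> z) \<cdot> i = i\<close>[simplified] \<open>(s \<cdot> z) \<cdot> j = j\<close>[simplified])
  then have "h \<cdot> (w0 \<cdot> (z \<cdot> h)) = h \<cdot> idt S0"
    using Cmp_assoc_Arr[of "z \<cdot> h" w0 h] by (simp add: w0(2)[symmetric])
  then have inv: "w0 \<cdot> (z \<cdot> h) = idt S0"
    by (rule monic_cancel[OF monic, of _ _ S0]) (simp_all add: in_Mor_iff)
  have "ptrace X (s \<cdot> z) = ptrace X (h \<cdot> (w0 \<cdot> z))" by (simp add: w0(2))
  also have "\<dots> = ptrace S0 ((w0 \<cdot> z) \<cdot> h)" by (rule ptrace_cyclic) (simp_all add: in_Mor_iff)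
  also have "(w0 \<cdot> z) \<cdot> h = (i1 \<cdot> p1) \<boxplus> (j1 \<cdot> q1)" using inv S0(10) by simp
  also have "ptrace S0 \<dots> = ptrace S0 (i1 \<cdot> p1) + ptrace S0 (j1 \<cdot> q1)"
    by (rule ptrace_Add) (simp_all add: in_Mor_iff)
  also have "ptrace S0 (i1 \<cdot> p1) = ptrace X (i' \<cdot> p')"
    using ptrace_cyclic[OF S0(4,2)] ptrace_cyclic[OF K(3,2)] S0(6) K(4) by simp
  also have "ptrace S0 (j1 \<cdot> q1) = ptrace X (j \<cdot> q)"
    using ptrace_cyclic[OF S0(5,3)] ptrace_cyclic[OF q j] S0(7) by simp
  finally show "ptrace X (s \<cdot> z) = ptrace X (i \<cdot> p) + ptrace X (j \<cdot> q) - ptrace X (k \<cdot> r)"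
    unfolding K(5) a'(2) a_def \<gamma>_def by simp
  assume P: "P \<in> Mor X X" "P \<cdot> (i \<cdot> p) = i \<cdot> p" "P \<cdot> (j \<cdot> q) = j \<cdot> q"
  note [simp] = MorD[OF P(1)]
  have "P \<cdot> i = (P \<cdot> (i \<cdot> p)) \<cdot> i" by simp
  then have Pi: "P \<cdot> i = i" unfolding P(2) by simp
  have "P \<cdot> j = (P \<cdot> (j \<cdot> q)) \<cdot> j" by simp
  then have Pj: "P \<cdot> j = j" unfolding P(3) by simp
  have "P \<cdot> s = (P \<cdot> h) \<cdot> w0" by (simp add: w0(2))
  then have "P \<cdot> s = s" unfolding fixed[OF P(1) Pi Pj] by (simp add: w0(2))
  then show "P \<cdot> (s \<cdot> z) = s \<cdot> z" using Cmp_assoc_Arr[of z s P] by simp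
qed

text \<open>
  Both factors of \<open>c\<close> through its kernel compose to zero in the other order.
\<close>

lemma ptrace_square_zero:
  assumes c: "c \<in> Mor X X" and cc: "c \<cdot> c = Zer C X X"
  shows "ptrace X c = 0"
proof -
  note [simp] = MorD[OF c]
  obtain k where k: "is_kernel C c k" using kernel_exists[of c] by auto
  define K where "K = Dom C k"
  have km: "k \<in> Mor K X" using k by (simp add: is_kernel_def in_Mor_iff K_def)
  note [simp] = MorD[OF km]
  obtain u where u: "u \<in> Mor X K" "k \<cdot> u = c"
    using kernel_factor[OF k, of c X] c cc unfolding K_def[symmetric] by auto
  note [simp] = MorD[OF u(1)]
  have "k \<cdot> (u \<cdot> k) = c \<cdot> k" using u(2) Cmp_assoc_Arr[of k u k] by simp
  also have "\<dots> = k \<cdot> Zer C K K" using k by (simp add: is_kernel_def)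
  finally have "u \<cdot> k = Zer C K K"
    by (rule monic_cancel[OF kernel_monic[OF k], of _ _ K]) (simp_all add: in_Mor_iff)
  then show ?thesis using ptrace_cyclic[OF u(1) km] u(2) ptrace_Zer[of K] by simp
qed

end

section \<open>Products of Frobenius subalgebras\<close>

locale connected_positive_frobenius = weakly_positive_category C D \<phi> + frobenius_in_category C F
  for C :: "('o, 'm) tcat" (structure) and D \<phi> F +
  assumes connected: "connected_frob C F"
    and phi_multiplicative: "multiplicative C F F (phi_frob C D \<phi> F)"
begin

abbreviation psi where "psi \<equiv> phi_frob C D \<phi> F"

text \<open>
  The comparison of \<open>X\<close>, as its own Frobenius dual, with the chosen dual; it is the dual of the identity.
\<close>

definition theta where "theta = dual_arr C (D X) fd (idt X)"

lemma theta_mor: "theta \<in> Mor X (dob (D X))"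
  using dual_arr_mor[OF X_Ob X_Ob D_dual[OF X_Ob] fd_dual Idt_mor[OF X_Ob]] by (simp add: theta_def)

definition theta_dual where "theta_dual = dual_arr C fd (DD X) theta"

lemma theta_dual_mor: "theta_dual \<in> Mor (dob (DD X)) X"
  using dual_arr_mor[OF X_Ob _ fd_dual _ theta_mor, of "DD X"] by (simp add: theta_dual_def)

lemma psi_eq: "psi = theta_dual \<cdot> \<phi> X"
  by (simp add: phi_frob_def ddual_arr_def theta_dual_def theta_def)

lemmas psi_simps [simp] = MorD(1-3)[OF theta_mor] MorD(1-3)[OF theta_dual_mor]

lemma psi_mor: "psi \<in> Mor X X"
  by (simp add: psi_eq in_Mor_iff)

text \<open>
  Naturality of \<open>\<phi>\<close> turns \<open>a\<close> into its double dual with respect to the chosen duals, and the comparison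
  arrows turn that into the double dual with respect to the Frobenius selfduality, which is \<open>a\<close>.
\<close>

lemma psi_commute:
  assumes a: "frob_idem a"
  shows "psi \<cdot> a = a \<cdot> psi"
proof -
  note [simp] = frob_idemD(1-3)[OF a]
  let ?a = "dual_arr C (D X) (D X) a"
  let ?aa = "dual_arr C (DD X) (DD X) ?a"
  have D: "left_dual C X (D X)" "left_dual C (dob (D X)) (DD X)" "dob (D X) \<in> Ob C" by simp_all
  have am: "?a \<in> Mor (dob (D X)) (dob (D X))"
    by (rule dual_arr_mor[OF X_Ob X_Ob D(1) D(1) frob_idemD(7)[OF a]])
  have aam: "?aa \<in> Mor (dob (DD X)) (dob (DD X))"
    by (rule dual_arr_mor[OF D(3) D(3) D(2) D(2) am])
  note [simp] = MorD(1-3)[OF am] MorD(1-3)[OF aam]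
  have "?a \<cdot> theta = dual_arr C (D X) fd (idt X \<cdot> a)"
    unfolding theta_def
    by (rule dual_arr_comp[OF X_Ob X_Ob X_Ob D(1) D(1) fd_dual frob_idemD(7)[OF a] Idt_mor[OF X_Ob],
          symmetric])
  also have "idt X \<cdot> a = a \<cdot> idt X" by simp
  also have "dual_arr C (D X) fd (a \<cdot> idt X) = theta \<cdot> dual_arr C fd fd a"
    unfolding theta_def
    by (rule dual_arr_comp[OF X_Ob X_Ob X_Ob D(1) fd_dual fd_dual Idt_mor[OF X_Ob] frob_idemD(7)[OF a]])
  finally have eq: "?a \<cdot> theta = theta \<cdot> a" using a by (simp add: frob_idem_def)
  have "theta_dual \<cdot> ?aa = dual_arr C fd (DD X) (?a \<cdot> theta)"
    unfolding theta_dual_def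
    by (rule dual_arr_comp[OF X_Ob D(3) D(3) fd_dual D(2) D(2) theta_mor am, symmetric])
  also have "\<dots> = dual_arr C fd fd a \<cdot> theta_dual"
    unfolding eq theta_dual_def
    by (rule dual_arr_comp[OF X_Ob X_Ob D(3) fd_dual fd_dual D(2) frob_idemD(7)[OF a] theta_mor])
  finally have eq2: "theta_dual \<cdot> ?aa = a \<cdot> theta_dual" using a by (simp add: frob_idem_def)
  have "\<phi> X \<cdot> a = ?aa \<cdot> \<phi> X"
    using phi_natural[OF frob_idemD(7)[OF a]] by (simp add: ddual_arr_def)
  then have "psi \<cdot> a = (theta_dual \<cdot> ?aa) \<cdot> \<phi> X" by (simp add: psi_eq)
  also have "\<dots> = a \<cdot> psi" unfolding eq2 by (simp add: psi_eq)
  finally show ?thesis .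
qed

text \<open>The trace is a loop drawn with the selfduality of the Frobenius algebra.\<close>

lemma ptrace_loop:
  assumes f: "f \<in> Mor X X"
  shows "ptrace X f = loop (psi \<cdot> f)"
proof -
  note [simp] = MorD[OF f]
  have D: "left_dual C X (D X)" "left_dual C (dob (D X)) (DD X)" "dob (D X) \<in> Ob C" by simp_all
  have coev: "dcoev (D X) = (idt X \<boxtimes> theta) \<cdot> cup"
    using dual_arr_dcoev[OF X_Ob X_Ob D(1) fd_dual Idt_mor[OF X_Ob]]
    by (simp add: theta_def TensM_Idt)
  have ev: "dev (DD X) \<cdot> (idt (dob (DD X)) \<boxtimes> theta) = (ct \<cdot> mu) \<cdot> (theta_dual \<boxtimes> idt X)"
    using dual_arr_dev[OF X_Ob D(3) fd_dual D(2) theta_mor] by (simp add: theta_dual_def)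
  have "trace C D X (\<phi> X \<cdot> f)
      = dev (DD X) \<cdot> ((((\<phi> X \<cdot> f) \<boxtimes> idt (dob (D X))) \<cdot> (idt X \<boxtimes> theta)) \<cdot> cup)"
    unfolding trace_def coev by simp
  also have "((\<phi> X \<cdot> f) \<boxtimes> idt (dob (D X))) \<cdot> (idt X \<boxtimes> theta)
      = (idt (dob (DD X)) \<boxtimes> theta) \<cdot> ((\<phi> X \<cdot> f) \<boxtimes> idt X)"
    by (simp add: interchange_Arr)
  also have "dev (DD X) \<cdot> (((idt (dob (DD X)) \<boxtimes> theta) \<cdot> ((\<phi> X \<cdot> f) \<boxtimes> idt X)) \<cdot> cup)
      = (dev (DD X) \<cdot> (idt (dob (DD X)) \<boxtimes> theta)) \<cdot> (((\<phi> X \<cdot> f) \<boxtimes> idt X) \<cdot> cup)"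
    by simp
  also have "\<dots> = (ct \<cdot> mu) \<cdot> (((theta_dual \<boxtimes> idt X) \<cdot> ((\<phi> X \<cdot> f) \<boxtimes> idt X)) \<cdot> cup)"
    unfolding ev by simp
  also have "(theta_dual \<boxtimes> idt X) \<cdot> ((\<phi> X \<cdot> f) \<boxtimes> idt X) = (psi \<cdot> f) \<boxtimes> idt X"
    by (simp add: interchange_Arr psi_eq)
  finally show ?thesis
    by (simp add: ptrace_def loop_def emul_def psi_eq)
qed

text \<open>
  Connectedness: every arrow from the unit object to \<open>X\<close> is a multiple of the unit of the algebra.
\<close>

lemma unit_scalar:
  assumes nz: "idt X \<noteq> Zer C X X" and g: "g \<in> Mor \<I> X"
  shows "un \<noteq> Zer C \<I> X" "\<exists>k. g = Scl C k un"
proof -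
  show un: "un \<noteq> Zer C \<I> X"
  proof
    assume z: "un = Zer C \<I> X"
    have "idt X = Scl C 0 un \<bullet> idt X" using emul_unit(1)[of "idt X"] z by simp
    also have "\<dots> = Scl C 0 (un \<bullet> idt X)" by (rule emul_Scl(1)) simp_all
    also have "\<dots> = Zer C X X" by (simp add: emul_unit)
    finally show False using nz by simp
  qed
  obtain v where v: "v 0 \<in> Mor \<I> X"
    and span: "\<And>f. f \<in> Mor \<I> X \<Longrightarrow> \<exists>c. f = lsum C \<I> X (\<lambda>i. Scl C (c i) (v i)) 1"
    using mor_dim_spanning[OF Uni_Ob X_Ob connected[unfolded connected_frob_def]] by auto
  note [simp] = MorD(1-3)[OF v]
  have span': "\<exists>c. f = Scl C c (v 0)" if f: "f \<in> Mor \<I> X" for f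
  proof -
    obtain c where "f = lsum C \<I> X (\<lambda>i. Scl C (c i) (v i)) 1" using span[OF f] by blast
    then show ?thesis by (intro exI[of _ "c 0"]) simp
  qed
  obtain c0 where c0: "un = Scl C c0 (v 0)" using span'[OF funit_mor] by blast
  obtain c where c: "g = Scl C c (v 0)" using span'[OF g] by blast
  have "c0 \<noteq> 0" using un c0 by auto
  then have "g = Scl C (c / c0) un" unfolding c c0 by simp
  then show "\<exists>k. g = Scl C k un" by blast
qed

lemma Scl_unit_inject:
  assumes "idt X \<noteq> Zer C X X" "Scl C k un = Scl C l un"
  shows "k = l"
proof (rule ccontr)
  assume kl: "k \<noteq> l"
  have "Scl C (k - l) un = Scl C k un \<boxplus> Scl C (-1) (Scl C l un)"
    using Scl_plus[of un k "- l"] by simp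
  also have "\<dots> = Zer C \<I> X" unfolding assms(2) by (simp del: Scl_Scl)
  finally have "Scl C (1 / (k - l)) (Scl C (k - l) un) = Scl C (1 / (k - l)) (Zer C \<I> X)" by simp
  then have "un = Zer C \<I> X" using kl by simp
  then show False using unit_scalar(1)[OF assms(1) funit_mor] by simp
qed

text \<open>
  The product of two Frobenius subalgebras with idempotents \<open>a\<close> and \<open>b\<close> is cut out by a multiple
  \<open>P\<close> of \<open>conv a b\<close>. The twisted convolution \<open>conv (\<psi> \<cdot> a) b\<close> produces the trace of \<open>a \<cdot> b\<close>, and
  comparing both on the unit shows that it has the same scalar as \<open>conv a b\<close>, or the scalar zero.
\<close>

lemma product_idempotent:
  assumes nz: "idt X \<noteq> Zer C X X" and a: "frob_idem a" and b: "frob_idem b"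
  shows "\<exists>P. P \<in> Mor X X \<and> P \<cdot> P = P \<and> P \<cdot> a = a \<and> P \<cdot> b = b \<and>
    (ptrace X (a \<cdot> b) = 0 \<or> ptrace X (a \<cdot> b) * ptrace X P = ptrace X a * ptrace X b)"
proof -
  note am = frob_idemD(7)[OF a] and bm = frob_idemD(7)[OF b] and pm = psi_mor
  note [simp] = frob_idemD(1-5)[OF a] frob_idemD(1-5)[OF b] MorD(1-3)[OF pm]
  let ?f = "psi \<cdot> a"
  have fm: "?f \<in> Mor X X" by (simp add: in_Mor_iff)
  have aa: "multiplicative_over a a"
    by (simp add: multiplicative_over_def frob_idem_left_module[OF a])
  have psi_emul: "psi \<cdot> (r \<bullet> s) = (psi \<cdot> r) \<bullet> (psi \<cdot> s)"
    if "r \<in> Arr C" "s \<in> Arr C" "Cod C r = X" "Cod C s = X" for r s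
  proof -
    have "psi \<cdot> (r \<bullet> s) = (psi \<cdot> mu) \<cdot> (r \<boxtimes> s)" using that by (simp add: emul_def)
    also have "psi \<cdot> mu = mu \<cdot> (psi \<boxtimes> psi)" using phi_multiplicative by (simp add: multiplicative_def)
    finally show ?thesis using that by (simp add: emul_def interchange_Arr)
  qed
  have fa: "multiplicative_over a ?f"
    by (simp add: multiplicative_over_def frob_idem_left_module[OF a] psi_emul)
  have af: "a \<cdot> ?f = ?f"
    using psi_commute[OF a] Cmp_assoc_Arr[of psi a a] by simp
  note c0m = conv_mor[OF am bm] and c1m = conv_mor[OF fm bm]
  note [simp] = MorD(1-3)[OF c0m] MorD(1-3)[OF c1m]
  obtain k0 where k0: "conv a b \<cdot> un = Scl C k0 un"
    using unit_scalar(2)[OF nz, of "conv a b \<cdot> un"] by (auto simp: in_Mor_iff)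
  obtain k1 where k1: "conv ?f b \<cdot> un = Scl C k1 un"
    using unit_scalar(2)[OF nz, of "conv ?f b \<cdot> un"] by (auto simp: in_Mor_iff)
  have c00: "conv a b \<cdot> conv a b = Scl C k0 (conv a b)"
    using conv_conv[OF am am a b aa _ k0] by simp
  have c10: "conv ?f b \<cdot> conv a b = Scl C k1 (conv ?f b)"
    using conv_conv[OF fm am a b fa _ k1] by simp
  have "(conv ?f b \<cdot> conv a b) \<cdot> un = Scl C (k0 * k1) un"
    by (simp add: k0 k1)
  then have "Scl C (k1 * k1) un = Scl C (k0 * k1) un"
    unfolding c10 by (simp add: k1)
  then have "k1 * k1 = k0 * k1" by (rule Scl_unit_inject[OF nz])
  then have k1_cases: "k1 = 0 \<or> k1 = k0" by simp
  let ?\<eta> = "scalar (ct \<cdot> un)"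
  have tr: "ptrace X (a \<cdot> b) = k1 * ?\<eta>"
    using loop_conv_unit[OF fm b k1] by (simp add: ptrace_loop in_Mor_iff)
  obtain w where w: "((psi \<cdot> b) \<bullet> idt X) \<cdot> cup = Scl C w un"
    using unit_scalar(2)[OF nz, of "((psi \<cdot> b) \<bullet> idt X) \<cdot> cup"] by (auto simp: in_Mor_iff)
  have pc: "psi \<cdot> conv a b = conv (psi \<cdot> a) (psi \<cdot> b)"
    using psi_emul[of a b] Cmp_assoc_Arr[of dl "a \<bullet> b" psi] by (simp add: conv_def)
  have pbm: "psi \<cdot> b \<in> Mor X X" by (simp add: in_Mor_iff)
  have "ptrace X (conv a b) = w * ptrace X a"
    using loop_conv(1)[OF fm pbm w] by (simp add: ptrace_loop c0m am pc)
  moreover have "ptrace X b = w * ?\<eta>"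
    using loop_conv(2)[OF fm pbm w] by (simp add: ptrace_loop bm)
  ultimately have prod: "ptrace X (conv a b) * ?\<eta> = ptrace X a * ptrace X b" by simp
  have un: "un \<noteq> Zer C \<I> X" by (rule unit_scalar(1)[OF nz funit_mor])
  have pos: "ptrace X c \<noteq> 0" if "frob_idem c" for c
  proof -
    have "c \<noteq> Zer C X X" using frob_idemD(5)[OF that] un by auto
    then show ?thesis using ptrace_idempotent_pos[of c X] frob_idemD[OF that] by auto
  qed
  have "k0 \<noteq> 0"
  proof
    assume "k0 = 0"
    then have "ptrace X (conv a b) = 0" using c00 by (intro ptrace_square_zero[OF c0m]) simp
    then show False using prod pos[OF a] pos[OF b] by simp
  qed
  let ?P = "Scl C (1 / k0) (conv a b)"
  have "?P \<in> Mor X X" "?P \<cdot> ?P = ?P" using \<open>k0 \<noteq> 0\<close> by (simp_all add: in_Mor_iff c00)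
  moreover have "?P \<cdot> a = a" using \<open>k0 \<noteq> 0\<close> conv_unit_left_module[OF am a bm aa k0] by simp
  moreover have "?P \<cdot> b = b" using \<open>k0 \<noteq> 0\<close> conv_unit_right_module[OF am b k0] by simp
  moreover have "ptrace X (a \<cdot> b) = 0 \<or> ptrace X (a \<cdot> b) * ptrace X ?P = ptrace X a * ptrace X b"
    using k1_cases tr prod \<open>k0 \<noteq> 0\<close> by (auto simp: ptrace_Scl[OF c0m] mult.commute)
  ultimately show ?thesis by blast
qed

end

section \<open>Finiteness of coherent sublattices\<close>

lemma ambiently_selfdual_retraction:
  assumes "ambiently_selfdual C d k"
  shows "\<exists>r. k \<in> mor C (Dom C k) (Cod C k) \<and> r \<in> mor C (Cod C k) (Dom C k) \<and>
    r \<cdot>\<^bsub>C\<^esub> k = Idt C (Dom C k)"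
  using assms unfolding ambiently_selfdual_def splits_def by (auto simp: mor_def)

text \<open>
  With \<open>s\<close> and \<open>t'\<close> replaced by \<open>t\<close> the estimate would read \<open>t * (t + \<epsilon>) \<le> t * t\<close>. Allowing for the
  errors, it gives \<open>t * \<epsilon> < \<delta> * (3 * t + \<epsilon>)\<close>, and \<open>\<delta>\<close> is so small that the right-hand side is at most
  \<open>\<epsilon>\<^sup>2\<close>, hence at most \<open>t * \<epsilon>\<close>.
\<close>

lemma estimate_gap:
  fixes t t' s g \<epsilon> \<delta> M :: real
  assumes "0 < \<epsilon>" "\<epsilon> \<le> t" "t \<le> M" "\<delta> = \<epsilon>\<^sup>2 / (4 * (2 * M + \<epsilon>))"
    and "\<bar>s - t\<bar> < \<delta>" "\<bar>t' - t\<bar> < 2 * \<delta>" "0 \<le> s"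
    and "s * (t + t' - g) \<le> t * t'" "g \<le> t' - \<epsilon>"
  shows False
proof -
  have M: "0 < M" "0 < 2 * M + \<epsilon>" using assms(1-3) by linarith+
  then have "0 < \<delta>" using assms(1,4) by simp
  have "s * (t + \<epsilon>) \<le> s * (t + t' - g)" using assms(7,9) by (intro mult_left_mono) linarith+
  also have "\<dots> \<le> t * (t + 2 * \<delta>)"
    using assms(1,2,6,8) mult_left_mono[of t' "t + 2 * \<delta>" t] by linarith
  finally have 1: "s * (t + \<epsilon>) \<le> t * (t + 2 * \<delta>)" .
  have "(t - \<delta>) * (t + \<epsilon>) < s * (t + \<epsilon>)"
    using assms(1,2,5) by (intro mult_strict_right_mono) linarith+
  then have "(t - \<delta>) * (t + \<epsilon>) < t * (t + 2 * \<delta>)" using 1 by linarith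
  then have "t * \<epsilon> < \<delta> * (3 * t + \<epsilon>)" by (simp add: algebra_simps)
  moreover have "\<epsilon> * \<epsilon> \<le> t * \<epsilon>" using assms(1,2) by (intro mult_right_mono) linarith+
  moreover have "\<delta> * (3 * t + \<epsilon>) \<le> \<delta> * (4 * (2 * M + \<epsilon>))"
  proof (rule mult_left_mono)
    have "3 * t \<le> 3 * M" using assms(3) by simp
    then show "3 * t + \<epsilon> \<le> 4 * (2 * M + \<epsilon>)" using M(1) assms(1) by (simp add: algebra_simps)
  qed (use \<open>0 < \<delta>\<close> in simp)
  moreover have "\<delta> * (4 * (2 * M + \<epsilon>)) = \<epsilon> * \<epsilon>"
    using M unfolding assms(4) by (simp add: power2_eq_square)
  ultimately show False by linarith
qed

context connected_positive_frobenius
begin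

text \<open>
  This plays the role of the bound on the angle between two intermediate subfactors. The sum \<open>A + B\<close> is
  contained in the product of \<open>A\<close> and \<open>B\<close>, which bounds its trace; the witness \<open>g\<close> is the trace of
  \<open>A \<inter> B\<close>. The number \<open>\<epsilon>\<close> separates \<open>g\<close> from the traces of \<open>A\<close> and \<open>B\<close> unless one contains the other.
\<close>

lemma coherent_pair_estimate:
  assumes nz: "idt X \<noteq> Zer C X X"
    and A: "(G1, i) \<in> frob_subs C F" and B: "(G2, j) \<in> frob_subs C F"
    and coh: "coherent_pair C fd i j"
    and lower: "\<And>e. e \<in> Mor X X \<Longrightarrow> e \<cdot> e = e \<Longrightarrow> e \<noteq> Zer C X X \<Longrightarrow> \<epsilon> \<le> Re (ptrace X e)"
  defines "a \<equiv> sub_idem C F (G1, i)" and "b \<equiv> sub_idem C F (G2, j)"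
  shows "Im (ptrace X (a \<cdot> b)) = 0 \<and> 0 \<le> Re (ptrace X (a \<cdot> b)) \<and>
    (\<exists>g. Re (ptrace X (a \<cdot> b)) * (Re (ptrace X a) + Re (ptrace X b) - g)
        \<le> Re (ptrace X a) * Re (ptrace X b) \<and>
      g \<le> Re (ptrace X a) \<and> g \<le> Re (ptrace X b) \<and>
      (g = Re (ptrace X a) \<or> g \<le> Re (ptrace X a) - \<epsilon>) \<and>
      (g = Re (ptrace X b) \<or> g \<le> Re (ptrace X b) - \<epsilon>) \<and>
      (g = Re (ptrace X a) \<and> g = Re (ptrace X b) \<longrightarrow> a = b))"
proof -
  obtain n where n: "mor_dim C X X n" using mor_finite_dim[of X X] by auto
  interpret PT: positive_trace C X "ptrace X" n by (rule positive_trace) (simp_all add: n)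
  define p where "p = dual_arr C (frob_dual C G1) fd i"
  define q where "q = dual_arr C (frob_dual C G2) fd j"
  have a_eq: "a = i \<cdot> p" and b_eq: "b = j \<cdot> q" by (simp_all add: a_def b_def p_def q_def sub_idem_def)
  have A': "frobenius_subalgebra C F G1 i" and B': "frobenius_subalgebra C F G2 j"
    using A B by (simp_all add: frob_subs_def)
  note As = frobenius_subalgebra_idem[OF A', folded p_def, folded a_eq]
    and Bs = frobenius_subalgebra_idem[OF B', folded q_def, folded b_eq]
  note a = As(1) and b = Bs(1)
  note [simp] = frob_idemD(1-4)[OF a] frob_idemD(1-4)[OF b] MorD[OF As(2)] MorD[OF Bs(2)]
  obtain k s where k: "sub_meet C i j k" "ambiently_selfdual C fd k"
    and s: "sub_join C i j s" "ambiently_selfdual C fd s"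
    using coh unfolding coherent_pair_def by blast
  have "Cod C k = X" "Cod C s = X" using k(1) s(1) by (simp_all add: sub_meet_def sub_join_def)
  then obtain G r S z where r: "k \<in> Mor G X" "r \<in> Mor X G" "r \<cdot> k = idt G"
    and z: "s \<in> Mor S X" "z \<in> Mor X S" "z \<cdot> s = idt S"
    using ambiently_selfdual_retraction[OF k(2)] ambiently_selfdual_retraction[OF s(2)] by auto
  note join = ptrace_sub_join[OF As(2-4) Bs(2-4) r k(1) z s(1), folded a_eq b_eq]
  let ?\<gamma> = "k \<cdot> r" and ?\<sigma> = "s \<cdot> z"
  note [simp] = MorD(1-3)[OF r(1)] MorD(1-3)[OF r(2)] MorD(1-3)[OF z(1)] MorD(1-3)[OF z(2)]
  have idem: "PT.idem a" "PT.idem b" "PT.idem ?\<gamma>" "PT.idem ?\<sigma>"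
    by (simp_all add: PT.idem_def in_Mor_iff retraction_cancel[OF r] retraction_cancel[OF z])
  obtain P where P: "P \<in> Mor X X" "P \<cdot> P = P" "P \<cdot> a = a" "P \<cdot> b = b"
    "ptrace X (a \<cdot> b) = 0 \<or> ptrace X (a \<cdot> b) * ptrace X P = ptrace X a * ptrace X b"
    using product_idempotent[OF nz a b] by blast
  have Pi: "PT.idem P" using P by (simp add: PT.idem_def)
  define g where "g = Re (ptrace X ?\<gamma>)"
  note real = PT.T_idem[OF idem(1)] PT.T_idem[OF idem(2)] PT.T_idem[OF idem(3)] PT.T_idem[OF Pi]
  have le: "Re (ptrace X a) + Re (ptrace X b) - g \<le> Re (ptrace X P)"
    using PT.T_mono[OF Pi idem(4) join(2)[OF P(1,3,4)]] unfolding join(1) g_def by simp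
  have ineq: "Im (ptrace X (a \<cdot> b)) = 0 \<and> 0 \<le> Re (ptrace X (a \<cdot> b)) \<and>
    Re (ptrace X (a \<cdot> b)) * (Re (ptrace X a) + Re (ptrace X b) - g) \<le> Re (ptrace X a) * Re (ptrace X b)"
  proof (cases "ptrace X (a \<cdot> b) = 0")
    case True
    then show ?thesis using real by simp
  next
    case False
    then have eq: "ptrace X (a \<cdot> b) * ptrace X P = ptrace X a * ptrace X b" using P(5) by blast
    have un: "un \<noteq> Zer C \<I> X" by (rule unit_scalar(1)[OF nz funit_mor])
    have "P \<cdot> un = un" using P(1) Cmp_assoc_Arr[of un a P] frob_idemD(5)[OF a] P(3) MorD[OF P(1)] by simp
    then have "P \<noteq> Zer C X X" using un by auto
    then have pos: "Re (ptrace X P) > 0" using PT.idem_nonzero_iff[OF Pi] by simp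
    have im: "Im (ptrace X (a \<cdot> b)) * Re (ptrace X P) = 0"
      using arg_cong[OF eq, of Im] real by simp
    have re: "Re (ptrace X (a \<cdot> b)) * Re (ptrace X P) = Re (ptrace X a) * Re (ptrace X b)"
      using arg_cong[OF eq, of Re] real by simp
    have ge: "0 \<le> Re (ptrace X (a \<cdot> b))"
    proof (rule ccontr)
      assume "\<not> ?thesis"
      then have "Re (ptrace X (a \<cdot> b)) * Re (ptrace X P) < 0" using pos by (simp add: mult_neg_pos)
      moreover have "0 \<le> Re (ptrace X a) * Re (ptrace X b)" using real by simp
      ultimately show False using re by simp
    qed
    then show ?thesis using im pos re mult_left_mono[OF le ge] by simp
  qed
  obtain u v where uv: "u \<in> Mor G (fob G1)" "v \<in> Mor G (fob G2)" "i \<cdot> u = k" "j \<cdot> v = k"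
    using k(1) unfolding sub_meet_def by auto
  note [simp] = MorD[OF uv(1)] MorD[OF uv(2)] MorD[OF As(3)] MorD[OF Bs(3)]
  have "(i \<cdot> p) \<cdot> (i \<cdot> u) = i \<cdot> u" "(j \<cdot> q) \<cdot> (j \<cdot> v) = j \<cdot> v"
    by (simp_all add: retraction_cancel[OF As(2-4)] retraction_cancel[OF Bs(2-4)])
  then have ak: "a \<cdot> k = k" and bk: "b \<cdot> k = k" unfolding a_eq[symmetric] b_eq[symmetric] uv by simp_all
  have a\<gamma>: "a \<cdot> ?\<gamma> = ?\<gamma>" and b\<gamma>: "b \<cdot> ?\<gamma> = ?\<gamma>"
    using ak bk Cmp_assoc_Arr[of r k a] Cmp_assoc_Arr[of r k b] by simp_all
  \<comment> \<open>The complement of the intersection in \<open>c\<close> vanishes or has trace at least \<open>\<epsilon>\<close>.\<close>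
  have gap: "g \<le> Re (ptrace X c) \<and> (g = Re (ptrace X c) \<or> g \<le> Re (ptrace X c) - \<epsilon>) \<and>
    (g = Re (ptrace X c) \<longrightarrow> ?\<gamma> \<cdot> c = c)"
    if c: "PT.idem c" and c\<gamma>: "c \<cdot> ?\<gamma> = ?\<gamma>" for c
  proof -
    note [simp] = PT.idemD(1-3)[OF c]
    let ?c = "c \<boxplus> Scl C (-1) (?\<gamma> \<cdot> c)"
    note rc = PT.relative_complement[OF c idem(3) c\<gamma>]
    show ?thesis
    proof (cases "?c = Zer C X X")
      case True
      have "c = ?\<gamma> \<cdot> c"
        by (rule Add_right_cancel[of _ "Scl C (-1) (?\<gamma> \<cdot> c)" _ X X]) (use True in \<open>simp_all add: in_Mor_iff\<close>)
      moreover have "ptrace X c = ptrace X ?\<gamma>" using rc(2) PT.T_Zer True by simp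
      ultimately show ?thesis by (simp add: g_def)
    next
      case False
      have "Re (ptrace X ?c) > 0" using False PT.idem_nonzero_iff[OF rc(1)] by simp
      moreover have "\<epsilon> \<le> Re (ptrace X ?c)"
        using lower[of ?c] False PT.idemD(4,5)[OF rc(1)] by blast
      ultimately show ?thesis unfolding rc(2) g_def by simp
    qed
  qed
  have "a = b" if "g = Re (ptrace X a)" "g = Re (ptrace X b)"
  proof -
    have 1: "?\<gamma> \<cdot> a = a" "?\<gamma> \<cdot> b = b" using gap[OF idem(1) a\<gamma>] gap[OF idem(2) b\<gamma>] that by blast+
    have "b \<cdot> a = (b \<cdot> ?\<gamma>) \<cdot> a" using 1 by simp
    then have "b \<cdot> a = a" unfolding b\<gamma> using 1 by simp
    moreover have "a \<cdot> b = (a \<cdot> ?\<gamma>) \<cdot> b" using 1 by simp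
    then have "a \<cdot> b = b" unfolding a\<gamma> using 1 by simp
    ultimately show ?thesis using frob_idem_eqI[OF a b] by simp
  qed
  then show ?thesis using ineq gap[OF idem(1) a\<gamma>] gap[OF idem(2) b\<gamma>] by blast
qed

text \<open>
  Two close rows of the matrix \<open>s\<close> produce \<open>j \<noteq> l\<close> for which \<open>s j l\<close> is close to both \<open>t j\<close> and \<open>t l\<close>,
  against the estimate.
\<close>

lemma coherent_family_finite:
  assumes sub: "S \<subseteq> frob_subs C F"
    and coh: "\<And>A B. A \<in> S \<Longrightarrow> B \<in> S \<Longrightarrow> coherent_pair C fd (snd A) (snd B)"
  shows "finite (sub_idem C F ` S)"
proof (rule ccontr)
  assume inf: "infinite (sub_idem C F ` S)"
  obtain n where n: "mor_dim C X X n" using mor_finite_dim[of X X] by auto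
  interpret PT: positive_trace C X "ptrace X" n by (rule positive_trace) (simp_all add: n)
  obtain a :: "nat \<Rightarrow> 'm" where a: "inj a" "range a \<subseteq> sub_idem C F ` S"
    using infinite_countable_subset[OF inf] by blast
  have "\<forall>j::nat. \<exists>A. A \<in> S \<and> a j = sub_idem C F A" using a(2) by blast
  then obtain A where A: "\<And>j. A j \<in> S" "\<And>j. a j = sub_idem C F (A j)"
    using choice[of "\<lambda>j A. A \<in> S \<and> a j = sub_idem C F A"] by auto
  have frob: "frob_idem (a j)" for j
  proof -
    have "frobenius_subalgebra C F (fst (A j)) (snd (A j))"
      using A(1)[of j] sub by (auto simp: frob_subs_def)
    then show ?thesis using frobenius_subalgebra_idem(1) A(2)[of j] by (simp add: sub_idem_def)
  qed
  note am = frob_idemD(7)[OF frob]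
  \<comment> \<open>Over a zero object all endomorphisms coincide.\<close>
  have nz: "idt X \<noteq> Zer C X X"
  proof
    assume z: "idt X = Zer C X X"
    have "a j = Zer C X X" for j
    proof -
      have "a j = idt X \<cdot> a j" using MorD[OF am[of j]] by simp
      then show ?thesis unfolding z using MorD[OF am[of j]] by simp
    qed
    then have "a 0 = a 1" by simp
    then show False using a(1) by (auto dest: injD)
  qed
  have idem: "PT.idem (a j)" for j using frob_idemD(4,7)[OF frob[of j]] by (simp add: PT.idem_def)
  have anz: "a j \<noteq> Zer C X X" for j
    using frob_idemD(5)[OF frob[of j]] unit_scalar(1)[OF nz funit_mor] by auto
  obtain \<epsilon> where \<epsilon>: "\<epsilon> > 0" "\<And>e. PT.idem e \<Longrightarrow> e \<noteq> Zer C X X \<Longrightarrow> \<epsilon> \<le> Re (ptrace X e)"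
    using PT.idempotent_trace_lower_bound by blast
  define t where "t j = Re (ptrace X (a j))" for j
  define s where "s j l = ptrace X (a j \<cdot> a l)" for j l
  define M where "M = Re (ptrace X (idt X))"
  have tM: "t j \<le> M" and te: "\<epsilon> \<le> t j" for j
    using PT.T_mono[of "idt X" "a j"] idem[of j] MorD[OF am[of j]] \<epsilon>(2)[OF idem anz]
    by (simp_all add: t_def M_def PT.idem_def in_Mor_iff)
  have est: "Im (s j l) = 0 \<and> 0 \<le> Re (s j l) \<and>
    (\<exists>g. Re (s j l) * (t j + t l - g) \<le> t j * t l \<and> g \<le> t j \<and> g \<le> t l \<and>
      (g = t j \<or> g \<le> t j - \<epsilon>) \<and> (g = t l \<or> g \<le> t l - \<epsilon>) \<and> (g = t j \<and> g = t l \<longrightarrow> a j = a l))" for j l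
  proof -
    have pr: "(fst (A j), snd (A j)) \<in> frob_subs C F" "(fst (A l), snd (A l)) \<in> frob_subs C F"
      using A(1) sub by auto
    show ?thesis
      using coherent_pair_estimate[OF nz pr coh[OF A(1) A(1)], of \<epsilon>] \<epsilon>(2)
      by (simp add: t_def s_def A(2) PT.idem_def)
  qed
  have diag: "s j j = complex_of_real (t j)" for j
    using PT.T_idem[OF idem[of j]] frob_idemD(4)[OF frob[of j]] by (simp add: s_def t_def complex_eq_iff)
  have sym: "s j l = s l j" for j l unfolding s_def by (rule PT.T_cyclic[OF am am])
  \<comment> \<open>The estimate with \<open>g \<le> t j\<close> bounds the matrix entries.\<close>
  have bound: "norm (s j l) \<le> M" for j l
  proof -
    obtain g where g: "Re (s j l) * (t j + t l - g) \<le> t j * t l" "g \<le> t j"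
      using est[of j l] by blast
    have pos: "0 < t l" using te[of l] \<epsilon>(1) by linarith
    have "Re (s j l) * t l \<le> Re (s j l) * (t j + t l - g)"
      using est[of j l] g(2) by (intro mult_left_mono) auto
    then have "Re (s j l) * t l \<le> t j * t l" using g(1) by linarith
    then have "Re (s j l) \<le> t j" using pos by simp
    moreover have "norm (s j l) = Re (s j l)"
      using est[of j l] by (simp add: cmod_def)
    ultimately show ?thesis using tM[of j] by simp
  qed
  define \<delta> where "\<delta> = \<epsilon>\<^sup>2 / (4 * (2 * M + \<epsilon>))"
  have M: "0 < M" using tM[of 0] te[of 0] \<epsilon>(1) by linarith
  then have \<delta>: "\<delta> > 0" using \<epsilon>(1) by (simp add: \<delta>_def)
  obtain x y where xy: "\<And>j l. s j l = (\<Sum>i<n. x i j * y i l)"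
    using PT.trace_form_finite_rank[of a, OF am] unfolding s_def by blast
  obtain j l where jl: "j \<noteq> l" "\<And>k. norm (s j k - s l k) < \<delta>"
    using bounded_finite_rank_close_rows[of "{..<n}" s M x y, OF finite_lessThan bound xy \<delta>] by blast
  have close: "\<bar>t j - Re (s j l)\<bar> < \<delta>" "\<bar>Re (s j l) - t l\<bar> < \<delta>"
    using jl(2)[of j] jl(2)[of l] abs_Re_le_cmod[of "s j j - s l j"] abs_Re_le_cmod[of "s j l - s l l"]
    by (simp_all add: diag sym[of l j])
  obtain g where g: "Re (s j l) * (t j + t l - g) \<le> t j * t l" "g \<le> t j" "g \<le> t l"
    "g = t j \<or> g \<le> t j - \<epsilon>" "g = t l \<or> g \<le> t l - \<epsilon>" "g = t j \<and> g = t l \<longrightarrow> a j = a l"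
    using est[of j l] by blast
  have "a j \<noteq> a l" using a(1) jl(1) by (auto dest: injD)
  then consider "g \<le> t l - \<epsilon>" | "g \<le> t j - \<epsilon>" using g by blast
  then show False
  proof cases
    case 1
    show False
      by (rule estimate_gap[of \<epsilon> "t j" M \<delta> "Re (s j l)" "t l" g])
        (use 1 \<epsilon>(1) te tM \<delta>_def close g(1) est[of j l] in auto)
  next
    case 2
    show False
      by (rule estimate_gap[of \<epsilon> "t l" M \<delta> "Re (s j l)" "t j" g])
        (use 2 \<epsilon>(1) te tM \<delta>_def close g(1) est[of j l] in \<open>auto simp: algebra_simps\<close>)
  qed
qed

end

theorem corollary9p10:
  fixes C :: "('o, 'm) tcat" and D :: "'o \<Rightarrow> ('o, 'm) dual" and \<phi> :: "'o \<Rightarrow> 'm"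
    and X :: "('o, 'm) frob" and L :: "(('o, 'm) frob \<times> 'm) set set"
  assumes "weakly_positive_category C D \<phi>"
    and "frobenius_algebra C X"
    and "connected_frob C X"
    and "multiplicative C X X (phi_frob C D \<phi> X)"
    and "coherent_sublattice C X L"
  shows "finite L"
proof -
  interpret W: weakly_positive_category C D \<phi> by (rule assms(1))
  interpret P: connected_positive_frobenius C D \<phi> X
    by (intro connected_positive_frobenius.intro connected_positive_frobenius_axioms.intro
        frobenius_in_category.intro assms W.tensor_category_axioms)
  interpret S: coherent_sublattice C X L by (rule assms(5))
  let ?S = "{A \<in> frob_subs C X. sub_class C X A \<in> L}"
  have fin: "finite (sub_idem C X ` ?S)"
    by (rule P.coherent_family_finite) (use S.L_coherent in auto)
  have rep: "\<exists>A. A \<in> ?S \<and> Q = sub_class C X A" if "Q \<in> L" for Q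
  proof -
    have "Q \<in> frob_subs C X // sub_rel C X" using that S.L_sub by (auto simp: frob_poset_def)
    then obtain A where "A \<in> frob_subs C X" "Q = sub_rel C X `` {A}" by (rule quotientE)
    then show ?thesis using that unfolding sub_class_def by blast
  qed
  have cls: "sub_class C X A = {B \<in> frob_subs C X. sub_idem C X B = sub_idem C X A}"
    if "A \<in> frob_subs C X" for A
    using that by (auto simp: sub_class_def sub_rel_def)
  have "L \<subseteq> (\<lambda>e. {B \<in> frob_subs C X. sub_idem C X B = e}) ` (sub_idem C X ` ?S)"
  proof
    fix Q assume "Q \<in> L"
    then obtain A where A: "A \<in> ?S" "Q = sub_class C X A" using rep by blast
    then have "Q = {B \<in> frob_subs C X. sub_idem C X B = sub_idem C X A}" using cls by simp
    then show "Q \<in> (\<lambda>e. {B \<in> frob_subs C X. sub_idem C X B = e}) ` (sub_idem C X ` ?S)"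
      using A(1) by blast
  qed
  then show ?thesis by (rule finite_subset) (rule finite_imageI[OF fin])
qed

end
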